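(* Let $v$ be the fixed point with $z_1(v)=0$ in the $\gimel$-orbit of a $1$-singular point, let $\mathcal D_v$ be the universal ring of $v$, let $\mathcal B_v$ be the set of local distributions $D^1_\sigma,D^2_{\sigma'}$ defined in the context, and let $S$ be the complex vector space spanned by $\mathcal B_v$. For every $\sum_i h_i\sigma_i\in\mathcal D_v$ (finite sum, the $\sigma_i\in\gimel$ distinct) one has, as functionals on $H^0(W,\mathcal O^{G_v})$, $$ev_v\circ\Big(\sum_i h_i\sigma_i\Big)=\sum_i g_i(v)\,D^2_{\sigma_i}+\sum_i\frac{\partial g_i}{\partial z_1}(v)\,D^1_{\sigma_i},\qquad g_i=z_1h_i .$$ (If $h_i$ is holomorphic at $v$, then $g_i(v)=0$ and $\frac{\partial g_i}{\partial z_1}(v)=h_i(v)$.) Therefore $S$ is a $\mathcal D_v$-module, with action $A\cdot D=D\circ A$ for $A\in\mathcal D_v$, $D\in S$ (a left module over $(\mathcal D_v,* )$), and with basis $\mathcal B_v$.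
   Context: Tableaux and groups. Let $n\ge 2$ and let $V\simeq\mathbb C^{n(n+1)/2}$ be the complex manifold of tableaux $x=(x_{ki})_{1\le i\le k\le n}$ of complex numbers. Let $\gimel\simeq\mathbb Z^{n(n-1)/2}$ be the free abelian group generated by $\sigma_{st}$, $1\le t\le s\le n-1$, acting on $V$ by letting $\sigma_{st}$ add $1$ to the coordinate $x_{st}$ and fix all other coordinates. Let $G=S_1\times\cdots\times S_n$ (product of symmetric groups) act on $V$ by $(s(x))_{ki}=x_{k\,s_k(i)}$. Let $\mathcal M,\mathcal O$ be the sheaves of meromorphic and holomorphic functions on $V$. For a function $f$, $s\in G$, $\sigma\in\gimel$ put $\sigma(f)=f\circ\sigma^{-1}$, $s(f)=f\circ s^{-1}$, $s(\sigma)=s\circ\sigma\circ s^{-1}\in\gimel$. The ring $\mathcal R$. $\mathcal R$ is the set of finite formal sums $\sum_i f_i\sigma_i$ with $f_i$ meromorphic on $V$ and $\sigma_i\in\gimel$ (the free module over meromorphic functions with basis $\gimel$), with the skew group ring multiplication $(\sum_i f_i\sigma_i)\circ(\sum_j f'_j\sigma'_j)=\sum_{i,j}f_i\,\sigma_i(f'_j)\,\sigma_i\circ\sigma'_j$. A second multiplication is $A*B:=B\circ A$. $G$ acts on $\mathcal R$ by $s(\sum f_i\sigma_i)=\sum s(f_i)s(\sigma_i)$. The point $v$. A point $x^0\in V$ is $1$-singular if there are a row $k$ and indices $i\neq j$ such that $x^0_{ki}-x^0_{kj}\in\mathbb Z$ and $x^0_{rs}-x^0_{rt}\notin\mathbb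 Z$ for all $r$ and $s\ne t$ with $(r,\{s,t\})\neq(k,\{i,j\})$. Fix such $x^0$ and $k,i,j$. Put $z_1=x_{ki}-x_{kj}$, $z_2=x_{ki}+x_{kj}$, and let $z_3,z_4,\dots$ be the remaining coordinates $x_{st}$; $(z_1,z_2,\dots)$ are coordinates on $V$, and $\partial/\partial z_1$ is taken in these coordinates. Fix a point $v\in\gimel(x^0)$ with $z_1(v)=0$. Let $\tau\in G$ be the element with $\tau(z_1)=-z_1$, $\tau(z_l)=z_l$ for $l>1$ (the transposition of $i,j$ in row $k$). The stabilizer of $v$ in $G$ is $G_v=\{\mathrm{id},\tau\}$. Fix a sufficiently small open neighborhood $W$ of the orbit $\gimel(v)$, invariant under $\gimel$ and $\tau$; sufficiently small means in particular that the functions $x_{rs}-x_{rt}$, $s\ne t$, $(r,\{s,t\})\ne(k,\{i,j\})$, have no zeros in $W$. Elements of $\mathcal R$ are considered restricted to $W$. $\mathcal R^{G_v}$ denotes the $G_v$-invariants in $\mathcal R$, and $H^0(W,\mathcal O^{G_v})$ the $\tau$-invariant holomorphic functions on $W$. The universal ring. $\mathcal D_v\subset\mathcal R^{G_v}$ is the subring generated by all elements of $\mathcal R^{G_v}$ of the form $\sum_i (H_i/z_1)\sigma_i$ (finite sum) with $H_i$ holomorphic in $W$. For every $\sum_i h_i\sigma_i\in\mathcal D_v$ the functions $z_1h_i$ are holomorphic at $v$. $\mathcal D_v$ acts on $H^0(W,\mathcal O^{G_v})$ by $(f\sigma)(F)=f\cdot(F\circ\sigma^{-1})$ extended additively. For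 a linear functional $D$ on $H^0(W,\mathcal O^{G_v})$ and $A\in\mathcal D_v$, $D\circ A$ is the functional $F\mapsto D(A(F))$. $ev_v$ is evaluation at $v$. The distributions. For $\sigma,\sigma'\in\gimel$ with $\tau(\sigma')\neq\sigma'$ define functionals on $H^0(W,\mathcal O^{G_v})$: $D^1_\sigma=\frac12\,ev_v\circ(\sigma+\tau(\sigma))$, $D^2_{\sigma'}=ev_v\circ\frac{\sigma'-\tau(\sigma')}{2z_1}$; by convention $D^2_{\sigma}=0$ if $\tau(\sigma)=\sigma$. Let $\Delta$ be the set of $\sigma\in\gimel$ which act on the pair of coordinates $(x_{ki},x_{kj})$ by $(x_{ki},x_{kj})\mapsto(x_{ki}+m_1,x_{kj}+m_2)$ with $m_1\le m_2$. Put $\mathcal B_v=\{D^1_\sigma,D^2_{\sigma'}\mid\sigma,\sigma'\in\Delta,\ \tau(\sigma')\ne\sigma'\}$ and let $S\subset H^0(W,\mathcal O^{G_v})^*$ be its linear span. *)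

theory Defs
  imports
    "HOL-Analysis.Analysis"
    "HOL-Library.Function_Algebras"
    "HOL-Combinatorics.Permutations"
    "HOL-Algebra.Generated_Rings"
    "HOL-Algebra.Module"
begin

text \<open>In this theory \<open>inv\<close> is the inverse of a function.\<close>

no_notation m_inv (\<open>(\<open>open_block notation=\<open>prefix inv\<close>\<close>inv\<index> _)\<close> [81] 80)

section \<open>Tableaux, shifts and permutations\<close>

text \<open>
  The rows are indexed by a finite linear order \<open>'n\<close> with \<open>n = CARD('n)\<close> elements (for instance
  the numeral type \<open>n\<close>), so that the row \<open>k\<close> has the positions \<open>(k, i)\<close> with \<open>i \<le> k\<close>.
\<close>

typedef (overloaded) 'n tpos = "{(k, i). i \<le> (k :: 'n::{finite,linorder})}"
  by auto

instance tpos :: ("{finite,linorder}") finite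
proof
  have "finite (Rep_tpos ` (UNIV :: 'a tpos set))"
    by (rule finite)
  then show "finite (UNIV :: 'a tpos set)"
    by (rule finite_imageD) (simp add: inj_on_def Rep_tpos_inject)
qed

text \<open>The value of \<open>tp k i\<close> is meaningful only for \<open>i \<le> k\<close>.\<close>

definition tp :: "'n::{finite,linorder} \<Rightarrow> 'n \<Rightarrow> 'n tpos"
  where "tp k i = Abs_tpos (k, i)"

definition trow :: "'n::{finite,linorder} tpos \<Rightarrow> 'n"
  where "trow p = fst (Rep_tpos p)"

definition tcol :: "'n::{finite,linorder} tpos \<Rightarrow> 'n"
  where "tcol p = snd (Rep_tpos p)"

type_synonym 'n tableau = "complex ^ 'n tpos"

text \<open>
  An element of the free abelian group of shifts is encoded by its integer exponents, that is by
  the integral tableau it adds.  The generators only move the rows below the last one, and the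
  composition of shifts is the addition of exponents.
\<close>

type_synonym 'n shift = "int ^ 'n tpos"

definition shifts :: "'n::{finite,linorder} shift set"
  where "shifts = {\<sigma>. \<forall>p. trow p = Max UNIV \<longrightarrow> \<sigma> $ p = 0}"

definition shift :: "'n::{finite,linorder} shift \<Rightarrow> 'n tableau \<Rightarrow> 'n tableau"
  where "shift \<sigma> x = (\<chi> p. x $ p + of_int (\<sigma> $ p))"

definition orbit :: "'n::{finite,linorder} tableau \<Rightarrow> 'n tableau set"
  where "orbit x = (\<lambda>\<sigma>. shift \<sigma> x) ` shifts"

definition row_perms :: "('n::{finite,linorder} \<Rightarrow> 'n \<Rightarrow> 'n) set"
  where "row_perms = {s. \<forall>k. s k permutes {..k}}"

definition permute :: "('n::{finite,linorder} \<Rightarrow> 'n \<Rightarrow> 'n) \<Rightarrow> 'a ^ 'n tpos \<Rightarrow> 'a ^ 'n tpos"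
  where "permute s x = (\<chi> p. x $ tp (trow p) (s (trow p) (tcol p)))"

lemma trow_tp [simp]: "i \<le> k \<Longrightarrow> trow (tp k i) = k"
  and tcol_tp [simp]: "i \<le> k \<Longrightarrow> tcol (tp k i) = i"
  by (simp_all add: trow_def tcol_def tp_def Abs_tpos_inverse)

lemma tcol_le_trow: "tcol p \<le> trow p"
  using Rep_tpos[of p] by (auto simp: trow_def tcol_def)

lemma tp_trow_tcol [simp]: "tp (trow p) (tcol p) = p"
  by (simp add: trow_def tcol_def tp_def Rep_tpos_inverse)

lemma bij_permute:
  assumes "s \<in> row_perms"
  shows "bij (permute s)"
proof (rule o_bij)
  have s: "s k permutes {..k}" for k
    using assms by (simp add: row_perms_def)
  have le: "s (trow p) (tcol p) \<le> trow p" for p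
    using permutes_in_image[OF s, of "trow p" "tcol p"] tcol_le_trow[of p] by simp
  have le': "inv (s (trow p)) (tcol p) \<le> trow p" for p
    using permutes_in_image[OF permutes_inv[OF s], of "trow p" "tcol p"] tcol_le_trow[of p] by simp
  show "permute (\<lambda>k. inv (s k)) \<circ> permute s = id"
    by (auto simp: fun_eq_iff vec_eq_iff permute_def le le' permutes_inverses[OF s])
  show "permute s \<circ> permute (\<lambda>k. inv (s k)) = id"
    by (auto simp: fun_eq_iff vec_eq_iff permute_def le le' permutes_inverses[OF s])
qed

text \<open>
  Consequently the conjugate of a shift by \<open>s\<close> is the shift whose exponents are permuted by \<open>s\<close>.
\<close>

lemma shift_permute:
  assumes "s \<in> row_perms"
  shows "shift (permute s \<sigma>) = permute s \<circ> shift \<sigma> \<circ> inv (permute s)"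
proof
  fix x
  have "permute s (shift \<sigma> (inv (permute s) x)) = shift (permute s \<sigma>) (permute s (inv (permute s) x))"
    by (simp add: vec_eq_iff permute_def shift_def)
  then show "shift (permute s \<sigma>) x = (permute s \<circ> shift \<sigma> \<circ> inv (permute s)) x"
    by (simp add: bij_permute[OF assms] bij_is_surj surj_f_inv_f)
qed

definition row_swap :: "'n \<Rightarrow> 'n \<Rightarrow> 'n \<Rightarrow> 'n::{finite,linorder} \<Rightarrow> 'n \<Rightarrow> 'n"
  where "row_swap k i j r = (if r = k then Transposition.transpose i j else id)"

definition stab :: "'n::{finite,linorder} tableau \<Rightarrow> ('n \<Rightarrow> 'n \<Rightarrow> 'n) set"
  where "stab v = {s \<in> row_perms. permute s v = v}"

definition one_singular :: "'n::{finite,linorder} tableau \<Rightarrow> 'n \<Rightarrow> 'n \<Rightarrow> 'n \<Rightarrow> bool"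
  where "one_singular x k i j \<longleftrightarrow>
    i \<le> k \<and> j \<le> k \<and> i \<noteq> j \<and> x $ tp k i - x $ tp k j \<in> \<int> \<and>
    (\<forall>r s t. s \<le> r \<and> t \<le> r \<and> s \<noteq> t \<and> (r, {s, t}) \<noteq> (k, {i, j}) \<longrightarrow>
      x $ tp r s - x $ tp r t \<notin> \<int>)"

definition z1 :: "'n::{finite,linorder} \<Rightarrow> 'n \<Rightarrow> 'n \<Rightarrow> 'n tableau \<Rightarrow> complex"
  where "z1 k i j x = x $ tp k i - x $ tp k j"

text \<open>
  The partial derivative with respect to \<open>z1\<close>, the other coordinates being the sum
  \<open>x $ tp k i + x $ tp k j\<close> and the remaining entries of the tableau.
\<close>

definition dz1 ::
    "'n::{finite,linorder} \<Rightarrow> 'n \<Rightarrow> 'n \<Rightarrow> ('n tableau \<Rightarrow> complex) \<Rightarrow> 'n tableau \<Rightarrow> complex"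
  where "dz1 k i j f x =
    deriv (\<lambda>t. f (x + t *s (axis (tp k i) (1/2) - axis (tp k j) (1/2)))) 0"


section \<open>Holomorphic and meromorphic functions of several variables\<close>

definition holo_on :: "(complex ^ 'p \<Rightarrow> complex) \<Rightarrow> (complex ^ 'p) set \<Rightarrow> bool"
  where "holo_on f U \<longleftrightarrow> open U \<and>
    (\<forall>x\<in>U. \<exists>L. (f has_derivative L) (at x) \<and> (\<forall>c h. L (c *s h) = c * L h))"

definition holo_at :: "(complex ^ 'p \<Rightarrow> complex) \<Rightarrow> complex ^ 'p \<Rightarrow> bool"
  where "holo_at f x \<longleftrightarrow> (\<exists>U. x \<in> U \<and> holo_on f U)"

text \<open>
  A meromorphic function on an open set \<open>W\<close> is represented by a total function, taken in a normal
  form: at the points of \<open>W\<close> where the meromorphic function is holomorphic the representative has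
  the value of the holomorphic extension; at all other points, and outside \<open>W\<close>, it is \<open>0\<close>.  Thus
  equality of meromorphic functions is equality of representatives, and the algebraic operations
  are the pointwise operations followed by \<open>mero_nf\<close>.
\<close>

definition holo_value :: "(complex ^ 'p \<Rightarrow> complex) \<Rightarrow> complex ^ 'p \<Rightarrow> complex \<Rightarrow> bool"
  where "holo_value f x y \<longleftrightarrow>
    (\<exists>U g D. x \<in> U \<and> holo_on g U \<and> g x = y \<and>
      open D \<and> D \<subseteq> U \<and> U \<subseteq> closure D \<and> (\<forall>u\<in>D. f u = g u))"

definition mero_nf ::
    "(complex ^ 'p) set \<Rightarrow> (complex ^ 'p \<Rightarrow> complex) \<Rightarrow> complex ^ 'p \<Rightarrow> complex"
  where "mero_nf W f x =
    (if x \<in> W \<and> (\<exists>y. holo_value f x y) then THE y. holo_value f x y else 0)"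

definition mero :: "(complex ^ 'p) set \<Rightarrow> (complex ^ 'p \<Rightarrow> complex) set"
  where "mero W = {f. mero_nf W f = f \<and>
    (\<forall>x\<in>W. \<exists>U p q. x \<in> U \<and> holo_on p U \<and> holo_on q U \<and> U \<subseteq> closure {u\<in>U. q u \<noteq> 0} \<and>
      (\<forall>u\<in>U. q u \<noteq> 0 \<longrightarrow> f u = p u / q u))}"


section \<open>The skew group ring and the universal ring\<close>

text \<open>A formal sum is given by its coefficients \<open>A \<sigma>\<close>, of which only finitely many are nonzero.\<close>

type_synonym 'n fsum = "'n shift \<Rightarrow> 'n tableau \<Rightarrow> complex"

definition coeff_shift ::
    "'n::{finite,linorder} tableau set \<Rightarrow> ('n tableau \<Rightarrow> complex) \<Rightarrow> 'n shift \<Rightarrow> 'n fsum"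
  where "coeff_shift W f \<sigma> = (\<lambda>\<rho>. if \<rho> = \<sigma> then mero_nf W f else 0)"

definition skew_ring :: "'n::{finite,linorder} tableau set \<Rightarrow> 'n fsum ring"
  where "skew_ring W =
    \<lparr>carrier = {A. (\<forall>\<sigma>. A \<sigma> \<in> mero W) \<and> finite {\<sigma>. A \<sigma> \<noteq> 0} \<and> {\<sigma>. A \<sigma> \<noteq> 0} \<subseteq> shifts},
     mult = (\<lambda>A B \<rho>. mero_nf W (\<lambda>x.
       \<Sum>(\<sigma>, \<sigma>') | A \<sigma> \<noteq> 0 \<and> B \<sigma>' \<noteq> 0 \<and> \<sigma> + \<sigma>' = \<rho>. A \<sigma> x * B \<sigma>' (shift (- \<sigma>) x))),
     one = coeff_shift W (\<lambda>_. 1) 0,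
     zero = (\<lambda>_. 0),
     add = (\<lambda>A B \<sigma>. mero_nf W (\<lambda>x. A \<sigma> x + B \<sigma> x))\<rparr>"

definition fsum_perm :: "('n::{finite,linorder} \<Rightarrow> 'n \<Rightarrow> 'n) \<Rightarrow> 'n fsum \<Rightarrow> 'n fsum"
  where "fsum_perm s A = (\<lambda>\<sigma>. A (inv (permute s) \<sigma>) \<circ> inv (permute s))"

definition invariants ::
    "'n::{finite,linorder} tableau set \<Rightarrow> 'n tableau \<Rightarrow> 'n fsum set"
  where "invariants W v = {A \<in> carrier (skew_ring W). \<forall>s\<in>stab v. fsum_perm s A = A}"

definition univ_ring :: "'n::{finite,linorder} tableau set \<Rightarrow> 'n tableau \<Rightarrow>
    'n \<Rightarrow> 'n \<Rightarrow> 'n \<Rightarrow> 'n fsum ring"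
  where "univ_ring W v k i j = (skew_ring W)\<lparr>carrier := generate_ring (skew_ring W)
    {A \<in> invariants W v. \<forall>\<sigma>. \<exists>H. holo_on H W \<and> A \<sigma> = mero_nf W (\<lambda>x. H x / z1 k i j x)}\<rparr>"

definition opposite_ring :: "('a, 'b) ring_scheme \<Rightarrow> ('a, 'b) ring_scheme"
  where "opposite_ring R = R\<lparr>mult := (\<lambda>a b. b \<otimes>\<^bsub>R\<^esub> a)\<rparr>"

text \<open>The library's locale for modules requires a commutative ring of scalars.\<close>

locale left_module = R?: ring R + M?: abelian_group M
  for R :: "('a, 'c) ring_scheme" (structure) and M :: "('a, 'b, 'd) module_scheme" (structure) +
  assumes smult_closed:
      "\<lbrakk>a \<in> carrier R; x \<in> carrier M\<rbrakk> \<Longrightarrow> a \<odot>\<^bsub>M\<^esub> x \<in> carrier M"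
    and smult_l_distr:
      "\<lbrakk>a \<in> carrier R; b \<in> carrier R; x \<in> carrier M\<rbrakk> \<Longrightarrow>
      (a \<oplus>\<^bsub>R\<^esub> b) \<odot>\<^bsub>M\<^esub> x = a \<odot>\<^bsub>M\<^esub> x \<oplus>\<^bsub>M\<^esub> b \<odot>\<^bsub>M\<^esub> x"
    and smult_r_distr:
      "\<lbrakk>a \<in> carrier R; x \<in> carrier M; y \<in> carrier M\<rbrakk> \<Longrightarrow>
      a \<odot>\<^bsub>M\<^esub> (x \<oplus>\<^bsub>M\<^esub> y) = a \<odot>\<^bsub>M\<^esub> x \<oplus>\<^bsub>M\<^esub> a \<odot>\<^bsub>M\<^esub> y"
    and smult_assoc:
      "\<lbrakk>a \<in> carrier R; b \<in> carrier R; x \<in> carrier M\<rbrakk> \<Longrightarrow>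
      (a \<otimes>\<^bsub>R\<^esub> b) \<odot>\<^bsub>M\<^esub> x = a \<odot>\<^bsub>M\<^esub> (b \<odot>\<^bsub>M\<^esub> x)"
    and smult_one:
      "x \<in> carrier M \<Longrightarrow> \<one>\<^bsub>R\<^esub> \<odot>\<^bsub>M\<^esub> x = x"


section \<open>Local distributions\<close>

definition inv_holo ::
    "'n::{finite,linorder} tableau set \<Rightarrow> 'n tableau \<Rightarrow> ('n tableau \<Rightarrow> complex) set"
  where "inv_holo W v =
    {F. holo_on F W \<and> (\<forall>x. x \<notin> W \<longrightarrow> F x = 0) \<and> (\<forall>s\<in>stab v. F \<circ> inv (permute s) = F)}"

definition apply_fsum ::
    "'n::{finite,linorder} tableau set \<Rightarrow> 'n fsum \<Rightarrow> ('n tableau \<Rightarrow> complex) \<Rightarrow> 'n tableau \<Rightarrow> complex"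
  where "apply_fsum W A F = mero_nf W (\<lambda>x. \<Sum>\<sigma> | A \<sigma> \<noteq> 0. A \<sigma> x * F (shift (- \<sigma>) x))"

text \<open>
  A functional on a set of functions is represented by a function that vanishes outside this set.
\<close>

type_synonym 'n functional = "('n tableau \<Rightarrow> complex) \<Rightarrow> complex"

definition fscale :: "complex \<Rightarrow> ('b \<Rightarrow> complex) \<Rightarrow> 'b \<Rightarrow> complex"
  where "fscale c D = (\<lambda>F. c * D F)"

global_interpretation functional: vector_space fscale
  by unfold_locales (simp_all add: fscale_def fun_eq_iff algebra_simps)

definition dual :: "('b \<Rightarrow> complex) set \<Rightarrow> (('b \<Rightarrow> complex) \<Rightarrow> complex) set"
  where "dual H = {D. (\<forall>F. F \<notin> H \<longrightarrow> D F = 0) \<and>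
    (\<forall>F\<in>H. \<forall>G\<in>H. D (F + G) = D F + D G) \<and> (\<forall>c. \<forall>F\<in>H. D (fscale c F) = c * D F)}"

definition ev :: "'n::{finite,linorder} tableau set \<Rightarrow> 'n tableau \<Rightarrow> 'n functional"
  where "ev W v = (\<lambda>F. if F \<in> inv_holo W v then F v else 0)"

definition comp_fsum :: "'n::{finite,linorder} tableau set \<Rightarrow> 'n tableau \<Rightarrow>
    'n functional \<Rightarrow> 'n fsum \<Rightarrow> 'n functional"
  where "comp_fsum W v D A = (\<lambda>F. if F \<in> inv_holo W v then D (apply_fsum W A F) else 0)"

definition dist1 :: "'n::{finite,linorder} tableau set \<Rightarrow> 'n tableau \<Rightarrow>
    'n \<Rightarrow> 'n \<Rightarrow> 'n \<Rightarrow> 'n shift \<Rightarrow> 'n functional"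
  where "dist1 W v k i j \<sigma> = fscale (1/2) (comp_fsum W v (ev W v)
    (coeff_shift W (\<lambda>_. 1) \<sigma> \<oplus>\<^bsub>skew_ring W\<^esub> coeff_shift W (\<lambda>_. 1) (permute (row_swap k i j) \<sigma>)))"

definition dist2 :: "'n::{finite,linorder} tableau set \<Rightarrow> 'n tableau \<Rightarrow>
    'n \<Rightarrow> 'n \<Rightarrow> 'n \<Rightarrow> 'n shift \<Rightarrow> 'n functional"
  where "dist2 W v k i j \<sigma> =
    (if permute (row_swap k i j) \<sigma> = \<sigma> then 0
     else comp_fsum W v (ev W v)
       (coeff_shift W (\<lambda>x. 1 / (2 * z1 k i j x)) \<sigma> \<oplus>\<^bsub>skew_ring W\<^esub>
        coeff_shift W (\<lambda>x. - 1 / (2 * z1 k i j x)) (permute (row_swap k i j) \<sigma>)))"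

definition ordered_shifts :: "'n::{finite,linorder} \<Rightarrow> 'n \<Rightarrow> 'n \<Rightarrow> 'n shift set"
  where "ordered_shifts k i j = {\<sigma>\<in>shifts. \<sigma> $ tp k i \<le> \<sigma> $ tp k j}"

definition dist_basis :: "'n::{finite,linorder} tableau set \<Rightarrow> 'n tableau \<Rightarrow>
    'n \<Rightarrow> 'n \<Rightarrow> 'n \<Rightarrow> 'n functional set"
  where "dist_basis W v k i j =
    dist1 W v k i j ` ordered_shifts k i j \<union>
    dist2 W v k i j ` {\<sigma> \<in> ordered_shifts k i j. permute (row_swap k i j) \<sigma> \<noteq> \<sigma>}"

text \<open>The multiplicative part of a module record is not used by \<^locale>\<open>left_module\<close>.\<close>

definition dist_module :: "'n::{finite,linorder} tableau set \<Rightarrow> 'n tableau \<Rightarrow>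
    'n \<Rightarrow> 'n \<Rightarrow> 'n \<Rightarrow> ('n fsum, 'n functional) module"
  where "dist_module W v k i j =
    \<lparr>carrier = functional.span (dist_basis W v k i j), mult = undefined, one = undefined,
     zero = 0, add = (+), smult = (\<lambda>A D. comp_fsum W v D A)\<rparr>"

end

theory Submission
  imports Defs "HOL-Complex_Analysis.Cauchy_Integral_Formula"
begin

text \<open>
  Write \<open>z\<close> for the coordinate \<open>z1\<close> and \<open>\<tau>\<close> for the transposition, which changes the sign of \<open>z\<close>
  and fixes the hyperplane \<open>z = 0\<close> pointwise.  A generator of the universal ring, with coefficients
  \<open>H \<sigma> / z\<close>, maps an invariant holomorphic \<open>F\<close> to the quotient by \<open>z\<close> of the sum of the functions
  \<open>H \<sigma> x * F (x - \<sigma>)\<close>.  By invariance this sum changes sign under \<open>\<tau>\<close>, so it vanishes on the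
  hyperplane and is divisible by \<open>z\<close> (\<open>holo_on_division\<close>).  Hence the whole universal ring maps
  invariant holomorphic functions to such functions (\<open>D_action\<close>).

  This property alone limits the poles.  Products of generators have coefficients with poles on
  the hyperplanes where \<open>z\<close> is an integer, of some finite order (\<open>D_poles\<close>).  Suppose that the
  order at \<open>z = 0\<close> is \<open>n\<close> and that the \<open>p \<sigma>\<close> are \<open>z ^ n\<close> times the coefficients of \<open>A\<close>.  Along a line
  transversal to the hyperplane at a point \<open>u\<close> of it, the sum of the \<open>p \<sigma> (u + t e) * F (u - \<sigma> + t e)\<close>
  is \<open>t ^ n\<close> times a holomorphic function.  Comparing values and first derivatives at \<open>t = 0\<close> relates
  the numbers \<open>p \<sigma> u\<close> to the first order jets of \<open>F\<close> at the points \<open>u - \<sigma>\<close> (\<open>jet_identity\<close>).  Those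
  jets can be prescribed freely by invariant polynomials, up to the symmetry \<open>\<tau>\<close>
  (\<open>jet_interpolation\<close>), so for \<open>n \<ge> 2\<close> all the numbers vanish (\<open>numerators_vanish\<close>), the \<open>p \<sigma>\<close> are
  divisible by \<open>z\<close>, and \<open>n\<close> can be lowered until it is \<open>1\<close> (\<open>simple_poles\<close>).

  For \<open>n = 1\<close> and \<open>u = v\<close> the derivative at \<open>t = 0\<close> of the same sum is the value of \<open>A F\<close> at \<open>v\<close>, and
  the product rule gives the formula, because \<open>D\<^sup>1\<close> and \<open>D\<^sup>2\<close> of \<open>\<sigma>\<close> are the value and the
  \<open>z\<close>-derivative of \<open>F\<close> at \<open>v - \<sigma>\<close> (\<open>D1_eval\<close>, \<open>D2_eval\<close>).  Each of these distributions is itself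
  the composition of the evaluation at \<open>v\<close> with an element of the universal ring, so composing it
  further with the ring is again covered by the formula (\<open>span_comp\<close>).  Linear independence is
  once more the free choice of the jets.

  A meromorphic function is given by a normal form, and an identity between normal forms holds as
  soon as it holds on a dense open set.  Such sets form a filter, called \<open>generic\<close> below, which
  turns the ring axioms into pointwise calculations.
\<close>

section \<open>Holomorphic functions of several variables\<close>

lemma bounded_linear_smult_left: "bounded_linear (\<lambda>t::complex. t *s (h::complex^'p))"
  unfolding linear_conv_bounded_linear[symmetric]
  by (rule linearI) (auto simp: vec_eq_iff algebra_simps)

lemma has_field_derivative_line:
  fixes f :: "complex ^ 'p \<Rightarrow> complex"
  assumes "(f has_derivative L) (at (x + t *s h))" "\<And>c h. L (c *s h) = c * L h"
  shows "((\<lambda>t. f (x + t *s h)) has_field_derivative L h) (at t)"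
proof -
  have "((\<lambda>t. x + t *s h) has_derivative (\<lambda>t. t *s h)) (at t)"
    by (rule derivative_eq_intros bounded_linear_imp_has_derivative[OF bounded_linear_smult_left] refl | simp)+
  from has_derivative_compose[OF this assms(1)] show ?thesis
    by (simp add: has_field_derivative_def assms(2) mult.commute[of _ "L h"])
qed

lemma holo_on_imp_open: "holo_on f U \<Longrightarrow> open U"
  by (simp add: holo_on_def)

lemma holo_on_subset: "holo_on f U \<Longrightarrow> open V \<Longrightarrow> V \<subseteq> U \<Longrightarrow> holo_on f V"
  unfolding holo_on_def by blast

lemma holo_on_cong:
  assumes "holo_on f U" "\<And>x. x \<in> U \<Longrightarrow> f x = g x"
  shows "holo_on g U"
proof -
  have "(g has_derivative L) (at x)" if "(f has_derivative L) (at x)" "x \<in> U" for x L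
    using has_derivative_transform_within_open[OF that(1) _ that(2)] assms
    by (auto simp: holo_on_def)
  then show ?thesis using assms(1) unfolding holo_on_def by blast
qed

lemma holo_on_local:
  assumes "\<And>x. x \<in> U \<Longrightarrow> \<exists>V. x \<in> V \<and> holo_on f V" "open U"
  shows "holo_on f U"
  using assms unfolding holo_on_def by blast

lemma holo_on_imp_continuous_on: "holo_on f U \<Longrightarrow> continuous_on U f"
  unfolding holo_on_def
  by (meson continuous_at_imp_continuous_on has_derivative_continuous)

lemma holo_on_const: "open U \<Longrightarrow> holo_on (\<lambda>_. c) U"
  unfolding holo_on_def by (auto intro!: exI[of _ "\<lambda>_. 0"])

lemma holo_on_proj: "open U \<Longrightarrow> holo_on (\<lambda>x. x $ p) U"
  unfolding holo_on_def
  by (auto intro!: exI[of _ "\<lambda>x. x $ p"] bounded_linear_imp_has_derivative bounded_linear_vec_nth)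

lemma holo_on_add:
  assumes "holo_on f U" "holo_on g U"
  shows "holo_on (\<lambda>x. f x + g x) U"
  unfolding holo_on_def
proof (intro conjI ballI)
  show "open U" using assms by (simp add: holo_on_def)
  fix x assume "x \<in> U"
  with assms obtain L M where
    "(f has_derivative L) (at x)" "\<And>c h. L (c *s h) = c * L h"
    "(g has_derivative M) (at x)" "\<And>c h. M (c *s h) = c * M h"
    unfolding holo_on_def by meson
  then show "\<exists>L. ((\<lambda>x. f x + g x) has_derivative L) (at x) \<and> (\<forall>c h. L (c *s h) = c * L h)"
    by (intro exI[of _ "\<lambda>h. L h + M h"]) (auto intro!: derivative_intros simp: algebra_simps)
qed

lemma holo_on_mult:
  assumes "holo_on f U" "holo_on g U"
  shows "holo_on (\<lambda>x. f x * g x) U"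
  unfolding holo_on_def
proof (intro conjI ballI)
  show "open U" using assms by (simp add: holo_on_def)
  fix x assume "x \<in> U"
  with assms obtain L M where
    "(f has_derivative L) (at x)" "\<And>c h. L (c *s h) = c * L h"
    "(g has_derivative M) (at x)" "\<And>c h. M (c *s h) = c * M h"
    unfolding holo_on_def by meson
  then show "\<exists>L. ((\<lambda>x. f x * g x) has_derivative L) (at x) \<and> (\<forall>c h. L (c *s h) = c * L h)"
    by (intro exI[of _ "\<lambda>h. f x * M h + L h * g x"] conjI has_derivative_mult) (simp_all add: algebra_simps)
qed

lemma holo_on_cmult: "holo_on f U \<Longrightarrow> holo_on (\<lambda>x. c * f x) U"
  by (intro holo_on_mult holo_on_const holo_on_imp_open)

lemma holo_on_diff: "holo_on f U \<Longrightarrow> holo_on g U \<Longrightarrow> holo_on (\<lambda>x. f x - g x) U"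
  using holo_on_add[of f U "\<lambda>x. - 1 * g x"] holo_on_cmult[of g U "-1"] by simp

lemma holo_on_sum:
  assumes "open U" "\<And>a. a \<in> X \<Longrightarrow> holo_on (f a) U"
  shows "holo_on (\<lambda>x. \<Sum>a\<in>X. f a x) U"
  using assms by (induction X rule: infinite_finite_induct) (auto intro!: holo_on_add holo_on_const)

lemma holo_on_prod:
  assumes "open U" "\<And>a. a \<in> X \<Longrightarrow> holo_on (f a) U"
  shows "holo_on (\<lambda>x. \<Prod>a\<in>X. f a x) U"
  using assms by (induction X rule: infinite_finite_induct) (auto intro!: holo_on_mult holo_on_const)

lemma holo_on_power: "holo_on f U \<Longrightarrow> holo_on (\<lambda>x. f x ^ n) U"
  by (induction n) (auto intro: holo_on_mult holo_on_const holo_on_imp_open)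

lemma holo_on_inverse:
  assumes "holo_on f U" "\<And>x. x \<in> U \<Longrightarrow> f x \<noteq> 0"
  shows "holo_on (\<lambda>x. inverse (f x)) U"
  unfolding holo_on_def
proof (intro conjI ballI)
  show "open U" using assms by (simp add: holo_on_def)
  fix x assume x: "x \<in> U"
  with assms obtain L where
    "(f has_derivative L) (at x)" "\<And>c h. L (c *s h) = c * L h"
    unfolding holo_on_def by meson
  then show "\<exists>L. ((\<lambda>x. inverse (f x)) has_derivative L) (at x) \<and> (\<forall>c h. L (c *s h) = c * L h)"
    using assms(2)[OF x]
    by (intro exI[of _ "\<lambda>h. - (inverse (f x) * L h * inverse (f x))"])
       (auto intro!: derivative_eq_intros simp: algebra_simps)
qed

lemma holo_on_divide:
  "holo_on f U \<Longrightarrow> holo_on g U \<Longrightarrow> (\<And>x. x \<in> U \<Longrightarrow> g x \<noteq> 0) \<Longrightarrow> holo_on (\<lambda>x. f x / g x) U"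
  unfolding divide_inverse by (intro holo_on_mult holo_on_inverse)

text \<open>
  The substitution is only asked to have a complex linear derivative, so that the lemma covers shifts,
  permutations of the entries and projections along a line alike.
\<close>

lemma holo_on_compose:
  assumes "holo_on f U" "open V" "T ` V \<subseteq> U"
    and "\<And>x. x \<in> V \<Longrightarrow> (T has_derivative M) (at x)" "\<And>c h. M (c *s h) = c *s M h"
  shows "holo_on (\<lambda>x. f (T x)) V"
  unfolding holo_on_def
proof (intro conjI ballI)
  show "open V" by fact
  fix x assume x: "x \<in> V"
  with assms obtain L where L:
    "(f has_derivative L) (at (T x))" "\<And>c h. L (c *s h) = c * L h"
    unfolding holo_on_def by (meson image_subset_iff)
  show "\<exists>L. ((\<lambda>x. f (T x)) has_derivative L) (at x) \<and> (\<forall>c h. L (c *s h) = c * L h)"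
    using has_derivative_compose[OF assms(4)[OF x] L(1)] assms(5) L(2)
    by (intro exI[of _ "\<lambda>h. L (M h)"]) auto
qed

lemma holo_on_line:
  assumes "holo_on f U" "\<And>t. t \<in> X \<Longrightarrow> x + t *s h \<in> U"
  shows "(\<lambda>t. f (x + t *s h)) holomorphic_on X"
proof (rule holomorphic_onI)
  fix t assume "t \<in> X"
  with assms obtain L where
    "(f has_derivative L) (at (x + t *s h))" "\<And>c h. L (c *s h) = c * L h"
    unfolding holo_on_def by meson
  from has_field_derivative_line[OF this]
  show "(\<lambda>t. f (x + t *s h)) field_differentiable at t within X"
    using field_differentiable_at_within field_differentiable_def by blast
qed

lemma continuous_on_Pair_const: "continuous_on S (Pair a)"
  using continuous_on_Pair[OF continuous_on_const[of S a] continuous_on_id] by simp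

text \<open>
  The Cauchy estimate bounds the difference of two derivatives at \<open>0\<close> by the maximal difference of the
  functions on a circle, and this is small by compactness of the disc.
\<close>

lemma continuous_on_deriv_param:
  fixes \<phi> :: "'a::metric_space \<Rightarrow> complex \<Rightarrow> complex"
  assumes r: "r > 0" and cont: "continuous_on (P \<times> cball 0 r) (\<lambda>(p, s). \<phi> p s)"
    and holo: "\<And>p. p \<in> P \<Longrightarrow> \<phi> p holomorphic_on ball 0 r"
  shows "continuous_on P (\<lambda>p. deriv (\<phi> p) 0)"
  unfolding continuous_on_iff
proof (intro ballI allI impI)
  fix p0 and e :: real assume p0: "p0 \<in> P" and e: "e > 0"
  have "e * r / 2 > 0" using e r by simp
  then obtain X0 where X0: "p0 \<in> X0" "open X0"
    and le: "\<forall>p\<in>X0 \<inter> P. \<forall>s\<in>cball 0 r.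
      dist ((\<lambda>(p, s). \<phi> p s) (p, s)) ((\<lambda>(p, s). \<phi> p s) (p0, s)) \<le> e * r / 2"
    by (rule continuous_on_prod_compactE[OF cont compact_cball p0])
  obtain d where d: "d > 0" "ball p0 d \<subseteq> X0" using X0 openE by blast
  show "\<exists>d>0. \<forall>p\<in>P. dist p p0 < d \<longrightarrow> dist (deriv (\<phi> p) 0) (deriv (\<phi> p0) 0) < e"
  proof (intro exI[of _ d] conjI ballI impI)
    fix p assume p: "p \<in> P" "dist p p0 < d"
    then have pX: "p \<in> X0 \<inter> P" using d by (auto simp: dist_commute)
    have c: "continuous_on (cball 0 r) (\<phi> q)" if "q \<in> P" for q
      using continuous_on_compose2[OF cont continuous_on_Pair_const, of q "cball 0 r"] that by auto
    let ?D = "\<lambda>s. \<phi> p s - \<phi> p0 s"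
    have "cmod ((deriv ^^ 1) ?D 0) \<le> fact 1 * (e * r / 2) / r ^ 1"
    proof (rule Cauchy_inequality[OF _ _ r])
      show "?D holomorphic_on ball 0 r" "continuous_on (cball 0 r) ?D"
        using holo c p(1) p0 by (simp_all add: holomorphic_on_diff continuous_on_diff)
      fix s assume "cmod (0 - s) = r"
      then have "s \<in> cball 0 r" by simp
      then show "cmod (?D s) \<le> e * r / 2"
        using le pX by (simp add: dist_norm)
    qed
    moreover have "deriv ?D 0 = deriv (\<phi> p) 0 - deriv (\<phi> p0) 0"
      using holo[OF p(1)] holo[OF p0] r
      by (intro deriv_diff holomorphic_on_imp_differentiable_at[of _ "ball 0 r"]) simp_all
    ultimately have "dist (deriv (\<phi> p) 0) (deriv (\<phi> p0) 0) \<le> e / 2"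
      using r by (simp add: dist_norm)
    then show "dist (deriv (\<phi> p) 0) (deriv (\<phi> p0) 0) < e" using e by simp
  qed (use d in auto)
qed

lemma line_in_ball:
  fixes h :: "complex ^ 'p"
  assumes "R > 0"
  obtains r where "r > 0" "\<And>s. cmod s \<le> r \<Longrightarrow> norm (s *s h) < R"
proof -
  obtain K where K: "K > 0" "\<And>s. norm (s *s h) \<le> cmod s * K"
    using bounded_linear.pos_bounded[OF bounded_linear_smult_left] by blast
  show thesis
  proof
    show "R / (2 * K) > 0" using assms K by simp
    fix s :: complex assume "cmod s \<le> R / (2 * K)"
    then have "cmod s * K \<le> R / 2" using K by (simp add: field_simps)
    then show "norm (s *s h) < R" using K(2)[of s] assms by simp
  qed
qed

text \<open>
  Differentiation under the integral sign needs a continuous derivative, whereas \<open>holo_on\<close> only provides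
  a derivative at each point.  Applied componentwise, the previous continuity lemma closes this gap.
\<close>

lemma holo_on_integral:
  fixes K :: "complex ^ 'p \<Rightarrow> real \<Rightarrow> complex"
  assumes U: "open U" and holo: "\<And>t. t \<in> {0..1} \<Longrightarrow> holo_on (\<lambda>x. K x t) U"
    and cont: "continuous_on (U \<times> {0..1}) (\<lambda>(x, t). K x t)"
  shows "holo_on (\<lambda>x. integral {0..1} (K x)) U"
  unfolding holo_on_def
proof (intro conjI ballI)
  fix x0 assume x0: "x0 \<in> U"
  have "\<forall>x t. \<exists>L. x \<in> U \<and> t \<in> {0..1} \<longrightarrow>
      ((\<lambda>x. K x t) has_derivative L) (at x) \<and> (\<forall>c h. L (c *s h) = c * L h)"
    using holo unfolding holo_on_def by blast
  then have "\<exists>L. \<forall>x t. x \<in> U \<and> t \<in> {0..1} \<longrightarrow>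
      ((\<lambda>x. K x t) has_derivative L x t) (at x) \<and> (\<forall>c h. L x t (c *s h) = c * L x t h)"
    by (simp only: choice_iff)
  then obtain L where L: "\<And>x t. x \<in> U \<Longrightarrow> t \<in> {0..1} \<Longrightarrow> ((\<lambda>x. K x t) has_derivative L x t) (at x)"
    and Lc: "\<And>x t c h. x \<in> U \<Longrightarrow> t \<in> {0..1} \<Longrightarrow> L x t (c *s h) = c * L x t h"
    by blast
  obtain R where R: "R > 0" "ball x0 (2 * R) \<subseteq> U"
  proof -
    obtain R where "R > 0" "ball x0 R \<subseteq> U" using U x0 openE by blast
    then show thesis using that[of "R / 2"] by simp
  qed
  let ?V = "ball x0 R"
  have near: "x + y \<in> U" if "x \<in> ?V" "norm y < R" for x y
  proof -
    have "dist x0 (x + y) \<le> dist x0 x + dist x (x + y)" by (rule dist_triangle)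
    also have "\<dots> < 2 * R" using that by (simp add: dist_norm)
    finally show ?thesis using R by auto
  qed
  have VU: "?V \<subseteq> U" using near[of _ 0] R by auto
  have contL: "continuous_on (?V \<times> {0..1}) (\<lambda>(x, t). L x t h)" for h
  proof -
    obtain r where r: "r > 0" "\<And>s. cmod s \<le> r \<Longrightarrow> norm (s *s h) < R"
      using line_in_ball[OF R(1)] by blast
    have "continuous_on (?V \<times> {0..1}) (\<lambda>p. deriv ((\<lambda>p s. K (fst p + s *s h) (snd p)) p) 0)"
    proof (rule continuous_on_deriv_param[OF r(1)])
      have "continuous_on ((?V \<times> {0..1}) \<times> cball 0 r)
          (\<lambda>q. (\<lambda>(x, t). K x t) (fst (fst q) + snd q *s h, snd (fst q)))"
        using near r
        by (intro continuous_on_compose2[OF cont]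
              continuous_intros bounded_linear.continuous_on[OF bounded_linear_smult_left]) auto
      then show "continuous_on ((?V \<times> {0..1}) \<times> cball 0 r) (\<lambda>(p, s). K (fst p + s *s h) (snd p))"
        by (simp add: case_prod_unfold)
      fix p assume "p \<in> ?V \<times> {0..1::real}"
      then show "(\<lambda>s. K (fst p + s *s h) (snd p)) holomorphic_on ball 0 r"
        using near r by (intro holo_on_line[OF holo]) auto
    qed
    moreover have "deriv (\<lambda>s. K (x + s *s h) t) 0 = L x t h" if "x \<in> ?V" "t \<in> {0..1}" for x t
      using that VU L[of x t] Lc[of x t]
      by (intro DERIV_imp_deriv has_field_derivative_line) auto
    ultimately show ?thesis
      by (auto elim!: continuous_on_eq)
  qed
  have bl: "blinfun_apply (Blinfun (L x t)) = L x t" if "x \<in> U" "t \<in> {0..1}" for x t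
    using L[OF that] by (intro bounded_linear_Blinfun_apply) (rule has_derivative_bounded_linear)
  have contB: "continuous_on (?V \<times> cbox 0 1) (\<lambda>(x, t). Blinfun (L x t))"
  proof (rule continuous_on_blinfun_componentwise)
    fix h :: "complex ^ 'p"
    show "continuous_on (?V \<times> cbox 0 1) (\<lambda>q. blinfun_apply (case q of (x, t) \<Rightarrow> Blinfun (L x t)) h)"
      using VU by (intro continuous_on_eq[OF contL[of h, folded box_real(2)]]) (auto simp: bl subset_iff)
  qed
  have contK: "continuous_on {0..1} (K x)" if "x \<in> U" for x
    using continuous_on_compose2[OF cont continuous_on_Pair_const, of x "{0..1}"] that by auto
  have D: "((\<lambda>x. integral (cbox 0 1) (K x)) has_derivative
      integral (cbox 0 1) (\<lambda>t. Blinfun (L x0 t))) (at x0 within ?V)"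
  proof (rule leibniz_rule[OF _ _ contB])
    fix x t assume "x \<in> ?V" "t \<in> cbox (0::real) 1"
    then show "((\<lambda>x. K x t) has_derivative blinfun_apply (Blinfun (L x t))) (at x within ?V)"
      using L[of x t] VU by (auto simp: bl subset_iff intro: has_derivative_at_withinI)
  next
    fix x assume "x \<in> ?V"
    then show "K x integrable_on cbox 0 1"
      using contK VU by (intro integrable_continuous) auto
  qed (use R in auto)
  have int: "(\<lambda>t. Blinfun (L x0 t)) integrable_on cbox 0 1"
  proof -
    have "Pair x0 ` cbox 0 1 \<subseteq> ?V \<times> cbox (0::real) 1" using R by auto
    from continuous_on_compose2[OF contB continuous_on_Pair_const this] show ?thesis
      by (intro integrable_continuous) simp
  qed
  let ?L = "blinfun_apply (integral (cbox 0 1) (\<lambda>t. Blinfun (L x0 t)))"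
  have L': "?L h = integral {0..1} (\<lambda>t. L x0 t h)" for h
    unfolding blinfun_apply_integral[OF int] unfolding box_real
    by (rule integral_cong) (use x0 bl in auto)
  have "?L (c *s h) = c * ?L h" for c h
    unfolding L' integral_mult_right[symmetric]
    by (rule integral_cong) (use Lc[OF x0] in auto)
  moreover have "((\<lambda>x. integral {0..1} (K x)) has_derivative ?L) (at x0)"
    using D R by (simp add: at_within_open[of x0 ?V])
  ultimately show "\<exists>L. ((\<lambda>x. integral {0..1} (K x)) has_derivative L) (at x0) \<and>
      (\<forall>c h. L (c *s h) = c * L h)" by blast
qed (rule U)

section \<open>Division by a linear form\<close>

locale clinear_form =
  fixes z :: "complex ^ 'p \<Rightarrow> complex"
  assumes add: "z (x + y) = z x + z y" and scale: "z (c *s x) = c * z x"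
begin

lemma bounded_linear: "bounded_linear z"
  unfolding linear_conv_bounded_linear[symmetric]
proof (rule linearI)
  fix r :: real and x :: "complex ^ 'p"
  have "r *\<^sub>R x = complex_of_real r *s x"
    by (simp add: vec_eq_iff scaleR_conv_of_real[of _ "_::complex"])
  then show "z (r *\<^sub>R x) = r *\<^sub>R z x"
    by (simp add: scale scaleR_conv_of_real)
qed (rule add)

lemma holo: "open U \<Longrightarrow> holo_on z U"
  unfolding holo_on_def
  by (auto intro!: exI[of _ z] bounded_linear_imp_has_derivative bounded_linear simp: scale)

lemma holo_on_projection:
  assumes "holo_on f U" "open V" "\<And>x. x \<in> V \<Longrightarrow> x - z x *s e + a \<in> U"
  shows "holo_on (\<lambda>x. f (x - z x *s e + a)) V"
proof (rule holo_on_compose[OF assms(1,2)])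
  show "((\<lambda>x. x - z x *s e + a) has_derivative (\<lambda>h. h - z h *s e)) (at x)" for x
    by (auto intro!: derivative_eq_intros
          bounded_linear_imp_has_derivative bounded_linear_compose[OF bounded_linear_smult_left bounded_linear])
  show "c *s h - z (c *s h) *s e = c *s (h - z h *s e)" for c h
    by (simp add: scale vec_eq_iff algebra_simps)
qed (use assms(3) in auto)

lemma continuous_on_projection:
  "continuous_on U (\<lambda>x. x - z x *s e)"
  by (intro continuous_intros bounded_linear.continuous_on[OF bounded_linear_smult_left]
        bounded_linear.continuous_on[OF bounded_linear])

text \<open>
  Off the zero set of \<open>z\<close> the quotient \<open>\<psi>\<close> is \<open>f / z\<close>, and on it \<open>\<psi>\<close> has to be the derivative of \<open>f\<close> in the
  direction \<open>e\<close>.  Near a point of the zero set the Cauchy formula on the line through \<open>x\<close> in the direction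
  \<open>e\<close> expresses both cases by one integral, which depends holomorphically on \<open>x\<close>.
\<close>

lemma holo_on_division:
  assumes f: "holo_on f W" and e: "z e = 1" and f0: "\<And>x. x \<in> W \<Longrightarrow> z x = 0 \<Longrightarrow> f x = 0"
  obtains \<psi> where "holo_on \<psi> W" "\<And>x. x \<in> W \<Longrightarrow> f x = z x * \<psi> x"
proof
  note W = holo_on_imp_open[OF f]
  define \<psi> where "\<psi> x = (if z x = 0 then deriv (\<lambda>t. f (x + t *s e)) 0 else f x / z x)" for x
  show "f x = z x * \<psi> x" if "x \<in> W" for x
    using f0[OF that] by (simp add: \<psi>_def)
  have z_diff: "z (x - y) = z x - z y" for x y
    using bounded_linear by (simp add: linear_simps)
  show "holo_on \<psi> W"
  proof (rule holo_on_local[OF _ W])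
    fix u assume u: "u \<in> W"
    show "\<exists>V. u \<in> V \<and> holo_on \<psi> V"
    proof (cases "z u = 0")
      case False
      have "open (W \<inter> {x. z x \<noteq> 0})"
        using W holo_on_imp_continuous_on[OF holo[OF open_UNIV]]
        by (intro open_Int open_Collect_neq) auto
      then have "holo_on (\<lambda>x. f x / z x) (W \<inter> {x. z x \<noteq> 0})"
        by (intro holo_on_divide holo_on_subset[OF f] holo) auto
      then have "holo_on \<psi> (W \<inter> {x. z x \<noteq> 0})"
        by (rule holo_on_cong) (simp add: \<psi>_def)
      then show ?thesis using u False by (intro exI[of _ "W \<inter> {x. z x \<noteq> 0}"]) simp
    next
      case True
      obtain R where R: "R > 0" "ball u (2 * R) \<subseteq> W"
      proof -
        obtain R where "R > 0" "ball u R \<subseteq> W" using W u openE by blast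
        then show thesis using that[of "R / 2"] by simp
      qed
      obtain r0 where r0: "r0 > 0" "\<And>s. cmod s \<le> r0 \<Longrightarrow> norm (s *s e) < R"
        using line_in_ball[OF R(1)] by blast
      define r where "r = r0 / 2"
      have r: "r > 0" "r < r0" using r0 by (auto simp: r_def)
      \<comment> \<open>Every line in the direction \<open>e\<close> that meets \<open>V\<close> has a disc of radius \<open>r0\<close> around its zero of \<open>z\<close>
        inside \<open>W\<close>, and the points of \<open>V\<close> lie inside the circle \<open>c\<close> of radius \<open>r\<close>.\<close>
      define V where "V = {x. x - z x *s e \<in> ball u R} \<inter> {x. cmod (z x) < r}"
      have "open V" unfolding V_def mem_ball
        by (intro open_Int open_Collect_less continuous_intros continuous_on_projection
              bounded_linear.continuous_on[OF bounded_linear])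
      have uV: "u \<in> V" using True R r by (simp add: V_def)
      have near: "x - z x *s e + s *s e \<in> W" if "x \<in> V" "cmod s \<le> r0" for x s
      proof -
        have "dist u (x - z x *s e + s *s e) \<le>
            dist u (x - z x *s e) + dist (x - z x *s e) (x - z x *s e + s *s e)"
          by (rule dist_triangle)
        also have "\<dots> < 2 * R" using that r0(2)[of s] by (simp add: V_def dist_norm)
        finally show ?thesis using R by auto
      qed
      define c where "c t = complex_of_real r * exp (2 * of_real pi * \<i> * of_real t)" for t :: real
      have c: "cmod (c t) = r" for t
        using r by (simp add: c_def norm_mult)
      have cw: "c t - z x \<noteq> 0" if "x \<in> V" for x t
        using c[of t] that by (auto simp: V_def)
      have "continuous_on UNIV c"
        unfolding c_def by (intro continuous_intros)
      have "holo_on (\<lambda>x. integral {0..1} (\<lambda>t. f (x - z x *s e + c t *s e) / (c t - z x))) V"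
      proof (rule holo_on_integral[OF \<open>open V\<close>])
        fix t
        show "holo_on (\<lambda>x. f (x - z x *s e + c t *s e) / (c t - z x)) V"
        proof (intro holo_on_divide holo_on_projection[OF f] holo_on_diff holo_on_const holo \<open>open V\<close>)
          show "x - z x *s e + c t *s e \<in> W" if "x \<in> V" for x
            using near[OF that, of "c t"] c r by simp
        qed (rule cw)
      next
        have "continuous_on (V \<times> {0..1::real}) (\<lambda>p. c (snd p))"
          by (rule continuous_on_compose2[OF \<open>continuous_on UNIV c\<close>]) (simp_all add: continuous_on_snd continuous_on_id)
        then have "continuous_on (V \<times> {0..1::real}) (\<lambda>p. fst p - z (fst p) *s e + c (snd p) *s e)"
          using continuous_on_compose2[OF continuous_on_projection[of UNIV e], of "V \<times> {0..1::real}" fst]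
          by (intro continuous_on_add bounded_linear.continuous_on[OF bounded_linear_smult_left])
             (simp_all add: continuous_on_fst continuous_on_id)
        moreover have "fst p - z (fst p) *s e + c (snd p) *s e \<in> W" if "p \<in> V \<times> {0..1::real}" for p
          using near[of "fst p" "c (snd p)"] c r that by (simp add: mem_Times_iff)
        ultimately have "continuous_on (V \<times> {0..1::real}) (\<lambda>p. f (fst p - z (fst p) *s e + c (snd p) *s e))"
          by (intro continuous_on_compose2[OF holo_on_imp_continuous_on[OF f]] image_subsetI)
        moreover have "continuous_on (V \<times> {0..1::real}) (\<lambda>p. z (fst p))"
          by (rule linear_continuous_on[OF bounded_linear_compose[OF bounded_linear bounded_linear_fst]])
        ultimately show "continuous_on (V \<times> {0..1::real}) (\<lambda>(x, t). f (x - z x *s e + c t *s e) / (c t - z x))"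
          unfolding case_prod_unfold using cw \<open>continuous_on (V \<times> {0..1::real}) (\<lambda>p. c (snd p))\<close>
          by (intro continuous_on_divide continuous_on_diff ballI) (simp_all add: mem_Times_iff)
      qed
      moreover have "integral {0..1} (\<lambda>t. f (x - z x *s e + c t *s e) / (c t - z x)) = \<psi> x"
        if x: "x \<in> V" for x
      proof -
        let ?\<phi> = "\<lambda>s. f (x - z x *s e + s *s e)"
        \<comment> \<open>On the line, \<open>\<psi>\<close> is \<open>?\<phi> s / s\<close> with its singularity at \<open>0\<close> removed.\<close>
        define q where "q s = (if s = 0 then deriv ?\<phi> 0 else (?\<phi> s - ?\<phi> 0) / (s - 0))" for s
        have "?\<phi> holomorphic_on ball 0 r0"
          using near[OF x] by (intro holo_on_line[OF f]) auto
        then have hq: "q holomorphic_on ball 0 r0"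
          unfolding q_def by (rule pole_lemma) (use r0 in auto)
        have \<phi>0: "?\<phi> 0 = 0"
          using near[OF x, of 0] r0 by (intro f0) (auto simp: z_diff scale e)
        have cint: "((\<lambda>s. q s / (s - z x)) has_contour_integral (2 * of_real pi * \<i> * q (z x))) (circlepath 0 r)"
          using x r by (intro Cauchy_integral_circlepath holomorphic_on_imp_continuous_on
              holomorphic_on_subset[OF hq]) (auto simp: V_def)
        define P where "P = 2 * of_real pi * \<i>"
        have P: "P \<noteq> 0" by (simp add: P_def)
        from cint have "((\<lambda>t. q (c t) / (c t - z x) * (P * c t)) has_integral
            (P * q (z x))) {0..1}"
          unfolding has_contour_integral_def P_def[symmetric]
        proof (rule has_integral_eq[rotated])
          fix t :: real assume "t \<in> {0..1}"
          moreover have "circlepath 0 r t = c t"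
            by (simp add: circlepath c_def)
          ultimately show "q (circlepath 0 r t) / (circlepath 0 r t - z x) *
              vector_derivative (circlepath 0 r) (at t within {0..1}) =
              q (c t) / (c t - z x) * (P * c t)"
            by (simp add: vector_derivative_circlepath01 P_def) (simp add: c_def)
        qed
        then have "((\<lambda>t. inverse P * (q (c t) / (c t - z x) * (P * c t)))
            has_integral inverse P * (P * q (z x))) {0..1}"
          by (rule has_integral_mult_right)
        moreover have "inverse P * (q (c t) / (c t - z x) * (P * c t)) = ?\<phi> (c t) / (c t - z x)" for t
        proof -
          have "c t \<noteq> 0" using c[of t] r by auto
          then have "q (c t) * c t = ?\<phi> (c t)" using \<phi>0 by (simp add: q_def)
          moreover have "inverse P * (q (c t) / (c t - z x) * (P * c t)) = q (c t) * c t / (c t - z x)"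
            using P by simp
          ultimately show ?thesis by simp
        qed
        moreover have "inverse P * (P * q (z x)) = q (z x)"
          using P by simp
        moreover have "q (z x) = \<psi> x"
          using \<phi>0 by (auto simp: \<psi>_def q_def)
        ultimately have "((\<lambda>t. ?\<phi> (c t) / (c t - z x)) has_integral \<psi> x) {0..1}"
          by (simp only:)
        then show ?thesis by (rule integral_unique)
      qed
      ultimately have "holo_on \<psi> V"
        by (rule holo_on_cong)
      then show ?thesis using uV by blast
    qed
  qed
qed

end

section \<open>Equality on dense open sets\<close>

text \<open>
  For open \<open>W\<close> this is the filter of the sets that contain a dense open subset of \<open>W\<close>.
\<close>

definition generic :: "'a::topological_space set \<Rightarrow> 'a filter" where
  "generic W = (INF D\<in>{D. open D \<and> D \<subseteq> W \<and> W \<subseteq> closure D}. principal D)"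

text \<open>
  The reason why dense open sets are closed under finite intersections.
\<close>

lemma dense_open_Int:
  assumes "open D" "D \<subseteq> W" "W \<subseteq> closure D" "W \<subseteq> closure E"
  shows "W \<subseteq> closure (D \<inter> E)"
proof -
  have "D \<subseteq> closure (D \<inter> E)"
    using open_Int_closure_subset[OF assms(1), of E] assms(2,4) by auto
  then have "closure D \<subseteq> closure (D \<inter> E)" by (simp add: closure_minimal)
  with assms(3) show ?thesis by simp
qed

lemma eventually_generic:
  assumes "open W"
  shows "eventually P (generic W) \<longleftrightarrow> (\<exists>D. open D \<and> D \<subseteq> W \<and> W \<subseteq> closure D \<and> (\<forall>x\<in>D. P x))"
proof -
  let ?B = "{D. open D \<and> D \<subseteq> W \<and> W \<subseteq> closure D}"
  have "eventually P (generic W) \<longleftrightarrow> (\<exists>D\<in>?B. eventually P (principal D))"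
    unfolding generic_def
  proof (rule eventually_INF_base)
    show "?B \<noteq> {}" using assms closure_subset by blast
    fix D E assume "D \<in> ?B" "E \<in> ?B"
    then show "\<exists>F\<in>?B. principal F \<le> inf (principal D) (principal E)"
      using dense_open_Int[of D W E] by (intro bexI[of _ "D \<inter> E"]) auto
  qed
  then show ?thesis by (auto simp: eventually_principal)
qed

lemma eventually_generic_subset:
  assumes "open W" "open V" "V \<subseteq> W" "eventually P (generic W)"
  shows "eventually P (generic V)"
proof -
  obtain D where D: "open D" "W \<subseteq> closure D" "\<forall>x\<in>D. P x"
    using assms(1,4) by (auto simp: eventually_generic)
  have "V \<subseteq> closure (V \<inter> D)"
    using open_Int_closure_subset[OF assms(2), of D] D(2) assms(3) by auto
  then show ?thesis
    using D assms(2) by (auto simp: eventually_generic intro!: exI[of _ "V \<inter> D"])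
qed

lemma eventually_generic_mem: "open W \<Longrightarrow> eventually (\<lambda>x. x \<in> W) (generic W)"
  using closure_subset by (auto simp: eventually_generic)

lemma eventually_generic_local:
  assumes "open W" "\<And>x. x \<in> W \<Longrightarrow> \<exists>U. open U \<and> x \<in> U \<and> eventually P (generic U)"
  shows "eventually P (generic W)"
proof -
  define D where "D = {x \<in> W. \<exists>E. open E \<and> x \<in> E \<and> (\<forall>y\<in>E. P y)}"
  have D_alt: "D = W \<inter> \<Union>{E. open E \<and> (\<forall>y\<in>E. P y)}" by (auto simp: D_def)
  have "x \<in> closure D" if x: "x \<in> W" for x
  proof -
    obtain U where U: "open U" "x \<in> U" "eventually P (generic U)" using assms(2)[OF x] by blast
    then obtain E where E: "open E" "U \<subseteq> closure E" "\<forall>y\<in>E. P y"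
      by (auto simp: eventually_generic)
    have "x \<in> closure (W \<inter> E)"
      using open_Int_closure_subset[OF assms(1), of E] x U E by auto
    moreover have "W \<inter> E \<subseteq> D" using E by (auto simp: D_def)
    ultimately show ?thesis using closure_mono by blast
  qed
  moreover have "open D" unfolding D_alt by (intro open_Int assms(1) open_Union) auto
  ultimately show ?thesis
    unfolding eventually_generic[OF assms(1)] by (intro exI[of _ D]) (auto simp: D_def)
qed

text \<open>
  The replacement for the identity theorem: it needs no connectedness, since the functions are compared
  on a dense set.
\<close>

lemma generic_eq_imp_eq:
  fixes f g :: "'a::metric_space \<Rightarrow> 'b::t2_space"
  assumes "open W" "continuous_on W f" "continuous_on W g"
    and "eventually (\<lambda>x. f x = g x) (generic W)" "x \<in> W"
  shows "f x = g x"
proof -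
  obtain D where D: "D \<subseteq> W" "W \<subseteq> closure D" "\<forall>x\<in>D. f x = g x"
    using assms(1,4) by (auto simp: eventually_generic)
  then have "x \<in> closure D" using assms(5) by auto
  then obtain s where s: "\<And>n. s n \<in> D" "s \<longlonglongrightarrow> x"
    unfolding closure_sequential by blast
  have sW: "\<forall>n. s n \<in> W" using s(1) D(1) by blast
  have "(\<lambda>n. f (s n)) \<longlonglongrightarrow> f x"
    by (rule continuous_on_tendsto_compose[OF assms(2) s(2) assms(5) always_eventually[OF sW]])
  moreover have "(\<lambda>n. g (s n)) \<longlonglongrightarrow> g x"
    by (rule continuous_on_tendsto_compose[OF assms(3) s(2) assms(5) always_eventually[OF sW]])
  then have "(\<lambda>n. f (s n)) \<longlonglongrightarrow> g x"
    using s(1) D(3) by simp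
  ultimately show ?thesis by (rule LIMSEQ_unique)
qed

section \<open>Meromorphic functions and their normal forms\<close>

lemma holo_value_iff:
  "holo_value f x y \<longleftrightarrow>
    (\<exists>U g. x \<in> U \<and> holo_on g U \<and> g x = y \<and> eventually (\<lambda>u. f u = g u) (generic U))"
proof -
  have "holo_on g U \<and> g x = y \<and> eventually (\<lambda>u. f u = g u) (generic U) \<longleftrightarrow>
      holo_on g U \<and> g x = y \<and> (\<exists>D. open D \<and> D \<subseteq> U \<and> U \<subseteq> closure D \<and> (\<forall>u\<in>D. f u = g u))" for U g
    using eventually_generic[OF holo_on_imp_open] by auto
  then show ?thesis unfolding holo_value_def by simp
qed

lemma holo_value_unique:
  assumes "holo_value f x y" "holo_value f x y'"
  shows "y = y'"
proof -
  obtain U g where U: "x \<in> U" "holo_on g U" "g x = y" "eventually (\<lambda>u. f u = g u) (generic U)"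
    using assms(1) unfolding holo_value_iff by blast
  obtain V h where V: "x \<in> V" "holo_on h V" "h x = y'" "eventually (\<lambda>u. f u = h u) (generic V)"
    using assms(2) unfolding holo_value_iff by blast
  have o: "open U" "open V" "open (U \<inter> V)" using U V by (auto intro: holo_on_imp_open)
  have "eventually (\<lambda>u. f u = g u) (generic (U \<inter> V))" "eventually (\<lambda>u. f u = h u) (generic (U \<inter> V))"
    using o U V by (auto elim!: eventually_generic_subset[rotated 3])
  then have "eventually (\<lambda>u. g u = h u) (generic (U \<inter> V))"
    by eventually_elim simp
  moreover have "continuous_on (U \<inter> V) g" "continuous_on (U \<inter> V) h"
    using U(2) V(2) holo_on_imp_continuous_on continuous_on_subset by (metis Int_lower1, metis Int_lower2)
  ultimately have "g x = h x"
    using generic_eq_imp_eq[OF o(3)] U(1) V(1) by auto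
  with U V show ?thesis by simp
qed

lemma mero_nf_eqI:
  assumes "x \<in> W" "x \<in> U" "holo_on g U" "eventually (\<lambda>u. f u = g u) (generic U)"
  shows "mero_nf W f x = g x"
proof -
  have "holo_value f x (g x)" using assms unfolding holo_value_iff by blast
  then have "(THE y. holo_value f x y) = g x" using holo_value_unique by blast
  with \<open>holo_value f x (g x)\<close> assms(1) show ?thesis by (auto simp: mero_nf_def)
qed

lemma mero_nf_outside [simp]: "x \<notin> W \<Longrightarrow> mero_nf W f x = 0"
  by (simp add: mero_nf_def)

lemma holo_value_cong:
  assumes "open W" "eventually (\<lambda>x. f x = g x) (generic W)" "x \<in> W" "holo_value f x y"
  shows "holo_value g x y"
proof -
  obtain U h where U: "x \<in> U" "holo_on h U" "h x = y" "eventually (\<lambda>u. f u = h u) (generic U)"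
    using assms(4) unfolding holo_value_iff by blast
  have o: "open U" "open (U \<inter> W)" using U assms(1) by (auto intro: holo_on_imp_open)
  have "eventually (\<lambda>u. f u = h u) (generic (U \<inter> W))" "eventually (\<lambda>u. f u = g u) (generic (U \<inter> W))"
    using o U assms by (auto elim!: eventually_generic_subset[rotated 3])
  then have "eventually (\<lambda>u. g u = h u) (generic (U \<inter> W))"
    by eventually_elim simp
  moreover have "holo_on h (U \<inter> W)" using holo_on_subset[OF U(2) o(2)] by auto
  ultimately show ?thesis using U assms(3) unfolding holo_value_iff by blast
qed

text \<open>
  Normal forms do not see changes outside a dense open set, so all identities in the skew group ring can
  be checked generically.
\<close>

lemma mero_nf_cong:
  assumes "open W" "eventually (\<lambda>x. f x = g x) (generic W)"
  shows "mero_nf W f = mero_nf W g"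
proof
  fix x
  have "eventually (\<lambda>x. g x = f x) (generic W)" using assms(2) by eventually_elim simp
  then have "holo_value f x y \<longleftrightarrow> holo_value g x y" if "x \<in> W" for y
    using holo_value_cong[OF assms(1)] assms(2) that by blast
  then have "x \<in> W \<Longrightarrow> holo_value f x = holo_value g x" by blast
  then show "mero_nf W f x = mero_nf W g x" by (auto simp: mero_nf_def)
qed

lemma mero_nf_holo:
  assumes "holo_on f W"
  shows "mero_nf W f x = (if x \<in> W then f x else 0)"
  using mero_nf_eqI[of x W W f f] assms by simp

text \<open>
  The functions whose normal form is meromorphic.  The quotients are only required to agree with \<open>f\<close>
  generically, which makes this class closed under pointwise operations.
\<close>

definition premero :: "(complex ^ 'p) set \<Rightarrow> (complex ^ 'p \<Rightarrow> complex) \<Rightarrow> bool" where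
  "premero W f \<longleftrightarrow> (\<forall>x\<in>W. \<exists>U p q. x \<in> U \<and> holo_on p U \<and> holo_on q U \<and>
    eventually (\<lambda>u. q u \<noteq> 0) (generic U) \<and> eventually (\<lambda>u. f u = p u / q u) (generic U))"

lemma open_holo_nonzero:
  assumes "holo_on q U"
  shows "open {u\<in>U. q u \<noteq> 0}"
proof -
  have "open (U \<inter> q -` (- {0}))"
    using assms by (intro continuous_open_preimage holo_on_imp_continuous_on holo_on_imp_open open_Compl) auto
  moreover have "U \<inter> q -` (- {0}) = {u\<in>U. q u \<noteq> 0}" by auto
  ultimately show ?thesis by simp
qed

lemma premeroE:
  assumes "premero W f" "open W" "x \<in> W"
  obtains U p q where "open U" "U \<subseteq> W" "x \<in> U" "holo_on p U" "holo_on q U"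
    "eventually (\<lambda>u. q u \<noteq> 0) (generic U)" "eventually (\<lambda>u. f u = p u / q u) (generic U)"
proof -
  obtain U p q where U: "x \<in> U" "holo_on p U" "holo_on q U"
    "eventually (\<lambda>u. q u \<noteq> 0) (generic U)" "eventually (\<lambda>u. f u = p u / q u) (generic U)"
    using assms unfolding premero_def by blast
  have o: "open U" "open (U \<inter> W)" using U assms(2) by (auto intro: holo_on_imp_open)
  show thesis
    using U o assms
    by (intro that[of "U \<inter> W" p q]) (auto elim: holo_on_subset eventually_generic_subset[rotated 3])
qed

lemma premero_cong:
  assumes "open W" "eventually (\<lambda>x. f x = g x) (generic W)" "premero W f"
  shows "premero W g"
  unfolding premero_def
proof
  fix x assume x: "x \<in> W"
  obtain U p q where U: "open U" "U \<subseteq> W" "x \<in> U" "holo_on p U" "holo_on q U"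
    "eventually (\<lambda>u. q u \<noteq> 0) (generic U)" "eventually (\<lambda>u. f u = p u / q u) (generic U)"
    by (rule premeroE[OF assms(3,1) x])
  have "eventually (\<lambda>u. f u = g u) (generic U)"
    using eventually_generic_subset[OF assms(1) U(1,2) assms(2)] .
  with U(7) have "eventually (\<lambda>u. g u = p u / q u) (generic U)"
    by eventually_elim simp
  with U show "\<exists>U p q. x \<in> U \<and> holo_on p U \<and> holo_on q U \<and>
    eventually (\<lambda>u. q u \<noteq> 0) (generic U) \<and> eventually (\<lambda>u. g u = p u / q u) (generic U)" by blast
qed

text \<open>
  Near a point where the local denominator does not vanish the function is already holomorphic, hence
  equal to its normal form.
\<close>

lemma mero_nf_generic:
  assumes "open W" "premero W f"
  shows "eventually (\<lambda>x. mero_nf W f x = f x) (generic W)"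
proof (rule eventually_generic_local[OF assms(1)])
  fix x assume x: "x \<in> W"
  obtain U p q where U: "open U" "U \<subseteq> W" "x \<in> U" "holo_on p U" "holo_on q U"
    "eventually (\<lambda>u. q u \<noteq> 0) (generic U)" "eventually (\<lambda>u. f u = p u / q u) (generic U)"
    by (rule premeroE[OF assms(2,1) x])
  have "eventually (\<lambda>u. q u \<noteq> 0 \<and> f u = p u / q u) (generic U)"
    using U(6,7) by eventually_elim simp
  then obtain D where D: "open D" "D \<subseteq> U" "U \<subseteq> closure D" "\<forall>u\<in>D. q u \<noteq> 0 \<and> f u = p u / q u"
    using U(1) by (auto simp: eventually_generic)
  have "holo_on (\<lambda>u. p u / q u) D"
    using D U by (intro holo_on_divide) (auto intro: holo_on_subset)
  moreover have "eventually (\<lambda>u. f u = p u / q u) (generic D)"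
    using eventually_generic_subset[OF U(1) D(1,2) U(7)] .
  ultimately have "mero_nf W f u = f u" if "u \<in> D" for u
    using mero_nf_eqI[of u W D "\<lambda>u. p u / q u" f] that D U(2) by auto
  then have "eventually (\<lambda>x. mero_nf W f x = f x) (generic U)"
    using D U(1) by (auto simp: eventually_generic)
  then show "\<exists>U. open U \<and> x \<in> U \<and> eventually (\<lambda>x. mero_nf W f x = f x) (generic U)"
    using U by blast
qed

lemma mero_iff:
  assumes "open W"
  shows "f \<in> mero W \<longleftrightarrow> mero_nf W f = f \<and> premero W f"
proof (intro iffI conjI)
  assume f: "f \<in> mero W"
  then show "mero_nf W f = f" by (simp add: mero_def)
  show "premero W f" unfolding premero_def
  proof
    fix x assume "x \<in> W"
    with f obtain U p q where U: "x \<in> U" "holo_on p U" "holo_on q U"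
      "U \<subseteq> closure {u\<in>U. q u \<noteq> 0}" "\<forall>u\<in>U. q u \<noteq> 0 \<longrightarrow> f u = p u / q u"
      unfolding mero_def by blast
    have o: "open U" using U holo_on_imp_open by blast
    have "open {u\<in>U. q u \<noteq> 0}"
      by (rule open_holo_nonzero[OF U(3)])
    then have q: "eventually (\<lambda>u. q u \<noteq> 0) (generic U)"
      using U(4) o unfolding eventually_generic[OF o] by (intro exI[of _ "{u\<in>U. q u \<noteq> 0}"]) auto
    moreover have "eventually (\<lambda>u. f u = p u / q u) (generic U)"
      using q eventually_generic_mem[OF o] by eventually_elim (use U(5) in blast)
    ultimately show "\<exists>U p q. x \<in> U \<and> holo_on p U \<and> holo_on q U \<and>
      eventually (\<lambda>u. q u \<noteq> 0) (generic U) \<and> eventually (\<lambda>u. f u = p u / q u) (generic U)"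
      using U by blast
  qed
next
  assume f: "mero_nf W f = f \<and> premero W f"
  have "\<exists>U p q. x \<in> U \<and> holo_on p U \<and> holo_on q U \<and> U \<subseteq> closure {u\<in>U. q u \<noteq> 0} \<and>
      (\<forall>u\<in>U. q u \<noteq> 0 \<longrightarrow> f u = p u / q u)" if x: "x \<in> W" for x
  proof -
    obtain U p q where U: "open U" "U \<subseteq> W" "x \<in> U" "holo_on p U" "holo_on q U"
      "eventually (\<lambda>u. q u \<noteq> 0) (generic U)" "eventually (\<lambda>u. f u = p u / q u) (generic U)"
      by (rule premeroE[OF conjunct2[OF f] assms x])
    obtain D where D: "D \<subseteq> U" "U \<subseteq> closure D" "\<forall>u\<in>D. q u \<noteq> 0"
      using U(1,6) by (auto simp: eventually_generic)
    have "U \<subseteq> closure {u\<in>U. q u \<noteq> 0}"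
      using D closure_mono[of D "{u\<in>U. q u \<noteq> 0}"] by blast
    moreover have "f u = p u / q u" if "u \<in> U" "q u \<noteq> 0" for u
    proof -
      let ?V = "{u\<in>U. q u \<noteq> 0}"
      have "open ?V"
        by (rule open_holo_nonzero[OF U(5)])
      then have "holo_on (\<lambda>u. p u / q u) ?V" "eventually (\<lambda>u. f u = p u / q u) (generic ?V)"
        using U by (auto intro!: holo_on_divide elim: holo_on_subset eventually_generic_subset[rotated 3])
      then have "mero_nf W f u = p u / q u"
        using that U(2) by (intro mero_nf_eqI[of u W ?V]) auto
      with f show ?thesis by simp
    qed
    ultimately show ?thesis using U by blast
  qed
  with f show "f \<in> mero W" unfolding mero_def by blast
qed

lemma mero_nf_in_mero: "open W \<Longrightarrow> premero W f \<Longrightarrow> mero_nf W f \<in> mero W"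
  using mero_nf_generic[of W f] mero_nf_cong[of W "mero_nf W f" f]
    premero_cong[of W f "mero_nf W f"]
  by (auto simp: mero_iff eq_commute)

lemma mero_eqI:
  "open W \<Longrightarrow> f \<in> mero W \<Longrightarrow> g \<in> mero W \<Longrightarrow> eventually (\<lambda>x. f x = g x) (generic W) \<Longrightarrow> f = g"
  using mero_nf_cong[of W f g] by (simp add: mero_iff)

lemma premero_mero: "open W \<Longrightarrow> f \<in> mero W \<Longrightarrow> premero W f"
  by (simp add: mero_iff)

lemma premero_holo:
  assumes "holo_on f W"
  shows "premero W f"
  unfolding premero_def
proof
  fix x assume "x \<in> W"
  with assms show "\<exists>U p q. x \<in> U \<and> holo_on p U \<and> holo_on q U \<and>
      eventually (\<lambda>u. q u \<noteq> 0) (generic U) \<and> eventually (\<lambda>u. f u = p u / q u) (generic U)"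
    by (intro exI[of _ W] exI[of _ f] exI[of _ "\<lambda>_. 1"]) (auto intro: holo_on_imp_open holo_on_const)
qed

lemma
  assumes "open W" "premero W f" "premero W g"
  shows premero_add: "premero W (\<lambda>x. f x + g x)"
    and premero_mult: "premero W (\<lambda>x. f x * g x)"
proof -
  have *: "(\<exists>U p q. x \<in> U \<and> holo_on p U \<and> holo_on q U \<and> eventually (\<lambda>u. q u \<noteq> 0) (generic U) \<and>
      eventually (\<lambda>u. f u + g u = p u / q u) (generic U)) \<and>
    (\<exists>U p q. x \<in> U \<and> holo_on p U \<and> holo_on q U \<and> eventually (\<lambda>u. q u \<noteq> 0) (generic U) \<and>
      eventually (\<lambda>u. f u * g u = p u / q u) (generic U))" if x: "x \<in> W" for x
  proof -
    obtain U p q where U: "open U" "U \<subseteq> W" "x \<in> U" "holo_on p U" "holo_on q U"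
      "eventually (\<lambda>u. q u \<noteq> 0) (generic U)" "eventually (\<lambda>u. f u = p u / q u) (generic U)"
      by (rule premeroE[OF assms(2,1) x])
    obtain V p' q' where V: "open V" "V \<subseteq> W" "x \<in> V" "holo_on p' V" "holo_on q' V"
      "eventually (\<lambda>u. q' u \<noteq> 0) (generic V)" "eventually (\<lambda>u. g u = p' u / q' u) (generic V)"
      by (rule premeroE[OF assms(3,1) x])
    let ?X = "U \<inter> V"
    have o: "open ?X" using U V by auto
    have h: "holo_on p ?X" "holo_on q ?X" "holo_on p' ?X" "holo_on q' ?X"
      using U V o by (auto elim: holo_on_subset)
    have e: "eventually (\<lambda>u. q u \<noteq> 0) (generic ?X)" "eventually (\<lambda>u. f u = p u / q u) (generic ?X)"
      "eventually (\<lambda>u. q' u \<noteq> 0) (generic ?X)" "eventually (\<lambda>u. g u = p' u / q' u) (generic ?X)"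
      using U V o by (auto elim: eventually_generic_subset[rotated 3])
    have "eventually (\<lambda>u. q u * q' u \<noteq> 0) (generic ?X)"
      using e(1,3) by eventually_elim simp
    moreover have "eventually (\<lambda>u. f u + g u = (p u * q' u + p' u * q u) / (q u * q' u)) (generic ?X)"
      using e by eventually_elim (simp add: add_frac_eq)
    moreover have "eventually (\<lambda>u. f u * g u = (p u * p' u) / (q u * q' u)) (generic ?X)"
      using e by eventually_elim simp
    moreover have "holo_on (\<lambda>u. q u * q' u) ?X" "holo_on (\<lambda>u. p u * q' u + p' u * q u) ?X"
      "holo_on (\<lambda>u. p u * p' u) ?X"
      using h by (auto intro!: holo_on_mult holo_on_add)
    ultimately show ?thesis using U(3) V(3) by (meson IntI)
  qed
  show "premero W (\<lambda>x. f x + g x)" "premero W (\<lambda>x. f x * g x)"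
    using * unfolding premero_def by blast+
qed

lemma premero_sum:
  assumes "open W" "\<And>a. a \<in> X \<Longrightarrow> premero W (f a)"
  shows "premero W (\<lambda>x. \<Sum>a\<in>X. f a x)"
  using assms(2)
proof (induction X rule: infinite_finite_induct)
  case (insert a X)
  then show ?case using premero_add[OF assms(1), of "f a" "\<lambda>x. \<Sum>a\<in>X. f a x"] by simp
qed (simp_all add: premero_holo holo_on_const assms(1))

section \<open>Biholomorphic substitutions\<close>

text \<open>
  The maps to which this applies are the shifts and the transposition.  Both are affine, so their
  derivatives \<open>M\<close> and \<open>M'\<close> do not depend on the point.
\<close>

locale biholo =
  fixes T T' M M' :: "complex ^ 'p \<Rightarrow> complex ^ 'p"
  assumes TT': "\<And>x. T (T' x) = x" and T'T: "\<And>x. T' (T x) = x"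
    and T_deriv: "\<And>x. (T has_derivative M) (at x)" and T'_deriv: "\<And>x. (T' has_derivative M') (at x)"
    and M_scale: "\<And>c h. M (c *s h) = c *s M h" and M'_scale: "\<And>c h. M' (c *s h) = c *s M' h"
begin

lemma inverse_biholo: "biholo T' T M' M"
  by unfold_locales (rule TT' T'T T_deriv T'_deriv M_scale M'_scale)+

lemma continuous_T: "continuous_on X T" and continuous_T': "continuous_on X T'"
  by (intro continuous_at_imp_continuous_on ballI has_derivative_continuous[OF T_deriv]
        has_derivative_continuous[OF T'_deriv])+

lemma open_vimage_T: "open U \<Longrightarrow> open (T -` U)"
  by (rule open_vimage[OF _ continuous_T])

lemma holo_on_T: "holo_on f U \<Longrightarrow> holo_on (\<lambda>x. f (T x)) (T -` U)"
  using holo_on_imp_open by (intro holo_on_compose[OF _ _ _ T_deriv M_scale]) (auto intro: open_vimage_T)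

lemma eventually_generic_T:
  assumes "open U" "eventually P (generic U)"
  shows "eventually (\<lambda>x. P (T x)) (generic (T -` U))"
proof -
  obtain D where D: "open D" "D \<subseteq> U" "U \<subseteq> closure D" "\<forall>x\<in>D. P x"
    using assms by (auto simp: eventually_generic)
  have "T' ` closure D \<subseteq> closure (T -` D)"
    using closure_subset[of "T -` D"]
    by (intro image_closure_subset continuous_T' closed_closure) (auto simp: TT')
  moreover have "x \<in> T' ` closure D" if "x \<in> T -` U" for x
    using D(3) that T'T by (metis image_eqI subsetD vimageE)
  ultimately have "T -` U \<subseteq> closure (T -` D)" by blast
  then show ?thesis
    using D open_vimage_T assms(1) unfolding eventually_generic[OF open_vimage_T[OF assms(1)]]
    by (intro exI[of _ "T -` D"]) auto
qed

lemma holo_value_T: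
  assumes "holo_value f (T x) y"
  shows "holo_value (\<lambda>x. f (T x)) x y"
proof -
  obtain U g where U: "T x \<in> U" "holo_on g U" "g (T x) = y" "eventually (\<lambda>u. f u = g u) (generic U)"
    using assms unfolding holo_value_iff by blast
  then have "x \<in> T -` U" "holo_on (\<lambda>x. g (T x)) (T -` U)" "(\<lambda>x. g (T x)) x = y"
    "eventually (\<lambda>u. f (T u) = g (T u)) (generic (T -` U))"
    using holo_on_T[OF U(2)] eventually_generic_T[OF holo_on_imp_open[OF U(2)] U(4)] by auto
  then show ?thesis unfolding holo_value_iff by (intro exI[of _ "T -` U"] exI[of _ "\<lambda>x. g (T x)"]) auto
qed

lemma holo_value_T_iff: "holo_value (\<lambda>x. f (T x)) x y \<longleftrightarrow> holo_value f (T x) y"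
  using biholo.holo_value_T[OF inverse_biholo, of "\<lambda>x. f (T x)" "T x" y] holo_value_T[of f x y]
  by (auto simp: TT' T'T)

context
  fixes W assumes W: "open W" and TW: "T -` W = W"
begin

lemma mero_nf_T: "mero_nf W (\<lambda>x. f (T x)) x = mero_nf W f (T x)"
proof -
  have "holo_value (\<lambda>x. f (T x)) x = holo_value f (T x)"
    by (rule ext) (rule holo_value_T_iff)
  moreover have "T x \<in> W \<longleftrightarrow> x \<in> W" using TW by blast
  ultimately show ?thesis by (simp only: mero_nf_def)
qed

lemma premero_T:
  assumes "premero W f"
  shows "premero W (\<lambda>x. f (T x))"
  unfolding premero_def
proof
  fix x assume "x \<in> W"
  then have "T x \<in> W" using TW by blast
  then obtain U p q where U: "open U" "U \<subseteq> W" "T x \<in> U" "holo_on p U" "holo_on q U"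
    "eventually (\<lambda>u. q u \<noteq> 0) (generic U)" "eventually (\<lambda>u. f u = p u / q u) (generic U)"
    by (rule premeroE[OF assms W])
  then show "\<exists>U p q. x \<in> U \<and> holo_on p U \<and> holo_on q U \<and>
      eventually (\<lambda>u. q u \<noteq> 0) (generic U) \<and> eventually (\<lambda>u. f (T u) = p u / q u) (generic U)"
    using holo_on_T eventually_generic_T[OF U(1,6)] eventually_generic_T[OF U(1,7)]
    by (intro exI[of _ "T -` U"] exI[of _ "\<lambda>x. p (T x)"] exI[of _ "\<lambda>x. q (T x)"]) auto
qed

lemma eventually_T: "eventually P (generic W) \<Longrightarrow> eventually (\<lambda>x. P (T x)) (generic W)"
  using eventually_generic_T[OF W] TW by auto

end

end

section \<open>The skew group ring\<close>

lemma shift_zero [simp]: "shift 0 x = x"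
  by (simp add: shift_def vec_eq_iff)

lemma shift_shift: "shift \<sigma> (shift \<rho> x) = shift (\<sigma> + \<rho>) x"
  by (simp add: shift_def vec_eq_iff algebra_simps)

lemma biholo_shift: "biholo (shift \<sigma>) (shift (- \<sigma>)) (\<lambda>h. h) (\<lambda>h. h)"
proof -
  have "shift \<rho> = (\<lambda>x. x + (\<chi> p. of_int (\<rho> $ p)))" for \<rho> :: "'a shift"
    by (auto simp: shift_def vec_eq_iff)
  then show ?thesis
    by unfold_locales (auto simp: shift_shift vec_eq_iff intro!: derivative_eq_intros)
qed

lemma shifts_0 [simp]: "0 \<in> shifts"
  and shifts_add [simp]: "\<sigma> \<in> shifts \<Longrightarrow> \<rho> \<in> shifts \<Longrightarrow> \<sigma> + \<rho> \<in> shifts"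
  and shifts_minus [simp]: "\<sigma> \<in> shifts \<Longrightarrow> - \<sigma> \<in> shifts"
  by (simp_all add: shifts_def)

lemma sum_reindex_shift:
  fixes h :: "'a::ab_group_add \<Rightarrow> 'b::comm_monoid_add"
  assumes "finite Z" "\<And>y. y \<in> Y \<Longrightarrow> a + y \<in> Z" "\<And>m. m \<in> Z \<Longrightarrow> m - a \<notin> Y \<Longrightarrow> h m = 0"
  shows "(\<Sum>m\<in>Z. h m) = (\<Sum>y\<in>Y. h (a + y))"
proof -
  have "(\<Sum>m\<in>Z. h m) = (\<Sum>m\<in>(+) a ` Y. h m)"
  proof (rule sum.mono_neutral_right[OF assms(1)])
    show "(+) a ` Y \<subseteq> Z" using assms(2) by blast
    show "\<forall>m\<in>Z - (+) a ` Y. h m = 0"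
    proof
      fix m assume m: "m \<in> Z - (+) a ` Y"
      then have "m - a \<notin> Y" by (metis Diff_iff add_diff_cancel_left' diff_add_cancel image_eqI add.commute)
      with m assms(3) show "h m = 0" by blast
    qed
  qed
  also have "\<dots> = (\<Sum>y\<in>Y. h (a + y))"
    by (subst sum.reindex) (auto simp: inj_on_def)
  finally show ?thesis .
qed

locale shift_domain =
  fixes W :: "'n::{finite,linorder} tableau set"
  assumes open_W: "open W" and shift_W: "\<And>\<sigma>. \<sigma> \<in> shifts \<Longrightarrow> shift \<sigma> ` W = W"
begin

abbreviation "R \<equiv> skew_ring W"

abbreviation "supp A \<equiv> {\<sigma>. A \<sigma> \<noteq> (0 :: 'n tableau \<Rightarrow> complex)}"

lemma shift_vimage: 
  assumes "\<sigma> \<in> shifts"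
  shows "shift \<sigma> -` W = W"
proof -
  have "shift \<sigma> x \<in> W \<longleftrightarrow> x \<in> W" for x
  proof
    assume "shift \<sigma> x \<in> W"
    then have "shift (- \<sigma>) (shift \<sigma> x) \<in> shift (- \<sigma>) ` W" by blast
    then show "x \<in> W" using shift_W[of "- \<sigma>"] assms by (simp add: shift_shift)
  qed (use shift_W[OF assms] in blast)
  then show ?thesis by blast
qed

lemma shift_in_W: "\<sigma> \<in> shifts \<Longrightarrow> shift \<sigma> x \<in> W \<longleftrightarrow> x \<in> W"
  using shift_vimage by blast

lemma carrier_iff:
  "A \<in> carrier R \<longleftrightarrow> (\<forall>\<sigma>. A \<sigma> \<in> mero W) \<and> finite (supp A) \<and> supp A \<subseteq> shifts"
  by (simp add: skew_ring_def)

lemma carrier_mero: "A \<in> carrier R \<Longrightarrow> A \<sigma> \<in> mero W"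
  and carrier_finite: "A \<in> carrier R \<Longrightarrow> finite (supp A)"
  and carrier_shifts: "A \<in> carrier R \<Longrightarrow> supp A \<subseteq> shifts"
  by (auto simp: carrier_iff)

lemma carrier_premero: "A \<in> carrier R \<Longrightarrow> premero W (A \<sigma>)"
  using premero_mero[OF open_W] carrier_mero by blast

lemma carrier_eqI:
  assumes "A \<in> carrier R" "B \<in> carrier R" "\<And>\<sigma>. eventually (\<lambda>x. A \<sigma> x = B \<sigma> x) (generic W)"
  shows "A = B"
  using mero_eqI[OF open_W] assms carrier_mero by blast

lemma mero_nf_zero: "mero_nf W (\<lambda>_. 0) = 0"
  using mero_nf_holo[OF holo_on_const[OF open_W, of 0]] by (auto simp: fun_eq_iff)

lemma carrierI:
  assumes "\<And>\<sigma>. A \<sigma> = mero_nf W (f \<sigma>)" "\<And>\<sigma>. premero W (f \<sigma>)"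
    and "finite X" "X \<subseteq> shifts" "\<And>\<sigma>. \<sigma> \<notin> X \<Longrightarrow> f \<sigma> = (\<lambda>_. 0)"
  shows "A \<in> carrier R"
proof -
  have "supp A \<subseteq> X" using assms(1,5) mero_nf_zero by fastforce
  then show ?thesis
    using assms mero_nf_in_mero[OF open_W] unfolding carrier_iff
    by (auto intro: finite_subset)
qed

lemma coeff_generic:
  assumes "A \<sigma> = mero_nf W f" "premero W f"
  shows "eventually (\<lambda>x. A \<sigma> x = f x) (generic W)"
  using mero_nf_generic[OF open_W assms(2)] assms(1) by simp

lemma premero_shift: "premero W f \<Longrightarrow> \<sigma> \<in> shifts \<Longrightarrow> premero W (\<lambda>x. f (shift \<sigma> x))"
  using biholo.premero_T[OF biholo_shift open_W shift_vimage] .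

lemma eventually_shift:
  "eventually P (generic W) \<Longrightarrow> \<sigma> \<in> shifts \<Longrightarrow> eventually (\<lambda>x. P (shift \<sigma> x)) (generic W)"
  using biholo.eventually_T[OF biholo_shift open_W shift_vimage] .

lemma add_coeff: "(A \<oplus>\<^bsub>R\<^esub> B) \<sigma> = mero_nf W (\<lambda>x. A \<sigma> x + B \<sigma> x)"
  by (simp add: skew_ring_def)

lemma add_generic:
  assumes "A \<in> carrier R" "B \<in> carrier R"
  shows "eventually (\<lambda>x. (A \<oplus>\<^bsub>R\<^esub> B) \<sigma> x = A \<sigma> x + B \<sigma> x) (generic W)"
  unfolding add_coeff using assms
  by (intro mero_nf_generic premero_add open_W carrier_premero)

lemma add_closed:
  assumes "A \<in> carrier R" "B \<in> carrier R"
  shows "A \<oplus>\<^bsub>R\<^esub> B \<in> carrier R"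
proof (rule carrierI[OF add_coeff])
  show "premero W (\<lambda>x. A \<sigma> x + B \<sigma> x)" for \<sigma>
    using assms by (intro premero_add open_W carrier_premero)
  show "finite (supp A \<union> supp B)" "supp A \<union> supp B \<subseteq> shifts"
    using assms carrier_finite carrier_shifts by auto
qed auto

lemma zero_coeff: "\<zero>\<^bsub>R\<^esub> = (\<lambda>_. 0)"
  by (simp add: skew_ring_def)

lemma zero_closed: "\<zero>\<^bsub>R\<^esub> \<in> carrier R"
  by (rule carrierI[where f = "\<lambda>_ _. 0" and X = "{}"])
     (auto simp: zero_coeff mero_nf_zero intro: premero_holo holo_on_const open_W)

text \<open>
  The coefficient of \<open>\<rho>\<close> in a product as a sum over one index set that contains the support of \<open>A\<close>.
  Unlike the pairs in the definition of the product, \<open>X\<close> can be chosen independently of \<open>\<rho>\<close> and \<open>B\<close>.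
\<close>

definition mult_sum :: "'n shift set \<Rightarrow> 'n fsum \<Rightarrow> 'n fsum \<Rightarrow> 'n fsum" where
  "mult_sum X A B \<rho> x = (\<Sum>\<sigma>\<in>X. A \<sigma> x * B (\<rho> - \<sigma>) (shift (- \<sigma>) x))"

lemma mult_coeff:
  assumes "A \<in> carrier R" "B \<in> carrier R" "finite X" "supp A \<subseteq> X"
  shows "(A \<otimes>\<^bsub>R\<^esub> B) \<rho> = mero_nf W (mult_sum X A B \<rho>)"
proof -
  have "(\<Sum>(\<sigma>, \<sigma>') | A \<sigma> \<noteq> 0 \<and> B \<sigma>' \<noteq> 0 \<and> \<sigma> + \<sigma>' = \<rho>. A \<sigma> x * B \<sigma>' (shift (- \<sigma>) x)) =
      mult_sum X A B \<rho> x" for x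
  proof -
    let ?X = "{\<sigma>. A \<sigma> \<noteq> 0 \<and> B (\<rho> - \<sigma>) \<noteq> 0}"
    have "{(\<sigma>, \<sigma>'). A \<sigma> \<noteq> 0 \<and> B \<sigma>' \<noteq> 0 \<and> \<sigma> + \<sigma>' = \<rho>} = (\<lambda>\<sigma>. (\<sigma>, \<rho> - \<sigma>)) ` ?X"
      by (auto simp: image_iff)
    then have "(\<Sum>(\<sigma>, \<sigma>') | A \<sigma> \<noteq> 0 \<and> B \<sigma>' \<noteq> 0 \<and> \<sigma> + \<sigma>' = \<rho>. A \<sigma> x * B \<sigma>' (shift (- \<sigma>) x)) =
        (\<Sum>\<sigma>\<in>?X. A \<sigma> x * B (\<rho> - \<sigma>) (shift (- \<sigma>) x))"
      by (simp add: sum.reindex inj_on_def)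
    also have "\<dots> = mult_sum X A B \<rho> x"
      unfolding mult_sum_def using assms(3,4)
      by (intro sum.mono_neutral_left) auto
    finally show ?thesis .
  qed
  then show ?thesis by (simp add: skew_ring_def mult_sum_def[abs_def])
qed

lemma premero_mult_sum:
  assumes "A \<in> carrier R" "B \<in> carrier R" "X \<subseteq> shifts"
  shows "premero W (mult_sum X A B \<rho>)"
  unfolding mult_sum_def using assms
  by (intro premero_sum premero_mult premero_shift open_W carrier_premero) auto

lemma mult_generic:
  assumes "A \<in> carrier R" "B \<in> carrier R" "finite X" "supp A \<subseteq> X" "X \<subseteq> shifts"
  shows "eventually (\<lambda>x. (A \<otimes>\<^bsub>R\<^esub> B) \<rho> x = mult_sum X A B \<rho> x) (generic W)"
  unfolding mult_coeff[OF assms(1-4)] using assms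
  by (intro mero_nf_generic open_W premero_mult_sum)

definition supp_sums :: "'n fsum \<Rightarrow> 'n fsum \<Rightarrow> 'n shift set" where
  "supp_sums A B = (\<lambda>(\<sigma>, \<rho>). \<sigma> + \<rho>) ` (supp A \<times> supp B)"

lemma finite_supp_sums: "A \<in> carrier R \<Longrightarrow> B \<in> carrier R \<Longrightarrow> finite (supp_sums A B)"
  and supp_sums_shifts: "A \<in> carrier R \<Longrightarrow> B \<in> carrier R \<Longrightarrow> supp_sums A B \<subseteq> shifts"
proof -
  assume A: "A \<in> carrier R" and B: "B \<in> carrier R"
  show "finite (supp_sums A B)"
    unfolding supp_sums_def by (intro finite_imageI finite_cartesian_product carrier_finite A B)
  show "supp_sums A B \<subseteq> shifts"
    using carrier_shifts[OF A] carrier_shifts[OF B]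
    by (auto simp: supp_sums_def intro!: shifts_add)
qed

lemma mult_sum_eq_0:
  assumes "\<rho> \<notin> supp_sums A B"
  shows "mult_sum (supp A) A B \<rho> = (\<lambda>_. 0)"
proof
  fix x
  have "B (\<rho> - \<sigma>) = 0" if "\<sigma> \<in> supp A" for \<sigma>
  proof (rule ccontr)
    assume "B (\<rho> - \<sigma>) \<noteq> 0"
    with that have "\<sigma> + (\<rho> - \<sigma>) \<in> supp_sums A B" unfolding supp_sums_def by (intro image_eqI[of _ _ "(\<sigma>, \<rho> - \<sigma>)"]) auto
    with assms show False by simp
  qed
  then show "mult_sum (supp A) A B \<rho> x = 0" by (simp add: mult_sum_def)
qed

lemma mult_closed:
  assumes "A \<in> carrier R" "B \<in> carrier R"
  shows "A \<otimes>\<^bsub>R\<^esub> B \<in> carrier R"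
  by (rule carrierI[OF mult_coeff premero_mult_sum finite_supp_sums supp_sums_shifts mult_sum_eq_0])
     (use assms carrier_finite carrier_shifts in auto)

lemma supp_mult:
  assumes "A \<in> carrier R" "B \<in> carrier R"
  shows "supp (A \<otimes>\<^bsub>R\<^esub> B) \<subseteq> supp_sums A B"
  using mult_coeff[OF assms carrier_finite[OF assms(1)] order_refl] mult_sum_eq_0[of _ A B] mero_nf_zero
  by force

lemma coeff_shift_generic:
  assumes "premero W f"
  shows "eventually (\<lambda>x. coeff_shift W f \<sigma> \<rho> x = (if \<rho> = \<sigma> then f x else 0)) (generic W)"
  using mero_nf_generic[OF open_W assms] by (auto simp: coeff_shift_def)

lemma coeff_shift_closed:
  assumes "premero W f" "\<sigma> \<in> shifts"
  shows "coeff_shift W f \<sigma> \<in> carrier R"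
  by (rule carrierI[where f = "\<lambda>\<rho>. if \<rho> = \<sigma> then f else (\<lambda>_. 0)" and X = "{\<sigma>}"])
     (use assms in \<open>auto simp: coeff_shift_def mero_nf_zero intro: premero_holo holo_on_const open_W\<close>)

lemma supp_coeff_shift: "supp (coeff_shift W f \<sigma>) \<subseteq> {\<sigma>}"
  by (auto simp: coeff_shift_def)

lemma one_coeff: "\<one>\<^bsub>R\<^esub> = coeff_shift W (\<lambda>_. 1) 0"
  by (simp add: skew_ring_def)

lemma one_closed: "\<one>\<^bsub>R\<^esub> \<in> carrier R"
  unfolding one_coeff by (intro coeff_shift_closed premero_holo holo_on_const open_W) simp

lemma one_generic: "eventually (\<lambda>x. \<one>\<^bsub>R\<^esub> \<rho> x = (if \<rho> = 0 then 1 else 0)) (generic W)"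
  unfolding one_coeff by (intro coeff_shift_generic premero_holo holo_on_const open_W)

lemma supp_one: "supp \<one>\<^bsub>R\<^esub> \<subseteq> {0}"
  unfolding one_coeff by (rule supp_coeff_shift)

text \<open>
  Generically both sides are the sum of the products of three coefficients over all pairs \<open>\<sigma>\<close>, \<open>\<mu>\<close>, where
  \<open>\<mu>\<close> is the total shift of the first two factors on one side and the shift of the second factor on
  the other.
\<close>

lemma mult_assoc:
  assumes A: "A \<in> carrier R" and B: "B \<in> carrier R" and C: "C \<in> carrier R"
  shows "(A \<otimes>\<^bsub>R\<^esub> B) \<otimes>\<^bsub>R\<^esub> C = A \<otimes>\<^bsub>R\<^esub> (B \<otimes>\<^bsub>R\<^esub> C)"
proof (rule carrier_eqI)
  fix \<rho>
  let ?X = "supp A" and ?Y = "supp B" and ?Z = "supp_sums A B"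
  note fin = carrier_finite[OF A] carrier_finite[OF B] finite_supp_sums[OF A B]
  note sh = carrier_shifts[OF A] carrier_shifts[OF B] supp_sums_shifts[OF A B]
  have 1: "eventually (\<lambda>x. ((A \<otimes>\<^bsub>R\<^esub> B) \<otimes>\<^bsub>R\<^esub> C) \<rho> x = mult_sum ?Z (A \<otimes>\<^bsub>R\<^esub> B) C \<rho> x) (generic W)"
    by (intro mult_generic mult_closed A B C fin sh supp_mult)
  have 2: "eventually (\<lambda>x. \<forall>\<mu>\<in>?Z. (A \<otimes>\<^bsub>R\<^esub> B) \<mu> x = mult_sum ?X A B \<mu> x) (generic W)"
    by (intro eventually_ball_finite ballI mult_generic A B fin sh order_refl)
  have 3: "eventually (\<lambda>x. (A \<otimes>\<^bsub>R\<^esub> (B \<otimes>\<^bsub>R\<^esub> C)) \<rho> x = mult_sum ?X A (B \<otimes>\<^bsub>R\<^esub> C) \<rho> x) (generic W)"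
    by (intro mult_generic mult_closed A B C fin sh order_refl)
  have 4: "eventually (\<lambda>x. \<forall>\<sigma>\<in>?X. (B \<otimes>\<^bsub>R\<^esub> C) (\<rho> - \<sigma>) (shift (- \<sigma>) x) =
      mult_sum ?Y B C (\<rho> - \<sigma>) (shift (- \<sigma>) x)) (generic W)"
  proof (intro eventually_ball_finite ballI fin)
    fix \<sigma> assume "\<sigma> \<in> ?X"
    then have "- \<sigma> \<in> shifts" using sh by auto
    then show "eventually (\<lambda>x. (B \<otimes>\<^bsub>R\<^esub> C) (\<rho> - \<sigma>) (shift (- \<sigma>) x) =
        mult_sum ?Y B C (\<rho> - \<sigma>) (shift (- \<sigma>) x)) (generic W)"
      by (intro eventually_shift[where \<sigma> = "- \<sigma>"] mult_generic B C fin sh order_refl)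
  qed
  show "eventually (\<lambda>x. ((A \<otimes>\<^bsub>R\<^esub> B) \<otimes>\<^bsub>R\<^esub> C) \<rho> x = (A \<otimes>\<^bsub>R\<^esub> (B \<otimes>\<^bsub>R\<^esub> C)) \<rho> x) (generic W)"
    using 1 2 3 4
  proof eventually_elim
    case (elim x)
    let ?t = "\<lambda>\<sigma> \<mu>. A \<sigma> x * B (\<mu> - \<sigma>) (shift (- \<sigma>) x) * C (\<rho> - \<mu>) (shift (- \<mu>) x)"
    have "((A \<otimes>\<^bsub>R\<^esub> B) \<otimes>\<^bsub>R\<^esub> C) \<rho> x = (\<Sum>\<mu>\<in>?Z. \<Sum>\<sigma>\<in>?X. ?t \<sigma> \<mu>)"
      unfolding elim(1) unfolding mult_sum_def[of ?Z] using elim(2)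
      by (intro sum.cong refl) (simp add: mult_sum_def sum_distrib_right)
    also have "\<dots> = (\<Sum>\<sigma>\<in>?X. \<Sum>\<mu>\<in>?Z. ?t \<sigma> \<mu>)"
      by (rule sum.swap)
    also have "\<dots> = (\<Sum>\<sigma>\<in>?X. \<Sum>\<mu>\<in>?Y. ?t \<sigma> (\<sigma> + \<mu>))"
      using fin by (intro sum.cong refl sum_reindex_shift) (auto simp: supp_sums_def)
    also have "\<dots> = (\<Sum>\<sigma>\<in>?X. A \<sigma> x * mult_sum ?Y B C (\<rho> - \<sigma>) (shift (- \<sigma>) x))"
      by (intro sum.cong refl)
         (simp add: mult_sum_def sum_distrib_left mult.assoc shift_shift algebra_simps)
    also have "\<dots> = (A \<otimes>\<^bsub>R\<^esub> (B \<otimes>\<^bsub>R\<^esub> C)) \<rho> x"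
      unfolding elim(3) unfolding mult_sum_def[of ?X] using elim(4) by (intro sum.cong refl) simp
    finally show ?case .
  qed
qed (intro mult_closed A B C)+

lemma ring_skew_ring: "ring R"
proof (rule ringI)
  show "abelian_group R"
  proof (rule abelian_groupI)
    fix A B C assume A: "A \<in> carrier R" and B: "B \<in> carrier R" and C: "C \<in> carrier R"
    show "A \<oplus>\<^bsub>R\<^esub> B \<in> carrier R" by (intro add_closed A B)
    show "(A \<oplus>\<^bsub>R\<^esub> B) \<oplus>\<^bsub>R\<^esub> C = A \<oplus>\<^bsub>R\<^esub> (B \<oplus>\<^bsub>R\<^esub> C)"
    proof (rule carrier_eqI)
      fix \<sigma>
      show "eventually (\<lambda>x. ((A \<oplus>\<^bsub>R\<^esub> B) \<oplus>\<^bsub>R\<^esub> C) \<sigma> x = (A \<oplus>\<^bsub>R\<^esub> (B \<oplus>\<^bsub>R\<^esub> C)) \<sigma> x) (generic W)"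
        using add_generic[OF add_closed[OF A B] C, of \<sigma>] add_generic[OF A B, of \<sigma>]
          add_generic[OF A add_closed[OF B C], of \<sigma>] add_generic[OF B C, of \<sigma>]
        by eventually_elim simp
    qed (intro add_closed A B C)+
    show "A \<oplus>\<^bsub>R\<^esub> B = B \<oplus>\<^bsub>R\<^esub> A"
      by (rule ext) (simp add: add_coeff add.commute)
    show "\<zero>\<^bsub>R\<^esub> \<oplus>\<^bsub>R\<^esub> A = A"
    proof (rule carrier_eqI)
      fix \<sigma>
      show "eventually (\<lambda>x. (\<zero>\<^bsub>R\<^esub> \<oplus>\<^bsub>R\<^esub> A) \<sigma> x = A \<sigma> x) (generic W)"
        using add_generic[OF zero_closed A, of \<sigma>] by eventually_elim (simp add: zero_coeff)
    qed (intro add_closed zero_closed A)+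
    define N where "N \<sigma> = mero_nf W (\<lambda>x. - 1 * A \<sigma> x)" for \<sigma>
    have p: "premero W (\<lambda>x. - 1 * A \<sigma> x)" for \<sigma>
      by (intro premero_mult premero_holo holo_on_const carrier_premero A open_W)
    have N: "N \<in> carrier R"
      by (rule carrierI[OF N_def p carrier_finite[OF A] carrier_shifts[OF A]]) auto
    have "N \<oplus>\<^bsub>R\<^esub> A = \<zero>\<^bsub>R\<^esub>"
    proof (rule carrier_eqI)
      fix \<sigma>
      show "eventually (\<lambda>x. (N \<oplus>\<^bsub>R\<^esub> A) \<sigma> x = \<zero>\<^bsub>R\<^esub> \<sigma> x) (generic W)"
        using add_generic[OF N A, of \<sigma>] coeff_generic[of N \<sigma>, OF N_def p]
        by eventually_elim (simp add: zero_coeff)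
    qed (intro add_closed zero_closed N A)+
    then show "\<exists>N\<in>carrier R. N \<oplus>\<^bsub>R\<^esub> A = \<zero>\<^bsub>R\<^esub>" using N by blast
  qed (rule zero_closed)
next
  show "Group.monoid R"
  proof (rule monoidI)
    fix A assume A: "A \<in> carrier R"
    show "\<one>\<^bsub>R\<^esub> \<otimes>\<^bsub>R\<^esub> A = A"
    proof (rule carrier_eqI)
      fix \<sigma>
      show "eventually (\<lambda>x. (\<one>\<^bsub>R\<^esub> \<otimes>\<^bsub>R\<^esub> A) \<sigma> x = A \<sigma> x) (generic W)"
        using mult_generic[OF one_closed A _ supp_one, of \<sigma>, simplified] one_generic[of 0]
        by eventually_elim (simp add: mult_sum_def)
    qed (intro mult_closed one_closed A)+
    show "A \<otimes>\<^bsub>R\<^esub> \<one>\<^bsub>R\<^esub> = A"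
    proof (rule carrier_eqI)
      fix \<rho>
      have "eventually (\<lambda>x. \<forall>\<sigma>\<in>supp A. \<one>\<^bsub>R\<^esub> (\<rho> - \<sigma>) (shift (- \<sigma>) x) =
          (if \<rho> - \<sigma> = 0 then 1 else 0)) (generic W)"
      proof (intro eventually_ball_finite ballI carrier_finite A)
        fix \<sigma> assume "\<sigma> \<in> supp A"
        then have "- \<sigma> \<in> shifts" using carrier_shifts[OF A] by auto
        then show "eventually (\<lambda>x. \<one>\<^bsub>R\<^esub> (\<rho> - \<sigma>) (shift (- \<sigma>) x) =
            (if \<rho> - \<sigma> = 0 then 1 else 0)) (generic W)"
          by (rule eventually_shift[OF one_generic])
      qed
      with mult_generic[OF A one_closed carrier_finite[OF A] order_refl carrier_shifts[OF A], of \<rho>]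
      show "eventually (\<lambda>x. (A \<otimes>\<^bsub>R\<^esub> \<one>\<^bsub>R\<^esub>) \<rho> x = A \<rho> x) (generic W)"
      proof eventually_elim
        case (elim x)
        have "mult_sum (supp A) A \<one>\<^bsub>R\<^esub> \<rho> x = (\<Sum>\<sigma>\<in>supp A. if \<sigma> = \<rho> then A \<sigma> x else 0)"
          unfolding mult_sum_def using elim(2) by (intro sum.cong refl) auto
        also have "\<dots> = A \<rho> x"
          using carrier_finite[OF A] by (auto simp: sum.delta)
        finally show ?case using elim(1) by simp
      qed
    qed (intro mult_closed one_closed A)+
  qed (simp_all add: mult_closed one_closed mult_assoc)
next
  fix A B C assume A: "A \<in> carrier R" and B: "B \<in> carrier R" and C: "C \<in> carrier R"
  define X where "X = supp A \<union> supp B \<union> supp (A \<oplus>\<^bsub>R\<^esub> B)"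
  note AB = add_closed[OF A B]
  have X: "finite X" "X \<subseteq> shifts" "supp A \<subseteq> X" "supp B \<subseteq> X" "supp (A \<oplus>\<^bsub>R\<^esub> B) \<subseteq> X"
    using A B AB carrier_finite carrier_shifts by (auto simp: X_def)
  show "(A \<oplus>\<^bsub>R\<^esub> B) \<otimes>\<^bsub>R\<^esub> C = A \<otimes>\<^bsub>R\<^esub> C \<oplus>\<^bsub>R\<^esub> B \<otimes>\<^bsub>R\<^esub> C"
  proof (rule carrier_eqI)
    fix \<rho>
    have "eventually (\<lambda>x. \<forall>\<sigma>\<in>X. (A \<oplus>\<^bsub>R\<^esub> B) \<sigma> x = A \<sigma> x + B \<sigma> x) (generic W)"
      by (intro eventually_ball_finite ballI X add_generic A B)
    moreover have "eventually (\<lambda>x. ((A \<oplus>\<^bsub>R\<^esub> B) \<otimes>\<^bsub>R\<^esub> C) \<rho> x = mult_sum X (A \<oplus>\<^bsub>R\<^esub> B) C \<rho> x) (generic W)"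
      "eventually (\<lambda>x. (A \<otimes>\<^bsub>R\<^esub> C) \<rho> x = mult_sum X A C \<rho> x) (generic W)"
      "eventually (\<lambda>x. (B \<otimes>\<^bsub>R\<^esub> C) \<rho> x = mult_sum X B C \<rho> x) (generic W)"
      by (intro mult_generic X A B C AB)+
    moreover note add_generic[OF mult_closed[OF A C] mult_closed[OF B C], of \<rho>]
    ultimately show "eventually (\<lambda>x. ((A \<oplus>\<^bsub>R\<^esub> B) \<otimes>\<^bsub>R\<^esub> C) \<rho> x =
        (A \<otimes>\<^bsub>R\<^esub> C \<oplus>\<^bsub>R\<^esub> B \<otimes>\<^bsub>R\<^esub> C) \<rho> x) (generic W)"
      by eventually_elim (simp add: mult_sum_def sum.distrib[symmetric] distrib_right cong: sum.cong)
  qed (intro add_closed mult_closed A B C)+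
  define Y where "Y = supp C"
  have Y: "finite Y" "supp C \<subseteq> Y" "Y \<subseteq> shifts"
    using carrier_finite[OF C] carrier_shifts[OF C] by (simp_all add: Y_def)
  show "C \<otimes>\<^bsub>R\<^esub> (A \<oplus>\<^bsub>R\<^esub> B) = C \<otimes>\<^bsub>R\<^esub> A \<oplus>\<^bsub>R\<^esub> C \<otimes>\<^bsub>R\<^esub> B"
  proof (rule carrier_eqI)
    fix \<rho>
    have "eventually (\<lambda>x. \<forall>\<sigma>\<in>Y. (A \<oplus>\<^bsub>R\<^esub> B) (\<rho> - \<sigma>) (shift (- \<sigma>) x) =
        A (\<rho> - \<sigma>) (shift (- \<sigma>) x) + B (\<rho> - \<sigma>) (shift (- \<sigma>) x)) (generic W)"
    proof (intro eventually_ball_finite ballI Y)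
      fix \<sigma> assume "\<sigma> \<in> Y"
      then have "- \<sigma> \<in> shifts" using Y by auto
      then show "eventually (\<lambda>x. (A \<oplus>\<^bsub>R\<^esub> B) (\<rho> - \<sigma>) (shift (- \<sigma>) x) =
          A (\<rho> - \<sigma>) (shift (- \<sigma>) x) + B (\<rho> - \<sigma>) (shift (- \<sigma>) x)) (generic W)"
        by (rule eventually_shift[OF add_generic[OF A B]])
    qed
    moreover have "eventually (\<lambda>x. (C \<otimes>\<^bsub>R\<^esub> (A \<oplus>\<^bsub>R\<^esub> B)) \<rho> x = mult_sum Y C (A \<oplus>\<^bsub>R\<^esub> B) \<rho> x) (generic W)"
      "eventually (\<lambda>x. (C \<otimes>\<^bsub>R\<^esub> A) \<rho> x = mult_sum Y C A \<rho> x) (generic W)"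
      "eventually (\<lambda>x. (C \<otimes>\<^bsub>R\<^esub> B) \<rho> x = mult_sum Y C B \<rho> x) (generic W)"
      by (intro mult_generic Y A B C AB)+
    moreover note add_generic[OF mult_closed[OF C A] mult_closed[OF C B], of \<rho>]
    ultimately show "eventually (\<lambda>x. (C \<otimes>\<^bsub>R\<^esub> (A \<oplus>\<^bsub>R\<^esub> B)) \<rho> x =
        (C \<otimes>\<^bsub>R\<^esub> A \<oplus>\<^bsub>R\<^esub> C \<otimes>\<^bsub>R\<^esub> B) \<rho> x) (generic W)"
      by eventually_elim (simp add: mult_sum_def sum.distrib[symmetric] distrib_left cong: sum.cong)
  qed (intro add_closed mult_closed A B C)+
qed

section \<open>The action of the skew group ring on functions\<close>

lemma apply_coeff:
  assumes "A \<in> carrier R" "finite X" "supp A \<subseteq> X"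
  shows "apply_fsum W A F = mero_nf W (\<lambda>x. \<Sum>\<sigma>\<in>X. A \<sigma> x * F (shift (- \<sigma>) x))"
proof -
  have "(\<Sum>\<sigma> | A \<sigma> \<noteq> 0. A \<sigma> x * F (shift (- \<sigma>) x)) = (\<Sum>\<sigma>\<in>X. A \<sigma> x * F (shift (- \<sigma>) x))" for x
    using assms by (intro sum.mono_neutral_left) auto
  then show ?thesis by (simp add: apply_fsum_def)
qed

lemma premero_action:
  assumes "A \<in> carrier R" "X \<subseteq> shifts" "premero W F"
  shows "premero W (\<lambda>x. \<Sum>\<sigma>\<in>X. A \<sigma> x * F (shift (- \<sigma>) x))"
  using assms(1,2)
  by (intro assms(3) premero_sum premero_mult premero_shift open_W carrier_premero) auto

lemma apply_generic:
  assumes "A \<in> carrier R" "finite X" "supp A \<subseteq> X" "X \<subseteq> shifts" "premero W F"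
  shows "eventually (\<lambda>x. apply_fsum W A F x = (\<Sum>\<sigma>\<in>X. A \<sigma> x * F (shift (- \<sigma>) x))) (generic W)"
  unfolding apply_coeff[OF assms(1-3)] using assms by (intro mero_nf_generic open_W premero_action)

lemma apply_mero:
  assumes "A \<in> carrier R" "premero W F"
  shows "apply_fsum W A F \<in> mero W"
  unfolding apply_coeff[OF assms(1) carrier_finite[OF assms(1)] order_refl] using assms
  by (intro mero_nf_in_mero open_W premero_action carrier_shifts)

lemma apply_add:
  assumes A: "A \<in> carrier R" and B: "B \<in> carrier R" and F: "premero W F"
  shows "eventually (\<lambda>x. apply_fsum W (A \<oplus>\<^bsub>R\<^esub> B) F x = apply_fsum W A F x + apply_fsum W B F x) (generic W)"
proof -
  define X where "X = supp A \<union> supp B \<union> supp (A \<oplus>\<^bsub>R\<^esub> B)"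
  note AB = add_closed[OF A B]
  have X: "finite X" "X \<subseteq> shifts" "supp A \<subseteq> X" "supp B \<subseteq> X" "supp (A \<oplus>\<^bsub>R\<^esub> B) \<subseteq> X"
    using A B AB carrier_finite carrier_shifts by (auto simp: X_def)
  have "eventually (\<lambda>x. \<forall>\<sigma>\<in>X. (A \<oplus>\<^bsub>R\<^esub> B) \<sigma> x = A \<sigma> x + B \<sigma> x) (generic W)"
    by (intro eventually_ball_finite ballI X add_generic A B)
  moreover have "eventually (\<lambda>x. apply_fsum W (A \<oplus>\<^bsub>R\<^esub> B) F x = (\<Sum>\<sigma>\<in>X. (A \<oplus>\<^bsub>R\<^esub> B) \<sigma> x * F (shift (- \<sigma>) x))) (generic W)"
    "eventually (\<lambda>x. apply_fsum W A F x = (\<Sum>\<sigma>\<in>X. A \<sigma> x * F (shift (- \<sigma>) x))) (generic W)"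
    "eventually (\<lambda>x. apply_fsum W B F x = (\<Sum>\<sigma>\<in>X. B \<sigma> x * F (shift (- \<sigma>) x))) (generic W)"
    by (intro apply_generic X A B AB F)+
  ultimately show ?thesis
    by eventually_elim (simp add: sum.distrib[symmetric] distrib_right cong: sum.cong)
qed

text \<open>
  The same reindexing as for associativity: the function \<open>F\<close> takes the place of the third factor.
\<close>

lemma apply_mult:
  assumes A: "A \<in> carrier R" and B: "B \<in> carrier R" and F: "premero W F"
  shows "apply_fsum W (A \<otimes>\<^bsub>R\<^esub> B) F = apply_fsum W A (apply_fsum W B F)"
proof (rule mero_eqI[OF open_W])
  let ?X = "supp A" and ?Y = "supp B" and ?Z = "supp_sums A B"
  note fin = carrier_finite[OF A] carrier_finite[OF B] finite_supp_sums[OF A B]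
  note sh = carrier_shifts[OF A] carrier_shifts[OF B] supp_sums_shifts[OF A B]
  have BF: "premero W (apply_fsum W B F)"
    using premero_mero[OF open_W apply_mero[OF B F]] .
  show "apply_fsum W (A \<otimes>\<^bsub>R\<^esub> B) F \<in> mero W" "apply_fsum W A (apply_fsum W B F) \<in> mero W"
    by (intro apply_mero mult_closed A B F BF)+
  have 1: "eventually (\<lambda>x. apply_fsum W (A \<otimes>\<^bsub>R\<^esub> B) F x =
      (\<Sum>\<mu>\<in>?Z. (A \<otimes>\<^bsub>R\<^esub> B) \<mu> x * F (shift (- \<mu>) x))) (generic W)"
    by (intro apply_generic mult_closed A B F fin sh supp_mult)
  have 2: "eventually (\<lambda>x. \<forall>\<mu>\<in>?Z. (A \<otimes>\<^bsub>R\<^esub> B) \<mu> x = mult_sum ?X A B \<mu> x) (generic W)"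
    by (intro eventually_ball_finite ballI mult_generic A B fin sh order_refl)
  have 3: "eventually (\<lambda>x. apply_fsum W A (apply_fsum W B F) x =
      (\<Sum>\<sigma>\<in>?X. A \<sigma> x * apply_fsum W B F (shift (- \<sigma>) x))) (generic W)"
    by (intro apply_generic A BF fin sh order_refl)
  have 4: "eventually (\<lambda>x. \<forall>\<sigma>\<in>?X. apply_fsum W B F (shift (- \<sigma>) x) =
      (\<Sum>\<rho>\<in>?Y. B \<rho> (shift (- \<sigma>) x) * F (shift (- \<rho>) (shift (- \<sigma>) x)))) (generic W)"
  proof (intro eventually_ball_finite ballI fin)
    fix \<sigma> assume "\<sigma> \<in> ?X"
    then have "- \<sigma> \<in> shifts" using sh by auto
    then show "eventually (\<lambda>x. apply_fsum W B F (shift (- \<sigma>) x) =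
      (\<Sum>\<rho>\<in>?Y. B \<rho> (shift (- \<sigma>) x) * F (shift (- \<rho>) (shift (- \<sigma>) x)))) (generic W)"
      by (intro eventually_shift[where \<sigma> = "- \<sigma>"] apply_generic B F fin sh order_refl)
  qed
  show "eventually (\<lambda>x. apply_fsum W (A \<otimes>\<^bsub>R\<^esub> B) F x = apply_fsum W A (apply_fsum W B F) x) (generic W)"
    using 1 2 3 4
  proof eventually_elim
    case (elim x)
    let ?t = "\<lambda>\<sigma> \<mu>. A \<sigma> x * B (\<mu> - \<sigma>) (shift (- \<sigma>) x) * F (shift (- \<mu>) x)"
    have "apply_fsum W (A \<otimes>\<^bsub>R\<^esub> B) F x = (\<Sum>\<mu>\<in>?Z. \<Sum>\<sigma>\<in>?X. ?t \<sigma> \<mu>)"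
      unfolding elim(1) using elim(2)
      by (intro sum.cong refl) (simp add: mult_sum_def sum_distrib_right)
    also have "\<dots> = (\<Sum>\<sigma>\<in>?X. \<Sum>\<mu>\<in>?Z. ?t \<sigma> \<mu>)"
      by (rule sum.swap)
    also have "\<dots> = (\<Sum>\<sigma>\<in>?X. \<Sum>\<mu>\<in>?Y. ?t \<sigma> (\<sigma> + \<mu>))"
      using fin by (intro sum.cong refl sum_reindex_shift) (auto simp: supp_sums_def)
    also have "\<dots> = (\<Sum>\<sigma>\<in>?X. A \<sigma> x * apply_fsum W B F (shift (- \<sigma>) x))"
      using elim(4)
      by (intro sum.cong refl)
         (simp add: sum_distrib_left mult.assoc shift_shift algebra_simps)
    also have "\<dots> = apply_fsum W A (apply_fsum W B F) x"
      by (simp add: elim(3))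
    finally show ?case .
  qed
qed

lemma apply_one:
  assumes F: "F \<in> mero W"
  shows "apply_fsum W \<one>\<^bsub>R\<^esub> F = F"
proof (rule mero_eqI[OF open_W _ F])
  have F': "premero W F" using premero_mero[OF open_W F] .
  show "apply_fsum W \<one>\<^bsub>R\<^esub> F \<in> mero W" by (rule apply_mero[OF one_closed F'])
  show "eventually (\<lambda>x. apply_fsum W \<one>\<^bsub>R\<^esub> F x = F x) (generic W)"
    using apply_generic[OF one_closed _ supp_one _ F', simplified] one_generic[of 0]
    by eventually_elim simp
qed

lemma apply_zero: "apply_fsum W \<zero>\<^bsub>R\<^esub> F = 0"
  using apply_coeff[OF zero_closed, of "{}"] mero_nf_zero by (simp add: zero_coeff)

end

section \<open>Sums of functions and opposite rings\<close>

lemma sum_fun_apply: "(\<Sum>a\<in>X. f a) x = (\<Sum>a\<in>X. f a x)"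
  by (induction X rule: infinite_finite_induct) auto

lemma ring_opposite:
  assumes "ring A"
  shows "ring (opposite_ring A)"
proof -
  interpret ring A by fact
  show ?thesis
  proof (rule ringI)
    show "abelian_group (opposite_ring A)"
    proof (rule abelian_groupI)
      fix x assume "x \<in> carrier (opposite_ring A)"
      then show "\<exists>y\<in>carrier (opposite_ring A). y \<oplus>\<^bsub>opposite_ring A\<^esub> x = \<zero>\<^bsub>opposite_ring A\<^esub>"
        by (auto simp: opposite_ring_def intro: l_neg)
    qed (auto simp: opposite_ring_def a_ac)
    show "Group.monoid (opposite_ring A)"
      by (rule monoidI) (auto simp: opposite_ring_def m_assoc)
  qed (auto simp: opposite_ring_def l_distr r_distr)
qed

section \<open>The transposition and its fixed hyperplane\<close>

lemma permute_row_swap_nth: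
  assumes "i \<le> k" "j \<le> k"
  shows "permute (row_swap k i j) x $ p = x $ Transposition.transpose (tp k i) (tp k j) p"
proof (cases "trow p = k")
  case True
  then have p: "p = tp k (tcol p)" using tp_trow_tcol[of p] by simp
  have "tp k (tcol p) = tp k a \<longleftrightarrow> tcol p = a" if "a \<le> k" for a
    using that p tcol_tp[of a k] by metis
  then show ?thesis using assms True p
    by (auto simp: permute_def row_swap_def Transposition.transpose_def)
next
  case False
  then have "p \<noteq> tp k i" "p \<noteq> tp k j" using assms by auto
  then show ?thesis using False by (simp add: permute_def row_swap_def Transposition.transpose_def)
qed

lemma permute_id: "permute (\<lambda>_. id) = id"
  by (auto simp: permute_def fun_eq_iff vec_eq_iff)

text \<open>
  The consequences of one-singularity that the proof uses: \<open>v\<close> lies on the hyperplane, and its stabilizer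
  consists of the identity and the transposition.
\<close>

locale swap_domain = shift_domain W for W :: "'n::{finite,linorder} tableau set" +
  fixes v :: "'n tableau" and k i j :: 'n
  assumes le: "i \<le> k" "j \<le> k" and neq: "i \<noteq> j"
    and tau_W: "permute (row_swap k i j) ` W = W"
    and v_W: "v \<in> W" and z1_v: "z1 k i j v = 0"
    and stab_v: "stab v = {\<lambda>_. id, row_swap k i j}"
begin

abbreviation "\<tau> \<equiv> permute (row_swap k i j)"
abbreviation "P \<equiv> tp k i"
abbreviation "Q \<equiv> tp k j"
abbreviation "z \<equiv> z1 k i j"
abbreviation "d \<equiv> dz1 k i j"

text \<open>
  The coordinate vector of \<open>z1\<close> for the coordinates in which \<open>z2\<close> is the sum of the two entries.
\<close>

definition e :: "'n tableau" where "e = axis P (1/2) - axis Q (1/2)"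

lemma PQ: "P \<noteq> Q" "Q \<noteq> P"
  using le neq tcol_tp by metis+

lemma tau_nth: "\<tau> x $ p = x $ Transposition.transpose P Q p"
  by (rule permute_row_swap_nth[OF le])

lemma tau_PQ [simp]: "\<tau> x $ P = x $ Q" "\<tau> x $ Q = x $ P"
  by (simp_all add: tau_nth)

lemma tau_tau [simp]: "\<tau> (\<tau> x) = x"
  by (simp add: vec_eq_iff tau_nth)

lemma inv_tau: "inv \<tau> = \<tau>"
  by (rule inv_unique_comp) (auto simp: fun_eq_iff)

lemma tau_eq_iff: "\<tau> x = x \<longleftrightarrow> x $ P = x $ Q"
proof
  assume "\<tau> x = x"
  then have "\<tau> x $ P = x $ P" by simp
  then show "x $ P = x $ Q" by simp
qed (auto simp: vec_eq_iff tau_nth Transposition.transpose_def)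

lemma tau_inject: "\<tau> x = \<tau> y \<longleftrightarrow> x = y"
  by (metis tau_tau)

lemma e_PQ: "e $ P = 1/2" "e $ Q = - 1/2"
  using PQ by (simp_all add: e_def axis_def)

lemma z_nth: "z x = x $ P - x $ Q"
  by (simp add: z1_def)

lemma d_def: "d f x = deriv (\<lambda>t. f (x + t *s e)) 0"
  by (simp add: dz1_def e_def)

lemma z_form: "clinear_form z"
  by unfold_locales (simp_all add: z_nth algebra_simps)

lemma z_e: "z e = 1"
  by (simp add: z_nth e_PQ)

lemma z_line: "z (x + t *s e) = z x + t"
  by (simp add: z_nth e_PQ)

lemma z_tau [simp]: "z (\<tau> x) = - z x"
  by (simp add: z_nth)

lemma z_shift: "z (shift \<sigma> x) = z x + of_int (\<sigma> $ P - \<sigma> $ Q)"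
  by (simp add: z_nth shift_def)

lemma tau_fix: "z x = 0 \<Longrightarrow> \<tau> x = x"
  by (simp add: tau_eq_iff z_nth)

lemma tau_line: "\<tau> (x + t *s e) = \<tau> x + (- t) *s e"
proof -
  have "\<tau> e $ p = - (e $ p)" for p
    using PQ by (auto simp: tau_nth Transposition.transpose_def e_PQ) (simp add: e_def axis_def)
  then show ?thesis by (simp add: vec_eq_iff tau_nth)
qed

lemma shift_line: "shift \<sigma> (x + t *s e) = shift \<sigma> x + t *s e"
  by (simp add: shift_def vec_eq_iff)

lemma tau_shift: "\<tau> (shift \<sigma> x) = shift (\<tau> \<sigma>) (\<tau> x)"
  by (simp add: vec_eq_iff tau_nth shift_def)

lemma tau_minus: "\<tau> (- \<sigma>) = - \<tau> (\<sigma> :: 'n shift)"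
  by (simp add: vec_eq_iff tau_nth)

lemma trow_transpose: "trow (Transposition.transpose P Q p) = trow p"
  using le by (auto simp: Transposition.transpose_def)

lemma tau_shifts [simp]: "\<tau> \<sigma> \<in> shifts \<longleftrightarrow> \<sigma> \<in> shifts"
proof -
  have *: "\<tau> \<sigma> \<in> shifts" if "\<sigma> \<in> shifts" for \<sigma>
    using that by (simp add: shifts_def tau_nth trow_transpose)
  show ?thesis using *[of \<sigma>] *[of "\<tau> \<sigma>"] by auto
qed

lemma biholo_tau: "biholo \<tau> \<tau> \<tau> \<tau>"
proof -
  have "bounded_linear (\<tau> :: 'n tableau \<Rightarrow> _)"
    unfolding linear_conv_bounded_linear[symmetric]
    by (rule linearI) (simp_all add: vec_eq_iff tau_nth)
  then show ?thesis
    by unfold_locales (auto simp: vec_eq_iff tau_nth intro: bounded_linear_imp_has_derivative)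
qed

lemma tau_in_W [simp]: "\<tau> x \<in> W \<longleftrightarrow> x \<in> W"
  using tau_W tau_inject by (metis image_iff tau_tau)

lemma tau_vimage: "\<tau> -` W = W"
  by auto

lemma d_has_derivative:
  assumes "holo_on f U" "x \<in> U"
  shows "((\<lambda>t. f (x + t *s e)) has_field_derivative d f x) (at 0)"
proof -
  obtain L where "(f has_derivative L) (at x)" "\<And>c h. L (c *s h) = c * L h"
    using assms unfolding holo_on_def by meson
  then have "((\<lambda>t. f (x + t *s e)) has_field_derivative L e) (at 0)"
    by (intro has_field_derivative_line) simp_all
  then show ?thesis unfolding d_def using DERIV_imp_deriv by metis
qed

lemma d_eqI: "((\<lambda>t. f (x + t *s e)) has_field_derivative D) (at 0) \<Longrightarrow> d f x = D"
  unfolding d_def by (rule DERIV_imp_deriv)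

lemma d_mult:
  assumes "holo_on f U" "holo_on g U" "x \<in> U"
  shows "d (\<lambda>x. f x * g x) x = d f x * g x + f x * d g x"
  using DERIV_mult[OF d_has_derivative[OF assms(1,3)] d_has_derivative[OF assms(2,3)]]
  by (intro d_eqI) (simp add: algebra_simps)

lemma d_add:
  assumes "holo_on f U" "holo_on g U" "x \<in> U"
  shows "d (\<lambda>x. f x + g x) x = d f x + d g x"
  using DERIV_add[OF d_has_derivative[OF assms(1,3)] d_has_derivative[OF assms(2,3)]]
  by (intro d_eqI)

lemma d_const [simp]: "d (\<lambda>_. c) x = 0"
  by (intro d_eqI) simp

lemma d_z [simp]: "d z x = 1"
  by (intro d_eqI) (auto simp: z_line intro!: derivative_eq_intros)

lemma eventually_line_in:
  assumes "open U" "x \<in> U"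
  shows "eventually (\<lambda>t. x + t *s e \<in> U) (nhds 0)"
proof -
  have "continuous_on UNIV (\<lambda>t. x + t *s e)"
    by (intro continuous_intros bounded_linear.continuous_on[OF bounded_linear_smult_left])
  then have "open ((\<lambda>t. x + t *s e) -` U)" using assms(1) by (rule open_vimage[rotated])
  then show ?thesis unfolding eventually_nhds using assms(2)
    by (intro exI[of _ "(\<lambda>t. x + t *s e) -` U"]) auto
qed

lemma d_cong:
  assumes "open U" "x \<in> U" "\<And>y. y \<in> U \<Longrightarrow> f y = g y"
  shows "d f x = d g x"
  unfolding d_def
  by (rule deriv_cong_ev) (use eventually_line_in[OF assms(1,2)] assms(3) in \<open>auto elim: eventually_mono\<close>)

lemma d_shift: "d (\<lambda>x. f (shift \<sigma> x)) x = d f (shift \<sigma> x)"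
  by (simp add: d_def shift_line)

text \<open>
  Reflection by \<open>\<tau>\<close> reverses the line through \<open>x\<close> in the direction \<open>e\<close>.
\<close>

lemma d_tau:
  assumes "holo_on f U" "x \<in> U" "\<And>x. f (\<tau> x) = f x"
  shows "d f (\<tau> x) = - d f x"
proof (rule d_eqI)
  have "((\<lambda>t. f (x + t *s e)) has_field_derivative d f x) (at (- 0))"
    using d_has_derivative[OF assms(1,2)] by simp
  then have "((\<lambda>t. f (x + (- t) *s e)) has_field_derivative d f x * (- 1)) (at 0)"
    by (rule DERIV_chain2[where g = uminus and x = 0]) (rule DERIV_minus[OF DERIV_ident])
  moreover have "f (\<tau> x + t *s e) = f (x + (- t) *s e)" for t
    using assms(3)[of "x + (- t) *s e"] tau_line[of x "- t"] by simp
  ultimately show "((\<lambda>t. f (\<tau> x + t *s e)) has_field_derivative - d f x) (at 0)"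
    by (simp only: mult_minus_right mult_1_right)
qed

lemma z_nonzero_generic:
  assumes "open U"
  shows "eventually (\<lambda>x. z x \<noteq> c) (generic U)"
proof -
  have "x \<in> closure {x\<in>U. z x \<noteq> c}" if x: "x \<in> U" for x
    unfolding closure_approachable
  proof (intro allI impI)
    fix \<epsilon> :: real assume "\<epsilon> > 0"
    obtain R where R: "R > 0" "ball x R \<subseteq> U" using assms x openE by blast
    obtain r where r: "r > 0" "\<And>s. cmod s \<le> r \<Longrightarrow> norm (s *s e) < min \<epsilon> R"
      using line_in_ball[of "min \<epsilon> R" e] \<open>\<epsilon> > 0\<close> R by auto
    define s where "s = (if z x = c then complex_of_real r else 0)"
    have s: "cmod s \<le> r" using r by (simp add: s_def)
    have "x + s *s e \<in> ball x R" using r(2)[OF s] by (simp add: dist_norm)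
    moreover have "z (x + s *s e) \<noteq> c" using r by (simp add: z_line s_def)
    moreover have "dist (x + s *s e) x < \<epsilon>" using r(2)[OF s] by (simp add: dist_norm)
    ultimately show "\<exists>y\<in>{x\<in>U. z x \<noteq> c}. dist y x < \<epsilon>" using R by blast
  qed
  moreover have "open {x\<in>U. z x - c \<noteq> 0}"
    by (intro open_holo_nonzero holo_on_diff clinear_form.holo[OF z_form] holo_on_const assms)
  ultimately show ?thesis
    unfolding eventually_generic[OF assms] by (intro exI[of _ "{x\<in>U. z x \<noteq> c}"]) auto
qed

lemma holo_z: "open U \<Longrightarrow> holo_on z U"
  by (rule clinear_form.holo[OF z_form])

lemma premero_divide_z:
  assumes "holo_on H W"
  shows "premero W (\<lambda>x. H x / z x)"
  unfolding premero_def
proof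
  fix x assume "x \<in> W"
  then show "\<exists>U p q. x \<in> U \<and> holo_on p U \<and> holo_on q U \<and> eventually (\<lambda>u. q u \<noteq> 0) (generic U) \<and>
    eventually (\<lambda>u. H u / z u = p u / q u) (generic U)"
    using assms holo_z[OF open_W] z_nonzero_generic[OF open_W]
    by (intro exI[of _ W] exI[of _ H] exI[of _ z]) auto
qed

abbreviation "\<H> \<equiv> inv_holo W v"

lemma inv_holo_iff:
  "F \<in> \<H> \<longleftrightarrow> holo_on F W \<and> (\<forall>x. x \<notin> W \<longrightarrow> F x = 0) \<and> (\<forall>x. F (\<tau> x) = F x)"
  by (auto simp: inv_holo_def stab_v permute_id inv_tau fun_eq_iff)

lemma inv_holoD:
  assumes "F \<in> \<H>"
  shows "holo_on F W" "x \<notin> W \<Longrightarrow> F x = 0" "F (\<tau> x) = F x"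
  using assms by (auto simp: inv_holo_iff)

lemma inv_holo_mero:
  assumes "F \<in> \<H>"
  shows "F \<in> mero W"
proof -
  have "mero_nf W F = F"
    using mero_nf_holo[OF inv_holoD(1)[OF assms]] inv_holoD(2)[OF assms] by (auto simp: fun_eq_iff)
  then show ?thesis using premero_holo[OF inv_holoD(1)[OF assms]] by (simp add: mero_iff open_W)
qed

lemma inv_holo_premero: "F \<in> \<H> \<Longrightarrow> premero W F"
  by (intro premero_holo inv_holoD)

lemma inv_holo_add: "F \<in> \<H> \<Longrightarrow> G \<in> \<H> \<Longrightarrow> F + G \<in> \<H>"
  using holo_on_add[of F W G] by (auto simp: inv_holo_iff plus_fun_def)

lemma inv_holo_scale: "F \<in> \<H> \<Longrightarrow> fscale c F \<in> \<H>"
  using holo_on_cmult[of F W c] by (auto simp: inv_holo_iff fscale_def)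

lemma inv_holo_restrict:
  assumes "holo_on f W" "\<And>x. x \<in> W \<Longrightarrow> f (\<tau> x) = f x"
  shows "(\<lambda>x. if x \<in> W then f x else 0) \<in> \<H>"
  using assms holo_on_cong[of f W "\<lambda>x. if x \<in> W then f x else 0"] by (auto simp: inv_holo_iff)

lemma d_inv_holo_tau: "F \<in> \<H> \<Longrightarrow> x \<in> W \<Longrightarrow> d F (\<tau> x) = - d F x"
  by (rule d_tau[of F W]) (auto dest: inv_holoD)

section \<open>The universal ring acts on invariant holomorphic functions\<close>

definition gens :: "'n fsum set" where
  "gens = {A \<in> invariants W v. \<forall>\<sigma>. \<exists>H. holo_on H W \<and> A \<sigma> = mero_nf W (\<lambda>x. H x / z x)}"

lemma gens_carrier: "A \<in> gens \<Longrightarrow> A \<in> carrier R"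
  by (simp add: gens_def invariants_def)

lemma gens_tau:
  assumes "A \<in> gens"
  shows "A (\<tau> \<sigma>) (\<tau> x) = A \<sigma> x"
proof -
  have "fsum_perm (row_swap k i j) A = A"
    using assms by (simp add: gens_def invariants_def stab_v)
  then have "A (\<tau> \<sigma>) \<circ> \<tau> = A \<sigma>" by (simp add: fsum_perm_def inv_tau fun_eq_iff)
  then show ?thesis by (simp add: fun_eq_iff)
qed

lemma gensI:
  assumes "finite X" "X \<subseteq> shifts" "\<And>\<sigma>. \<sigma> \<notin> X \<Longrightarrow> H \<sigma> = (\<lambda>_. 0)"
    and H: "\<And>\<sigma>. holo_on (H \<sigma>) W" and anti: "\<And>\<sigma> x. H (\<tau> \<sigma>) (\<tau> x) = - H \<sigma> x"
  shows "(\<lambda>\<sigma>. mero_nf W (\<lambda>x. H \<sigma> x / z x)) \<in> gens"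
proof -
  let ?A = "\<lambda>\<sigma>. mero_nf W (\<lambda>x. H \<sigma> x / z x)"
  have "?A \<in> carrier R"
    by (rule carrierI[OF refl premero_divide_z[OF H] assms(1,2)]) (simp add: assms(3))
  moreover have "?A (\<tau> \<sigma>) (\<tau> x) = ?A \<sigma> x" for \<sigma> x
    using biholo.mero_nf_T[OF biholo_tau open_W tau_vimage, of "\<lambda>x. H (\<tau> \<sigma>) x / z x" x]
    by (simp add: anti)
  then have "fsum_perm (row_swap k i j) ?A = ?A" by (simp add: fsum_perm_def inv_tau fun_eq_iff)
  moreover have "fsum_perm (\<lambda>_. id) ?A = ?A"
    by (simp add: fsum_perm_def permute_id fun_eq_iff)
  ultimately show ?thesis
    using H by (auto simp: gens_def invariants_def stab_v)
qed

lemma holo_shift: "holo_on f W \<Longrightarrow> \<sigma> \<in> shifts \<Longrightarrow> holo_on (\<lambda>x. f (shift \<sigma> x)) W"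
  using biholo.holo_on_T[OF biholo_shift, of f W \<sigma>] shift_vimage[of \<sigma>] by simp

text \<open>
  The numerator \<open>\<Phi>\<close> of the image of \<open>F\<close> changes sign under \<open>\<tau>\<close>, because the image is invariant and the
  denominator \<open>z\<close> changes sign.  So \<open>\<Phi>\<close> vanishes where \<open>z\<close> does and the quotient is holomorphic.
\<close>

lemma gens_action:
  assumes A: "A \<in> gens" and F: "F \<in> \<H>"
  shows "apply_fsum W A F \<in> \<H>"
proof -
  note AR = gens_carrier[OF A] and F' = inv_holo_premero[OF F]
  let ?G = "apply_fsum W A F" and ?X = "supp A"
  note X = carrier_finite[OF AR] and Xs = carrier_shifts[OF AR]
  have "\<forall>\<sigma>. \<exists>H. holo_on H W \<and> A \<sigma> = mero_nf W (\<lambda>x. H x / z x)"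
    using A by (simp add: gens_def)
  then obtain H where H: "\<And>\<sigma>. holo_on (H \<sigma>) W" "\<And>\<sigma>. A \<sigma> = mero_nf W (\<lambda>x. H \<sigma> x / z x)"
    unfolding choice_iff by blast
  define \<Phi> where "\<Phi> x = (\<Sum>\<sigma>\<in>?X. H \<sigma> x * F (shift (- \<sigma>) x))" for x
  have \<Phi>: "holo_on \<Phi> W"
    unfolding \<Phi>_def using Xs
    by (intro holo_on_sum open_W holo_on_mult H holo_shift inv_holoD(1)[OF F]) auto
  have AH: "eventually (\<lambda>x. \<forall>\<sigma>\<in>?X. A \<sigma> x = H \<sigma> x / z x) (generic W)"
    by (intro eventually_ball_finite X ballI coeff_generic H(2) premero_divide_z H(1))
  have z0: "eventually (\<lambda>x. z x \<noteq> 0) (generic W)"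
    by (rule z_nonzero_generic[OF open_W])
  have \<Phi>A: "eventually (\<lambda>x. \<Phi> x = z x * (\<Sum>\<sigma>\<in>?X. A \<sigma> x * F (shift (- \<sigma>) x))) (generic W)"
    using AH z0
  proof eventually_elim
    case (elim x)
    then show ?case unfolding \<Phi>_def sum_distrib_left by (intro sum.cong refl) simp
  qed
  have tau_X: "\<tau> \<sigma> \<in> ?X \<longleftrightarrow> \<sigma> \<in> ?X" for \<sigma>
  proof -
    have "A (\<tau> \<sigma>) = 0" if "A \<sigma> = 0" for \<sigma>
    proof
      fix x show "A (\<tau> \<sigma>) x = 0 x" using gens_tau[OF A, of \<sigma> "\<tau> x"] that by simp
    qed
    from this[of \<sigma>] this[of "\<tau> \<sigma>"] show ?thesis by auto
  qed
  have sum_tau: "(\<Sum>\<sigma>\<in>?X. A \<sigma> (\<tau> x) * F (shift (- \<sigma>) (\<tau> x))) = (\<Sum>\<sigma>\<in>?X. A \<sigma> x * F (shift (- \<sigma>) x))" for x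
  proof (rule sum.reindex_bij_witness[of _ \<tau> \<tau>])
    fix \<sigma> assume "\<sigma> \<in> ?X"
    have "shift (- \<sigma>) (\<tau> x) = \<tau> (shift (- \<tau> \<sigma>) x)"
      by (simp add: tau_shift tau_minus)
    then show "A (\<tau> \<sigma>) x * F (shift (- \<tau> \<sigma>) x) = A \<sigma> (\<tau> x) * F (shift (- \<sigma>) (\<tau> x))"
      using gens_tau[OF A, of "\<tau> \<sigma>" x] inv_holoD(3)[OF F] by simp
  qed (use tau_X in simp_all)
  have "eventually (\<lambda>x. \<Phi> (\<tau> x) = - \<Phi> x) (generic W)"
    using biholo.eventually_T[OF biholo_tau open_W tau_vimage \<Phi>A] \<Phi>A
    by eventually_elim (simp add: sum_tau)
  moreover have "holo_on (\<lambda>x. \<Phi> (\<tau> x)) W"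
    using biholo.holo_on_T[OF biholo_tau \<Phi>] tau_vimage by simp
  ultimately have anti: "\<Phi> (\<tau> x) = - \<Phi> x" if "x \<in> W" for x
    using generic_eq_imp_eq[OF open_W, of "\<lambda>x. \<Phi> (\<tau> x)" "\<lambda>x. - \<Phi> x" x] that \<Phi>
      holo_on_imp_continuous_on continuous_on_minus by blast
  have "\<Phi> x = 0" if "x \<in> W" "z x = 0" for x
    using anti[OF that(1)] tau_fix[OF that(2)] by simp
  then obtain \<psi> where \<psi>: "holo_on \<psi> W" "\<And>x. x \<in> W \<Longrightarrow> \<Phi> x = z x * \<psi> x"
    using clinear_form.holo_on_division[OF z_form \<Phi> z_e] by metis
  have G\<psi>: "eventually (\<lambda>x. ?G x = \<psi> x) (generic W)"
    using apply_generic[OF AR X order_refl Xs F'] \<Phi>A z0 eventually_generic_mem[OF open_W]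
    by eventually_elim (use \<psi>(2) in auto)
  have "?G = mero_nf W ?G"
    using apply_mero[OF AR F'] by (simp add: mero_iff[OF open_W])
  also have "\<dots> = mero_nf W \<psi>" by (rule mero_nf_cong[OF open_W G\<psi>])
  also have "\<dots> = (\<lambda>x. if x \<in> W then \<psi> x else 0)" using mero_nf_holo[OF \<psi>(1)] by auto
  finally have G: "?G = (\<lambda>x. if x \<in> W then \<psi> x else 0)" .
  have "eventually (\<lambda>x. \<psi> (\<tau> x) = \<psi> x) (generic W)"
    using z0 eventually_generic_mem[OF open_W]
  proof eventually_elim
    case (elim x)
    have "z x * \<psi> (\<tau> x) = z x * \<psi> x"
      using anti[OF elim(2)] \<psi>(2)[OF elim(2)] \<psi>(2)[of "\<tau> x"] elim(2) by simp
    then show ?case using elim(1) by simp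
  qed
  moreover have "holo_on (\<lambda>x. \<psi> (\<tau> x)) W"
    using biholo.holo_on_T[OF biholo_tau \<psi>(1)] tau_vimage by simp
  ultimately have "\<psi> (\<tau> x) = \<psi> x" if "x \<in> W" for x
    using generic_eq_imp_eq[OF open_W, of "\<lambda>x. \<psi> (\<tau> x)" \<psi> x] that \<psi>(1)
      holo_on_imp_continuous_on by blast
  then show ?thesis unfolding G by (intro inv_holo_restrict \<psi>(1))
qed

abbreviation "\<D> \<equiv> univ_ring W v k i j"

lemma carrier_D: "carrier \<D> = generate_ring R gens"
  by (simp add: univ_ring_def gens_def)

lemma D_ops: "mult \<D> = mult R" "add \<D> = add R" "one \<D> = one R" "zero \<D> = zero R"
  by (simp_all add: univ_ring_def)

lemma D_carrier: "A \<in> carrier \<D> \<Longrightarrow> A \<in> carrier R"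
  unfolding carrier_D using ring.generate_ring_in_carrier[OF ring_skew_ring] gens_carrier by blast

lemma ring_D: "ring \<D>"
proof -
  have "ring (R\<lparr>carrier := generate_ring R gens\<rparr>)"
    using ring.generate_ring_is_ring[OF ring_skew_ring] gens_carrier by blast
  then show ?thesis by (simp add: univ_ring_def gens_def)
qed

lemma a_inv_closed: "A \<in> carrier R \<Longrightarrow> \<ominus>\<^bsub>R\<^esub> A \<in> carrier R"
  by (rule abelian_group.a_inv_closed[OF ring.is_abelian_group[OF ring_skew_ring]])

lemma a_inv_add: "A \<in> carrier R \<Longrightarrow> \<ominus>\<^bsub>R\<^esub> A \<oplus>\<^bsub>R\<^esub> A = \<zero>\<^bsub>R\<^esub>"
  by (rule abelian_group.l_neg[OF ring.is_abelian_group[OF ring_skew_ring]])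

lemma apply_add_inv_holo:
  assumes A: "A \<in> carrier R" and B: "B \<in> carrier R" and F: "F \<in> \<H>"
    and AF: "apply_fsum W A F \<in> \<H>" and BF: "apply_fsum W B F \<in> \<H>"
  shows "apply_fsum W (A \<oplus>\<^bsub>R\<^esub> B) F = apply_fsum W A F + apply_fsum W B F"
  using apply_add[OF A B inv_holo_premero[OF F]]
  by (intro mero_eqI[OF open_W apply_mero[OF add_closed[OF A B] inv_holo_premero[OF F]]
        inv_holo_mero[OF inv_holo_add[OF AF BF]]]) simp

lemma D_action:
  assumes "A \<in> carrier \<D>" "F \<in> \<H>"
  shows "apply_fsum W A F \<in> \<H>"
  using assms unfolding carrier_D
proof (induction A arbitrary: F)
  case one
  then show ?case using apply_one[OF inv_holo_mero] by simp
next
  case (incl A)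
  then show ?case by (rule gens_action)
next
  case (a_inv A)
  have A: "A \<in> carrier R" using a_inv D_carrier carrier_D by blast
  note F = inv_holo_premero[OF a_inv.prems] and AF = a_inv.IH[OF a_inv.prems]
  have "apply_fsum W (\<ominus>\<^bsub>R\<^esub> A) F = fscale (- 1) (apply_fsum W A F)"
  proof (rule mero_eqI[OF open_W])
    show "apply_fsum W (\<ominus>\<^bsub>R\<^esub> A) F \<in> mero W" by (intro apply_mero a_inv_closed A F)
    show "fscale (- 1) (apply_fsum W A F) \<in> mero W" by (intro inv_holo_mero inv_holo_scale AF)
    show "eventually (\<lambda>x. apply_fsum W (\<ominus>\<^bsub>R\<^esub> A) F x = fscale (- 1) (apply_fsum W A F) x) (generic W)"
      using apply_add[OF a_inv_closed[OF A] A F]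
      by eventually_elim (simp add: a_inv_add[OF A] apply_zero fscale_def add_eq_0_iff2)
  qed
  then show ?case by (simp only: inv_holo_scale[OF AF])
next
  case (eng_add A B)
  have "A \<in> carrier R" "B \<in> carrier R" using eng_add D_carrier carrier_D by blast+
  then show ?case
    using eng_add.IH[OF eng_add.prems] eng_add.prems
    by (simp only: apply_add_inv_holo inv_holo_add)
next
  case (eng_mult A B)
  have "A \<in> carrier R" "B \<in> carrier R" using eng_mult D_carrier carrier_D by blast+
  then show ?case
    using eng_mult.IH eng_mult.prems by (simp add: apply_mult inv_holo_premero)
qed

section \<open>Poles of the coefficients\<close>

text \<open>
  All poles lie on hyperplanes where \<open>z\<close> is constant.  Multiplying by a power of \<open>z y - z x\<close> instead of
  dividing keeps the condition free of case distinctions at points without a pole.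
\<close>

definition poles :: "('n tableau \<Rightarrow> complex) \<Rightarrow> bool" where
  "poles f \<longleftrightarrow> (\<forall>x\<in>W. \<exists>N U p. x \<in> U \<and> U \<subseteq> W \<and> holo_on p U \<and>
    eventually (\<lambda>y. f y * (z y - z x) ^ N = p y) (generic U))"

lemma polesE:
  assumes "poles f" "x \<in> W"
  obtains N U p where "open U" "x \<in> U" "U \<subseteq> W" "holo_on p U"
    "eventually (\<lambda>y. f y * (z y - z x) ^ N = p y) (generic U)"
  using assms holo_on_imp_open unfolding poles_def by meson

lemma polesI:
  assumes "\<And>x. x \<in> W \<Longrightarrow> \<exists>N U p. x \<in> U \<and> U \<subseteq> W \<and> holo_on p U \<and>
    eventually (\<lambda>y. f y * (z y - z x) ^ N = p y) (generic U)"
  shows "poles f"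
  using assms unfolding poles_def by blast

lemma poles_cong:
  assumes "poles f" "eventually (\<lambda>x. f x = g x) (generic W)"
  shows "poles g"
proof (rule polesI)
  fix x assume "x \<in> W"
  with assms(1) obtain N U p where U: "open U" "x \<in> U" "U \<subseteq> W" "holo_on p U"
    "eventually (\<lambda>y. f y * (z y - z x) ^ N = p y) (generic U)" by (rule polesE)
  have "eventually (\<lambda>y. g y * (z y - z x) ^ N = p y) (generic U)"
    using U(5) eventually_generic_subset[OF open_W U(1,3) assms(2)] by eventually_elim simp
  then show "\<exists>N U p. x \<in> U \<and> U \<subseteq> W \<and> holo_on p U \<and>
    eventually (\<lambda>y. g y * (z y - z x) ^ N = p y) (generic U)"
    using U by (intro exI[of _ N] exI[of _ U] exI[of _ p]) simp
qed

lemma poles_holo: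
  assumes "holo_on f W" shows "poles f"
  using assms by (intro polesI exI[of _ 0] exI[of _ W] exI[of _ f]) simp

lemma holo_z_diff: "open U \<Longrightarrow> holo_on (\<lambda>y. (z y - c) ^ N) U"
  by (intro holo_on_power holo_on_diff holo_z holo_on_const)

lemma
  assumes "poles f" "poles g"
  shows poles_add: "poles (\<lambda>x. f x + g x)"
    and poles_mult: "poles (\<lambda>x. f x * g x)"
proof -
  have "(\<exists>N U p. x \<in> U \<and> U \<subseteq> W \<and> holo_on p U \<and>
      eventually (\<lambda>y. (f y + g y) * (z y - z x) ^ N = p y) (generic U)) \<and>
    (\<exists>N U p. x \<in> U \<and> U \<subseteq> W \<and> holo_on p U \<and>
      eventually (\<lambda>y. (f y * g y) * (z y - z x) ^ N = p y) (generic U))" if xW: "x \<in> W" for x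
  proof -
    obtain N U p where U: "open U" "x \<in> U" "U \<subseteq> W" "holo_on p U"
      "eventually (\<lambda>y. f y * (z y - z x) ^ N = p y) (generic U)"
      by (rule polesE[OF assms(1) xW])
    obtain M V q where V: "open V" "x \<in> V" "V \<subseteq> W" "holo_on q V"
      "eventually (\<lambda>y. g y * (z y - z x) ^ M = q y) (generic V)"
      by (rule polesE[OF assms(2) xW])
    let ?X = "U \<inter> V"
    have o: "open ?X" using U V by auto
    have h: "holo_on p ?X" "holo_on q ?X"
      using U V o by (auto elim: holo_on_subset)
    have e: "eventually (\<lambda>y. f y * (z y - z x) ^ N = p y) (generic ?X)"
      "eventually (\<lambda>y. g y * (z y - z x) ^ M = q y) (generic ?X)"
      using U V o by (auto elim: eventually_generic_subset[rotated 3])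
    have "eventually (\<lambda>y. (f y + g y) * (z y - z x) ^ (N + M) =
        p y * (z y - z x) ^ M + q y * (z y - z x) ^ N) (generic ?X)"
      using e
    proof eventually_elim
      case (elim y)
      show ?case unfolding elim[symmetric] by (simp add: power_add algebra_simps)
    qed
    moreover have "holo_on (\<lambda>y. p y * (z y - z x) ^ M + q y * (z y - z x) ^ N) ?X"
      by (intro holo_on_add holo_on_mult h holo_z_diff o)
    moreover have "eventually (\<lambda>y. (f y * g y) * (z y - z x) ^ (N + M) = p y * q y) (generic ?X)"
      using e
    proof eventually_elim
      case (elim y)
      show ?case unfolding elim[symmetric] by (simp add: power_add algebra_simps)
    qed
    moreover have "holo_on (\<lambda>y. p y * q y) ?X" by (intro holo_on_mult h)
    moreover have "x \<in> ?X" "?X \<subseteq> W" using U V by auto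
    ultimately show ?thesis by (intro conjI exI[of _ "N + M"] exI[of _ ?X]; blast)
  qed
  then show "poles (\<lambda>x. f x + g x)" "poles (\<lambda>x. f x * g x)"
    unfolding poles_def by blast+
qed

lemma poles_sum:
  assumes "\<And>a. a \<in> X \<Longrightarrow> poles (f a)"
  shows "poles (\<lambda>x. \<Sum>a\<in>X. f a x)"
  using assms
proof (induction X rule: infinite_finite_induct)
  case (insert a X)
  then show ?case using poles_add[of "f a" "\<lambda>x. \<Sum>a\<in>X. f a x"] by simp
qed (simp_all add: poles_holo holo_on_const open_W)

lemma poles_shift:
  assumes "poles f" "\<sigma> \<in> shifts"
  shows "poles (\<lambda>x. f (shift \<sigma> x))"
proof (rule polesI)
  fix x assume "x \<in> W"
  then have "shift \<sigma> x \<in> W" using assms(2) shift_in_W by simp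
  with assms(1) obtain N U p where U: "open U" "shift \<sigma> x \<in> U" "U \<subseteq> W" "holo_on p U"
    "eventually (\<lambda>y. f y * (z y - z (shift \<sigma> x)) ^ N = p y) (generic U)" by (rule polesE)
  note bs = biholo_shift[of \<sigma>]
  have "eventually (\<lambda>y. f (shift \<sigma> y) * (z y - z x) ^ N = p (shift \<sigma> y)) (generic (shift \<sigma> -` U))"
    using biholo.eventually_generic_T[OF bs U(1,5)] by eventually_elim (simp add: z_shift)
  moreover have "shift \<sigma> -` U \<subseteq> W" using U(3) shift_vimage[OF assms(2)] by blast
  ultimately show "\<exists>N U p. x \<in> U \<and> U \<subseteq> W \<and> holo_on p U \<and>
    eventually (\<lambda>y. f (shift \<sigma> y) * (z y - z x) ^ N = p y) (generic U)"
    using biholo.holo_on_T[OF bs U(4)] U(2)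
    by (intro exI[of _ N] exI[of _ "shift \<sigma> -` U"] exI[of _ "\<lambda>y. p (shift \<sigma> y)"]) simp
qed

lemma poles_divide_z:
  assumes "holo_on H W"
  shows "poles (\<lambda>x. H x / z x)"
proof (rule polesI)
  fix x assume x: "x \<in> W"
  show "\<exists>N U p. x \<in> U \<and> U \<subseteq> W \<and> holo_on p U \<and>
    eventually (\<lambda>y. H y / z y * (z y - z x) ^ N = p y) (generic U)"
  proof (cases "z x = 0")
    case True
    have "eventually (\<lambda>y. H y / z y * (z y - z x) ^ 1 = H y) (generic W)"
      using z_nonzero_generic[OF open_W, of 0] by eventually_elim (simp add: True)
    then show ?thesis using x assms by (intro exI[of _ 1] exI[of _ W] exI[of _ H]) simp
  next
    case False
    let ?U = "{y\<in>W. z y \<noteq> 0}"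
    have U: "open ?U" by (intro open_holo_nonzero holo_z open_W)
    have "holo_on (\<lambda>y. H y / z y) ?U"
      using holo_on_subset[OF assms U] by (intro holo_on_divide holo_z U) auto
    then show ?thesis using x False
      by (intro exI[of _ 0] exI[of _ ?U] exI[of _ "\<lambda>y. H y / z y"]) auto
  qed
qed

text \<open>
  Generators have poles only at \<open>z = 0\<close>, but products contain shifted coefficients, which move the poles
  to other values of \<open>z\<close>; hence the class of functions with poles along any of these hyperplanes.
\<close>

lemma D_poles:
  assumes "A \<in> carrier \<D>"
  shows "poles (A \<sigma>)"
  using assms unfolding carrier_D
proof (induction A arbitrary: \<sigma>)
  case one
  have "eventually (\<lambda>x. (if \<sigma> = 0 then 1 else 0) = \<one>\<^bsub>R\<^esub> \<sigma> x) (generic W)"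
    using one_generic[of \<sigma>] by eventually_elim simp
  then show ?case
    by (rule poles_cong[rotated]) (intro poles_holo holo_on_const open_W)
next
  case (incl A)
  then obtain H where H: "holo_on H W" "A \<sigma> = mero_nf W (\<lambda>x. H x / z x)"
    by (auto simp: gens_def)
  have "eventually (\<lambda>x. H x / z x = A \<sigma> x) (generic W)"
    using coeff_generic[of A \<sigma>, OF H(2) premero_divide_z[OF H(1)]] by eventually_elim simp
  then show ?case by (rule poles_cong[OF poles_divide_z[OF H(1)]])
next
  case (a_inv A)
  have A: "A \<in> carrier R" using a_inv D_carrier carrier_D by blast
  have "eventually (\<lambda>x. - 1 * A \<sigma> x = (\<ominus>\<^bsub>R\<^esub> A) \<sigma> x) (generic W)"
    using add_generic[OF a_inv_closed[OF A] A, of \<sigma>]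
    by eventually_elim (simp add: a_inv_add[OF A] zero_coeff add_eq_0_iff2)
  then show ?case
    by (rule poles_cong[rotated]) (intro poles_mult poles_holo holo_on_const open_W a_inv.IH)
next
  case (eng_add A B)
  have AB: "A \<in> carrier R" "B \<in> carrier R" using eng_add D_carrier carrier_D by blast+
  have "eventually (\<lambda>x. A \<sigma> x + B \<sigma> x = (A \<oplus>\<^bsub>R\<^esub> B) \<sigma> x) (generic W)"
    using add_generic[OF AB, of \<sigma>] by eventually_elim (rule sym)
  then show ?case
    by (rule poles_cong[OF poles_add[OF eng_add.IH]])
next
  case (eng_mult A B)
  have AB: "A \<in> carrier R" "B \<in> carrier R" using eng_mult D_carrier carrier_D by blast+
  note X = carrier_finite[OF AB(1)] order_refl carrier_shifts[OF AB(1)]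
  have "eventually (\<lambda>x. mult_sum (supp A) A B \<sigma> x = (A \<otimes>\<^bsub>R\<^esub> B) \<sigma> x) (generic W)"
    using mult_generic[OF AB X, of \<sigma>] by eventually_elim (rule sym)
  note ev = this
  have "poles (mult_sum (supp A) A B \<sigma>)"
  proof -
    have "- \<rho> \<in> shifts" if "\<rho> \<in> supp A" for \<rho> using that X(3) by auto
    then show ?thesis unfolding mult_sum_def
      by (intro poles_sum poles_mult poles_shift eng_mult.IH)
  qed
  then show ?case using ev by (rule poles_cong)
qed

lemma d_sum:
  assumes "\<And>a. a \<in> X \<Longrightarrow> holo_on (f a) U" "x \<in> U" "open U"
  shows "d (\<lambda>x. \<Sum>a\<in>X. f a x) x = (\<Sum>a\<in>X. d (f a) x)"
  using assms(1)
proof (induction X rule: infinite_finite_induct)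
  case (insert a X)
  then show ?case
    using d_add[of "f a" U "\<lambda>x. \<Sum>a\<in>X. f a x" x] holo_on_sum[of U X f] assms(2,3) by simp
qed simp_all

lemma d_z_power: "d (\<lambda>y. z y ^ n) x = of_nat n * z x ^ (n - 1)"
  by (rule d_eqI) (auto simp: z_line intro!: derivative_eq_intros)

text \<open>
  The function \<open>z ^ n * A F\<close> is the sum \<open>\<Psi>\<close> of the functions \<open>p \<sigma> y * F (y - \<sigma>)\<close>; the two identities are
  its value and its derivative in the direction \<open>e\<close> at a point where \<open>z = 0\<close>.  The derivative of
  \<open>z ^ n * A F\<close> there is \<open>A F\<close> for \<open>n = 1\<close> and \<open>0\<close> for larger \<open>n\<close>.
\<close>

lemma jet_identity:
  assumes A: "A \<in> carrier R" and F: "F \<in> \<H>" and AF: "apply_fsum W A F \<in> \<H>"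
    and X: "finite X" "supp A \<subseteq> X" "X \<subseteq> shifts"
    and U: "open U" "U \<subseteq> W" "u \<in> U" and u: "z u = 0" and n: "n > 0"
    and p: "\<And>\<sigma>. \<sigma> \<in> X \<Longrightarrow> holo_on (p \<sigma>) U"
    and pA: "\<And>\<sigma>. \<sigma> \<in> X \<Longrightarrow> eventually (\<lambda>y. z y ^ n * A \<sigma> y = p \<sigma> y) (generic U)"
  shows "(\<Sum>\<sigma>\<in>X. p \<sigma> u * F (shift (- \<sigma>) u)) = 0"
    and "(\<Sum>\<sigma>\<in>X. d (p \<sigma>) u * F (shift (- \<sigma>) u) + p \<sigma> u * d F (shift (- \<sigma>) u)) =
      (if n = 1 then apply_fsum W A F u else 0)"
proof -
  let ?G = "apply_fsum W A F"
  define \<Psi> where "\<Psi> y = (\<Sum>\<sigma>\<in>X. p \<sigma> y * F (shift (- \<sigma>) y))" for y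
  have Fs: "holo_on (\<lambda>y. F (shift (- \<sigma>) y)) U" if "\<sigma> \<in> X" for \<sigma>
    using holo_on_subset[OF holo_shift[OF inv_holoD(1)[OF F]] U(1,2)] that X(3) by auto
  have t: "holo_on (\<lambda>y. p \<sigma> y * F (shift (- \<sigma>) y)) U" if "\<sigma> \<in> X" for \<sigma>
    using that by (intro holo_on_mult p Fs)
  have \<Psi>: "holo_on \<Psi> U"
    unfolding \<Psi>_def by (intro holo_on_sum U(1) t)
  have G: "holo_on ?G U"
    using holo_on_subset[OF inv_holoD(1)[OF AF] U(1,2)] .
  have zn: "holo_on (\<lambda>y. z y ^ n) U"
    by (intro holo_on_power holo_z U)
  have "eventually (\<lambda>y. ?G y = (\<Sum>\<sigma>\<in>X. A \<sigma> y * F (shift (- \<sigma>) y))) (generic U)"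
    by (rule eventually_generic_subset[OF open_W U(1,2) apply_generic[OF A X inv_holo_premero[OF F]]])
  moreover have "eventually (\<lambda>y. \<forall>\<sigma>\<in>X. z y ^ n * A \<sigma> y = p \<sigma> y) (generic U)"
    by (intro eventually_ball_finite X ballI pA)
  ultimately have "eventually (\<lambda>y. z y ^ n * ?G y = \<Psi> y) (generic U)"
  proof eventually_elim
    case (elim y)
    show ?case unfolding elim(1) \<Psi>_def sum_distrib_left
      using elim(2) by (intro sum.cong refl) (simp add: mult.assoc[symmetric])
  qed
  then have eq: "z y ^ n * ?G y = \<Psi> y" if "y \<in> U" for y
    using generic_eq_imp_eq[OF U(1), of "\<lambda>y. z y ^ n * ?G y" \<Psi> y] that
      holo_on_imp_continuous_on[OF holo_on_mult[OF zn G]] holo_on_imp_continuous_on[OF \<Psi>] by blast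
  show "(\<Sum>\<sigma>\<in>X. p \<sigma> u * F (shift (- \<sigma>) u)) = 0"
    using eq[OF U(3)] n by (simp add: u \<Psi>_def power_0_left)
  have "d \<Psi> u = (\<Sum>\<sigma>\<in>X. d (\<lambda>y. p \<sigma> y * F (shift (- \<sigma>) y)) u)"
    unfolding \<Psi>_def by (rule d_sum[OF t U(3,1)])
  also have "\<dots> = (\<Sum>\<sigma>\<in>X. d (p \<sigma>) u * F (shift (- \<sigma>) u) + p \<sigma> u * d F (shift (- \<sigma>) u))"
  proof (intro sum.cong refl)
    fix \<sigma> assume "\<sigma> \<in> X"
    then show "d (\<lambda>y. p \<sigma> y * F (shift (- \<sigma>) y)) u =
        d (p \<sigma>) u * F (shift (- \<sigma>) u) + p \<sigma> u * d F (shift (- \<sigma>) u)"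
      using d_mult[OF p Fs U(3), of \<sigma> \<sigma>] d_shift[of F "- \<sigma>" u] by simp
  qed
  also have "d \<Psi> u = d (\<lambda>y. z y ^ n * ?G y) u"
    by (rule d_cong[OF U(1,3)]) (simp add: eq)
  also have "\<dots> = of_nat n * z u ^ (n - 1) * ?G u + z u ^ n * d ?G u"
    using d_mult[OF zn G U(3)] by (simp add: d_z_power)
  also have "\<dots> = (if n = 1 then ?G u else 0)"
    using n by (auto simp: u power_0_left)
  finally show "(\<Sum>\<sigma>\<in>X. d (p \<sigma>) u * F (shift (- \<sigma>) u) + p \<sigma> u * d F (shift (- \<sigma>) u)) =
      (if n = 1 then ?G u else 0)" by simp
qed

section \<open>Jets of invariant functions along the orbit\<close>

lemma shift_tau_fix: "z u = 0 \<Longrightarrow> shift (\<tau> \<sigma>) u = \<tau> (shift \<sigma> u)"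
  using tau_shift[of \<sigma> u] tau_fix[of u] by simp

lemma holo_coord: "holo_on (\<lambda>x :: 'n tableau. x $ p) UNIV"
  by (rule holo_on_proj) simp

text \<open>
  The invariants of \<open>\<tau>\<close> are generated by the entries outside the two positions, the sum of the two entries,
  and the square of their difference.  Together they separate the orbits of \<open>\<tau>\<close>.
\<close>

lemma separating_invariant:
  assumes u: "z u = 0" and \<rho>: "\<rho> \<noteq> \<sigma>" "\<rho> \<noteq> \<tau> \<sigma>"
  obtains q where "holo_on q UNIV" "\<And>x. q (\<tau> x) = q x" "q (shift (- \<rho>) u) = 0" "q (shift (- \<sigma>) u) \<noteq> 0"
proof -
  consider p where "p \<noteq> P" "p \<noteq> Q" "\<rho> $ p \<noteq> \<sigma> $ p"
    | "\<rho> $ P + \<rho> $ Q \<noteq> \<sigma> $ P + \<sigma> $ Q"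
    | "\<And>p. p \<noteq> P \<Longrightarrow> p \<noteq> Q \<Longrightarrow> \<rho> $ p = \<sigma> $ p" "\<rho> $ P + \<rho> $ Q = \<sigma> $ P + \<sigma> $ Q" by blast
  then show thesis
  proof cases
    case 1
    let ?q = "\<lambda>x :: 'n tableau. x $ p - shift (- \<rho>) u $ p"
    have "holo_on ?q UNIV"
      by (intro holo_on_diff holo_coord holo_on_const) simp
    with 1 show thesis
      by (intro that[of ?q]) (auto simp: tau_nth shift_def)
  next
    case 2
    let ?q = "\<lambda>x :: 'n tableau. x $ P + x $ Q - (shift (- \<rho>) u $ P + shift (- \<rho>) u $ Q)"
    have "holo_on ?q UNIV"
      by (intro holo_on_diff holo_on_add holo_coord holo_on_const) simp
    moreover have "?q (shift (- \<sigma>) u) = of_int (\<rho> $ P + \<rho> $ Q - (\<sigma> $ P + \<sigma> $ Q))"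
      by (simp add: shift_def)
    then have "?q (shift (- \<sigma>) u) \<noteq> 0"
      using 2 by (simp only: of_int_eq_0_iff)
    ultimately show thesis
      by (intro that[of ?q]) auto
  next
    case 3
    let ?q = "\<lambda>x. z x ^ 2 - z (shift (- \<rho>) u) ^ 2"
    have sq: "(\<sigma> $ P - \<sigma> $ Q)\<^sup>2 - (\<rho> $ P - \<rho> $ Q)\<^sup>2 \<noteq> 0"
    proof
      assume "(\<sigma> $ P - \<sigma> $ Q)\<^sup>2 - (\<rho> $ P - \<rho> $ Q)\<^sup>2 = 0"
      then consider "\<sigma> $ P - \<sigma> $ Q = \<rho> $ P - \<rho> $ Q" | "\<sigma> $ P - \<sigma> $ Q = - (\<rho> $ P - \<rho> $ Q)"
        using power2_eq_iff[of "\<sigma> $ P - \<sigma> $ Q" "\<rho> $ P - \<rho> $ Q"] by auto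
      then show False
      proof cases
        case a: 1
        then have "\<rho> $ P = \<sigma> $ P" "\<rho> $ Q = \<sigma> $ Q" using 3(2) by linarith+
        then have "\<rho> $ p = \<sigma> $ p" for p using 3(1) by metis
        then have "\<rho> = \<sigma>" by (simp add: vec_eq_iff)
        with \<rho> show False by simp
      next
        case b: 2
        then have "\<rho> $ P = \<sigma> $ Q" "\<rho> $ Q = \<sigma> $ P" using 3(2) by linarith+
        then have "\<rho> $ p = \<tau> \<sigma> $ p" for p using 3(1)
          by (auto simp: tau_nth Transposition.transpose_def)
        then have "\<rho> = \<tau> \<sigma>" by (simp add: vec_eq_iff)
        with \<rho> show False by simp
      qed
    qed
    have "?q (shift (- \<sigma>) u) = of_int ((\<sigma> $ P - \<sigma> $ Q)\<^sup>2 - (\<rho> $ P - \<rho> $ Q)\<^sup>2)"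
      by (simp add: z_shift u power2_commute)
    then have "?q (shift (- \<sigma>) u) \<noteq> 0"
      using sq by (simp only: of_int_eq_0_iff not_False_eq_True)
    moreover have "holo_on ?q UNIV"
      by (intro holo_on_diff holo_on_power holo_z holo_on_const) simp_all
    ultimately show thesis
      by (intro that[of ?q]) auto
  qed
qed

text \<open>
  At a point \<open>u - \<sigma>\<close> fixed by \<open>\<tau>\<close> the derivative of an invariant function vanishes, so there only \<open>b = 0\<close> is
  possible.  Squares of separating invariants kill the jets at the other points; a factor that is a
  polynomial in \<open>z\<^sup>2\<close> then adjusts the jet at \<open>u - \<sigma>\<close>.
\<close>

lemma jet_interpolation:
  assumes u: "u \<in> W" "z u = 0" and X: "finite X" "X \<subseteq> shifts" and \<sigma>: "\<sigma> \<in> shifts"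
    and b: "\<tau> \<sigma> = \<sigma> \<Longrightarrow> b = 0"
  obtains F where "F \<in> \<H>" "F (shift (- \<sigma>) u) = a" "d F (shift (- \<sigma>) u) = b"
    "\<And>\<rho>. \<rho> \<in> X \<Longrightarrow> \<rho> \<noteq> \<sigma> \<Longrightarrow> \<rho> \<noteq> \<tau> \<sigma> \<Longrightarrow> F (shift (- \<rho>) u) = 0"
    "\<And>\<rho>. \<rho> \<in> X \<Longrightarrow> \<rho> \<noteq> \<sigma> \<Longrightarrow> \<rho> \<noteq> \<tau> \<sigma> \<Longrightarrow> d F (shift (- \<rho>) u) = 0"
proof -
  let ?y = "\<lambda>\<rho>. shift (- \<rho>) u"
  define X' where "X' = X - {\<sigma>, \<tau> \<sigma>}"
  have "\<forall>\<rho>\<in>X'. \<exists>q. holo_on q UNIV \<and> (\<forall>x. q (\<tau> x) = q x) \<and> q (?y \<rho>) = 0 \<and> q (?y \<sigma>) \<noteq> 0"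
  proof
    fix \<rho> assume "\<rho> \<in> X'"
    then have \<rho>: "\<rho> \<noteq> \<sigma>" "\<rho> \<noteq> \<tau> \<sigma>" by (auto simp: X'_def)
    obtain q where "holo_on q UNIV" "\<And>x. q (\<tau> x) = q x" "q (?y \<rho>) = 0" "q (?y \<sigma>) \<noteq> 0"
      using separating_invariant[OF u(2) \<rho>] by metis
    then show "\<exists>q. holo_on q UNIV \<and> (\<forall>x. q (\<tau> x) = q x) \<and> q (?y \<rho>) = 0 \<and> q (?y \<sigma>) \<noteq> 0"
      by blast
  qed
  then obtain q where "\<forall>\<rho>\<in>X'. holo_on (q \<rho>) UNIV \<and> (\<forall>x. q \<rho> (\<tau> x) = q \<rho> x) \<and>
      q \<rho> (?y \<rho>) = 0 \<and> q \<rho> (?y \<sigma>) \<noteq> 0"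
    unfolding bchoice_iff by blast
  then have q: "\<And>\<rho>. \<rho> \<in> X' \<Longrightarrow> holo_on (q \<rho>) UNIV" "\<And>\<rho> x. \<rho> \<in> X' \<Longrightarrow> q \<rho> (\<tau> x) = q \<rho> x"
    "\<And>\<rho>. \<rho> \<in> X' \<Longrightarrow> q \<rho> (?y \<rho>) = 0" "\<And>\<rho>. \<rho> \<in> X' \<Longrightarrow> q \<rho> (?y \<sigma>) \<noteq> 0"
    by blast+
  have X': "finite X'" using X by (simp add: X'_def)
  define f0 where "f0 x = (\<Prod>\<rho>\<in>X'. q \<rho> x ^ 2)" for x
  have f0: "holo_on f0 UNIV" unfolding f0_def by (intro holo_on_prod holo_on_power q(1)) auto
  have f0_tau: "f0 (\<tau> x) = f0 x" for x unfolding f0_def by (intro prod.cong refl) (simp add: q(2))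
  have f0_y: "f0 (?y \<sigma>) \<noteq> 0" unfolding f0_def using X' q(4) by simp
  define A where "A = a / f0 (?y \<sigma>)"
  \<comment> \<open>\<open>A\<close> and \<open>C\<close> solve the two linear equations for the value and the derivative of \<open>f0 * g\<close> at \<open>?y \<sigma>\<close>.\<close>
  define C where "C = (if z (?y \<sigma>) = 0 then 0 else (b - d f0 (?y \<sigma>) * A) / (f0 (?y \<sigma>) * (2 * z (?y \<sigma>))))"
  define g where "g x = A + C * (z x ^ 2 - z (?y \<sigma>) ^ 2)" for x
  have g: "holo_on g UNIV" unfolding g_def
    by (intro holo_on_add holo_on_cmult holo_on_diff holo_on_power holo_z holo_on_const) auto
  have dg: "d g x = C * (2 * z x)" for x
    unfolding g_def by (rule d_eqI) (auto simp: z_line intro!: derivative_eq_intros)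
  define f where "f x = f0 x * g x" for x
  have f: "holo_on f UNIV" unfolding f_def by (intro holo_on_mult f0 g)
  define F where "F x = (if x \<in> W then f x else 0)" for x
  have F: "F \<in> \<H>"
    unfolding F_def
    by (rule inv_holo_restrict[OF holo_on_subset[OF f open_W subset_UNIV]]) (simp add: f_def g_def f0_tau)
  have yW: "?y \<rho> \<in> W" if "\<rho> \<in> shifts" for \<rho>
    using u(1) that shift_in_W by simp
  have Fy: "F x = f x" "d F x = d f0 x * g x + f0 x * d g x" if "x \<in> W" for x
  proof -
    show "F x = f x" using that by (simp add: F_def)
    have "d F x = d f x" using that by (intro d_cong[OF open_W]) (auto simp: F_def)
    also have "\<dots> = d f0 x * g x + f0 x * d g x"
      unfolding f_def by (rule d_mult[OF f0 g]) simp
    finally show "d F x = d f0 x * g x + f0 x * d g x" .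
  qed
  have "F (?y \<sigma>) = a"
    using f0_y by (simp add: Fy yW \<sigma> f_def g_def A_def)
  moreover have "d F (?y \<sigma>) = b"
  proof (cases "z (?y \<sigma>) = 0")
    case True
    then have "\<tau> (?y \<sigma>) = ?y \<sigma>" by (rule tau_fix)
    then have "d f0 (?y \<sigma>) = - d f0 (?y \<sigma>)"
      using d_tau[OF f0, of "?y \<sigma>"] f0_tau by simp
    moreover have "\<tau> \<sigma> = \<sigma>"
      using True u(2) of_int_eq_iff[of "\<sigma> $ Q" "\<sigma> $ P", where 'a = complex] by (simp add: z_shift tau_eq_iff)
    ultimately show ?thesis using b True by (simp add: Fy yW \<sigma> dg)
  next
    case False
    then show ?thesis using f0_y
      by (simp add: Fy(2)[OF yW[OF \<sigma>]] dg) (simp add: g_def C_def field_simps)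
  qed
  moreover have "F (?y \<rho>) = 0 \<and> d F (?y \<rho>) = 0" if "\<rho> \<in> X" "\<rho> \<noteq> \<sigma>" "\<rho> \<noteq> \<tau> \<sigma>" for \<rho>
  proof -
    have \<rho>: "\<rho> \<in> X'" "\<rho> \<in> shifts" using that X by (auto simp: X'_def)
    let ?r = "\<lambda>x. q \<rho> x * (\<Prod>\<rho>'\<in>X' - {\<rho>}. q \<rho>' x ^ 2)"
    have r: "holo_on ?r UNIV" by (intro holo_on_mult holo_on_prod holo_on_power q(1) \<rho>) auto
    have "f0 = (\<lambda>x. q \<rho> x * ?r x)"
      unfolding f0_def fun_eq_iff by (simp add: prod.remove[OF X' \<rho>(1)] power2_eq_square mult.assoc)
    then have "f0 (?y \<rho>) = 0" "d f0 (?y \<rho>) = 0"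
      using d_mult[OF q(1)[OF \<rho>(1)] r, of "?y \<rho>"] q(3)[OF \<rho>(1)] by simp_all
    then show ?thesis using yW[OF \<rho>(2)] by (simp add: Fy f_def)
  qed
  ultimately show thesis using that[OF F] by blast
qed

lemma inv_holo_orbit:
  assumes "F \<in> \<H>" "u \<in> W" "z u = 0" "\<sigma> \<in> shifts"
  shows "F (shift (- \<tau> \<sigma>) u) = F (shift (- \<sigma>) u)" "d F (shift (- \<tau> \<sigma>) u) = - d F (shift (- \<sigma>) u)"
proof -
  have "shift (- \<tau> \<sigma>) u = \<tau> (shift (- \<sigma>) u)"
    using shift_tau_fix[OF assms(3), of "- \<sigma>"] by (simp add: tau_minus)
  moreover have "shift (- \<sigma>) u \<in> W" using assms shift_in_W by simp
  ultimately show "F (shift (- \<tau> \<sigma>) u) = F (shift (- \<sigma>) u)" "d F (shift (- \<tau> \<sigma>) u) = - d F (shift (- \<sigma>) u)"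
    using assms(1) d_inv_holo_tau inv_holoD(3) by auto
qed

section \<open>The coefficients have simple poles\<close>

text \<open>
  With the first jet identity an invariant function of value \<open>1\<close> at \<open>u - \<sigma>\<close> gives \<open>p \<sigma> u + p (\<tau> \<sigma>) u = 0\<close>,
  because its value at \<open>u - \<tau> \<sigma>\<close> is the same.  With the second identity a function of value \<open>0\<close> and
  derivative \<open>1\<close> gives \<open>p \<sigma> u - p (\<tau> \<sigma>) u = 0\<close>, because its derivative at \<open>u - \<tau> \<sigma>\<close> has the
  opposite sign.  If \<open>\<tau> \<sigma> = \<sigma>\<close>, the first identity has only one term and suffices.
\<close>

lemma numerators_vanish:
  assumes A: "A \<in> carrier R" and AF: "\<And>F. F \<in> \<H> \<Longrightarrow> apply_fsum W A F \<in> \<H>"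
    and X: "finite X" "supp A \<subseteq> X" "X \<subseteq> shifts" "\<tau> ` X \<subseteq> X"
    and U: "open U" "U \<subseteq> W" "u \<in> U" and u: "z u = 0" and n: "n > 1"
    and p: "\<And>\<sigma>. \<sigma> \<in> X \<Longrightarrow> holo_on (p \<sigma>) U"
    and pA: "\<And>\<sigma>. \<sigma> \<in> X \<Longrightarrow> eventually (\<lambda>y. z y ^ n * A \<sigma> y = p \<sigma> y) (generic U)"
    and \<sigma>: "\<sigma> \<in> X"
  shows "p \<sigma> u = 0"
proof -
  have uW: "u \<in> W" using U by auto
  have \<sigma>s: "\<sigma> \<in> shifts" and \<tau>X: "\<tau> \<sigma> \<in> X" using X \<sigma> by auto
  note J = jet_identity[OF A _ AF X(1-3) U u _ p pA]
  have J0: "(\<Sum>\<rho>\<in>X. p \<rho> u * F (shift (- \<rho>) u)) = 0" if "F \<in> \<H>" for F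
    using J(1)[OF that that] n by simp
  have J1: "(\<Sum>\<rho>\<in>X. d (p \<rho>) u * F (shift (- \<rho>) u) + p \<rho> u * d F (shift (- \<rho>) u)) = 0" if "F \<in> \<H>" for F
    using J(2)[OF that that] n by simp
  have two: "(\<Sum>\<rho>\<in>X. h \<rho>) = (\<Sum>\<rho>\<in>{\<sigma>, \<tau> \<sigma>}. h \<rho>)"
    if "\<And>\<rho>. \<rho> \<in> X \<Longrightarrow> \<rho> \<noteq> \<sigma> \<Longrightarrow> \<rho> \<noteq> \<tau> \<sigma> \<Longrightarrow> h \<rho> = 0" for h :: "'n shift \<Rightarrow> complex"
    using X(1) \<sigma> \<tau>X that by (intro sum.mono_neutral_right) auto
  obtain F where F: "F \<in> \<H>" "F (shift (- \<sigma>) u) = 1"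
    "\<And>\<rho>. \<rho> \<in> X \<Longrightarrow> \<rho> \<noteq> \<sigma> \<Longrightarrow> \<rho> \<noteq> \<tau> \<sigma> \<Longrightarrow> F (shift (- \<rho>) u) = 0"
    using jet_interpolation[OF uW u X(1,3) \<sigma>s, of 0 1] by metis
  have s: "(\<Sum>\<rho>\<in>{\<sigma>, \<tau> \<sigma>}. p \<rho> u * F (shift (- \<rho>) u)) = 0"
    using J0[OF F(1)] by (subst (asm) two) (simp_all add: F(3))
  show ?thesis
  proof (cases "\<tau> \<sigma> = \<sigma>")
    case True
    then show ?thesis using s F(2) by simp
  next
    case False
    obtain F' where F': "F' \<in> \<H>" "F' (shift (- \<sigma>) u) = 0" "d F' (shift (- \<sigma>) u) = 1"
      "\<And>\<rho>. \<rho> \<in> X \<Longrightarrow> \<rho> \<noteq> \<sigma> \<Longrightarrow> \<rho> \<noteq> \<tau> \<sigma> \<Longrightarrow> F' (shift (- \<rho>) u) = 0"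
      "\<And>\<rho>. \<rho> \<in> X \<Longrightarrow> \<rho> \<noteq> \<sigma> \<Longrightarrow> \<rho> \<noteq> \<tau> \<sigma> \<Longrightarrow> d F' (shift (- \<rho>) u) = 0"
      using jet_interpolation[OF uW u X(1,3) \<sigma>s, of 1 0] False by metis
    have "(\<Sum>\<rho>\<in>{\<sigma>, \<tau> \<sigma>}. d (p \<rho>) u * F' (shift (- \<rho>) u) + p \<rho> u * d F' (shift (- \<rho>) u)) = 0"
      using J1[OF F'(1)] by (subst (asm) two) (simp_all add: F'(4,5))
    then have "p \<sigma> u - p (\<tau> \<sigma>) u = 0"
      using False inv_holo_orbit[OF F'(1) uW u \<sigma>s] F'(2,3) by simp
    moreover have "p \<sigma> u + p (\<tau> \<sigma>) u = 0"
      using s False inv_holo_orbit[OF F(1) uW u \<sigma>s] F(2) by simp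
    ultimately show ?thesis by simp
  qed
qed

text \<open>
  The index set \<open>X\<close> is finite, so the coefficients have a common pole order near \<open>v\<close>.  As long as it is at
  least \<open>2\<close>, all numerators vanish at \<open>z = 0\<close> and one factor \<open>z\<close> can be divided out.
\<close>

lemma simple_poles:
  assumes A: "A \<in> carrier R" and AF: "\<And>F. F \<in> \<H> \<Longrightarrow> apply_fsum W A F \<in> \<H>"
    and poles: "\<And>\<sigma>. poles (A \<sigma>)"
    and X: "finite X" "supp A \<subseteq> X" "X \<subseteq> shifts" "\<tau> ` X \<subseteq> X"
  shows "\<exists>U p. open U \<and> U \<subseteq> W \<and> v \<in> U \<and>
    (\<forall>\<sigma>\<in>X. holo_on (p \<sigma>) U \<and> eventually (\<lambda>y. z y * A \<sigma> y = p \<sigma> y) (generic U))"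
proof -
  have "\<exists>N U p. open U \<and> v \<in> U \<and> U \<subseteq> W \<and> holo_on p U \<and>
      eventually (\<lambda>y. A \<sigma> y * z y ^ N = p y) (generic U)" for \<sigma>
  proof -
    obtain N U p where "open U" "v \<in> U" "U \<subseteq> W" "holo_on p U"
      "eventually (\<lambda>y. A \<sigma> y * (z y - z v) ^ N = p y) (generic U)"
      by (rule polesE[OF poles v_W])
    then show ?thesis unfolding z1_v diff_zero by blast
  qed
  then have "\<forall>\<sigma>. \<exists>N U p. open U \<and> v \<in> U \<and> U \<subseteq> W \<and> holo_on p U \<and>
      eventually (\<lambda>y. A \<sigma> y * z y ^ N = p y) (generic U)" by blast
  then obtain N V r where "\<forall>\<sigma>. open (V \<sigma>) \<and> v \<in> V \<sigma> \<and> V \<sigma> \<subseteq> W \<and> holo_on (r \<sigma>) (V \<sigma>) \<and>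
      eventually (\<lambda>y. A \<sigma> y * z y ^ N \<sigma> = r \<sigma> y) (generic (V \<sigma>))"
    unfolding choice_iff by blast
  then have r: "\<And>\<sigma>. open (V \<sigma>)" "\<And>\<sigma>. v \<in> V \<sigma>" "\<And>\<sigma>. V \<sigma> \<subseteq> W" "\<And>\<sigma>. holo_on (r \<sigma>) (V \<sigma>)"
      "\<And>\<sigma>. eventually (\<lambda>y. A \<sigma> y * z y ^ N \<sigma> = r \<sigma> y) (generic (V \<sigma>))"
    by simp_all
  define U where "U = W \<inter> (\<Inter>\<sigma>\<in>X. V \<sigma>)"
  have U: "open U" "U \<subseteq> W" "v \<in> U"
    unfolding U_def using r X(1) open_W v_W by (auto intro!: open_Int open_INT)
  have UV: "U \<subseteq> V \<sigma>" if "\<sigma> \<in> X" for \<sigma> using that by (auto simp: U_def)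
  \<comment> \<open>A bound for all the orders that is at least \<open>1\<close>, so that the descent ends at order \<open>1\<close>.\<close>
  define n where "n = Suc (\<Sum>\<sigma>\<in>X. N \<sigma>)"
  let ?P = "\<lambda>m. \<exists>p. \<forall>\<sigma>\<in>X. holo_on (p \<sigma>) U \<and> eventually (\<lambda>y. z y ^ m * A \<sigma> y = p \<sigma> y) (generic U)"
  have "?P n"
  proof (intro exI ballI conjI)
    fix \<sigma> assume \<sigma>: "\<sigma> \<in> X"
    have "N \<sigma> \<le> n" unfolding n_def using member_le_sum[OF \<sigma>, of N] X(1) by simp
    then have "z y ^ n = z y ^ N \<sigma> * z y ^ (n - N \<sigma>)" for y
      by (simp add: power_add[symmetric])
    then have eq: "z y ^ n * A \<sigma> y = A \<sigma> y * z y ^ N \<sigma> * z y ^ (n - N \<sigma>)" for y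
      by simp
    have "eventually (\<lambda>y. A \<sigma> y * z y ^ N \<sigma> = r \<sigma> y) (generic U)"
      using eventually_generic_subset[OF r(1) U(1) UV[OF \<sigma>] r(5)] .
    then show "eventually (\<lambda>y. z y ^ n * A \<sigma> y = r \<sigma> y * z y ^ (n - N \<sigma>)) (generic U)"
      by eventually_elim (simp only: eq)
    show "holo_on (\<lambda>y. r \<sigma> y * z y ^ (n - N \<sigma>)) U"
      using holo_on_subset[OF r(4) U(1) UV[OF \<sigma>]] by (intro holo_on_mult holo_on_power holo_z U)
  qed
  moreover have "?P (Suc m)" if P: "?P (Suc (Suc m))" for m
  proof -
    obtain p where p: "\<And>\<sigma>. \<sigma> \<in> X \<Longrightarrow> holo_on (p \<sigma>) U"
      "\<And>\<sigma>. \<sigma> \<in> X \<Longrightarrow> eventually (\<lambda>y. z y ^ Suc (Suc m) * A \<sigma> y = p \<sigma> y) (generic U)"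
      using P by blast
    have "\<forall>\<sigma>\<in>X. \<exists>\<psi>. holo_on \<psi> U \<and> (\<forall>y\<in>U. p \<sigma> y = z y * \<psi> y)"
    proof
      fix \<sigma> assume \<sigma>: "\<sigma> \<in> X"
      have "p \<sigma> u = 0" if "u \<in> U" "z u = 0" for u
        using numerators_vanish[OF A AF X U(1,2) that _ p \<sigma>] by simp
      then obtain \<psi> where "holo_on \<psi> U" "\<And>y. y \<in> U \<Longrightarrow> p \<sigma> y = z y * \<psi> y"
        using clinear_form.holo_on_division[OF z_form p(1)[OF \<sigma>] z_e] by metis
      then show "\<exists>\<psi>. holo_on \<psi> U \<and> (\<forall>y\<in>U. p \<sigma> y = z y * \<psi> y)" by blast
    qed
    then obtain \<psi> where "\<forall>\<sigma>\<in>X. holo_on (\<psi> \<sigma>) U \<and> (\<forall>y\<in>U. p \<sigma> y = z y * \<psi> \<sigma> y)"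
      unfolding bchoice_iff by blast
    then have \<psi>: "\<And>\<sigma>. \<sigma> \<in> X \<Longrightarrow> holo_on (\<psi> \<sigma>) U"
      "\<And>\<sigma> y. \<sigma> \<in> X \<Longrightarrow> y \<in> U \<Longrightarrow> p \<sigma> y = z y * \<psi> \<sigma> y" by blast+
    show ?thesis
    proof (intro exI ballI conjI)
      fix \<sigma> assume \<sigma>: "\<sigma> \<in> X"
      show "eventually (\<lambda>y. z y ^ Suc m * A \<sigma> y = \<psi> \<sigma> y) (generic U)"
        using p(2)[OF \<sigma>] z_nonzero_generic[OF U(1), of 0] eventually_generic_mem[OF U(1)]
      proof eventually_elim
        case (elim y)
        then have "z y * (z y ^ Suc m * A \<sigma> y) = z y * \<psi> \<sigma> y"
          using \<psi>(2)[OF \<sigma> elim(3)] by (simp add: mult.assoc)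
        then show ?case by (rule mult_left_cancel[OF elim(2), THEN iffD1])
      qed
    qed (rule \<psi>(1))
  qed
  then have "?P (Suc m) \<Longrightarrow> ?P 1" for m
    by (induction m) auto
  ultimately have "?P 1" unfolding n_def by blast
  then show ?thesis using U by (intro exI[of _ U]) simp
qed

section \<open>The local distributions as values and derivatives\<close>

lemma evaluate_action:
  assumes A: "A \<in> carrier \<D>" and F: "F \<in> \<H>"
    and X: "finite X" "supp A \<subseteq> X" "X \<subseteq> shifts"
    and U: "open U" "U \<subseteq> W" "v \<in> U"
    and p: "\<And>\<sigma>. \<sigma> \<in> X \<Longrightarrow> holo_on (p \<sigma>) U"
    and pA: "\<And>\<sigma>. \<sigma> \<in> X \<Longrightarrow> eventually (\<lambda>y. z y * A \<sigma> y = p \<sigma> y) (generic U)"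
  shows "apply_fsum W A F v =
    (\<Sum>\<sigma>\<in>X. d (p \<sigma>) v * F (shift (- \<sigma>) v) + p \<sigma> v * d F (shift (- \<sigma>) v))"
  using jet_identity(2)[OF D_carrier[OF A] F D_action[OF A F] X U z1_v _ p, of 1] pA by simp

lemma add_coeff_shift:
  assumes "premero W f" "premero W g"
  shows "coeff_shift W f \<sigma> \<oplus>\<^bsub>R\<^esub> coeff_shift W g \<sigma>' =
    (\<lambda>\<rho>. mero_nf W (\<lambda>x. (if \<rho> = \<sigma> then f x else 0) + (if \<rho> = \<sigma>' then g x else 0)))"
proof
  fix \<rho>
  have "eventually (\<lambda>x. coeff_shift W f \<sigma> \<rho> x + coeff_shift W g \<sigma>' \<rho> x =
      (if \<rho> = \<sigma> then f x else 0) + (if \<rho> = \<sigma>' then g x else 0)) (generic W)"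
    using coeff_shift_generic[OF assms(1), of \<sigma> \<rho>] coeff_shift_generic[OF assms(2), of \<sigma>' \<rho>]
    by eventually_elim simp
  then show "(coeff_shift W f \<sigma> \<oplus>\<^bsub>R\<^esub> coeff_shift W g \<sigma>') \<rho> =
      mero_nf W (\<lambda>x. (if \<rho> = \<sigma> then f x else 0) + (if \<rho> = \<sigma>' then g x else 0))"
    unfolding add_coeff by (rule mero_nf_cong[OF open_W])
qed

text \<open>
  Both kinds of local distributions come from an element with two terms \<open>h / z\<close> at \<open>\<sigma>\<close> and \<open>h' / z\<close> at \<open>\<tau> \<sigma>\<close>.
  The antisymmetry of \<open>h\<close> and \<open>h'\<close> makes it a generator of the universal ring.  When \<open>\<tau> \<sigma> = \<sigma>\<close> the two terms
  are added, and the derivative of \<open>F\<close> at \<open>v - \<sigma>\<close> is \<open>0\<close>.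
\<close>

lemma pair_in_D:
  assumes \<sigma>: "\<sigma> \<in> shifts" and h: "holo_on h W" and h': "holo_on h' W"
    and anti: "\<And>x. h' (\<tau> x) = - h x"
    and E: "E = coeff_shift W (\<lambda>x. h x / z x) \<sigma> \<oplus>\<^bsub>R\<^esub> coeff_shift W (\<lambda>x. h' x / z x) (\<tau> \<sigma>)"
  shows "E \<in> carrier \<D>"
    and "F \<in> \<H> \<Longrightarrow> apply_fsum W E F v =
      (d h v + d h' v) * F (shift (- \<sigma>) v) + (h v - h' v) * d F (shift (- \<sigma>) v)"
proof -
  define H where "H \<rho> x = (if \<rho> = \<sigma> then h x else 0) + (if \<rho> = \<tau> \<sigma> then h' x else 0)" for \<rho> x
  have anti': "h (\<tau> x) = - h' x" for x using anti[of "\<tau> x"] by simp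
  have if_holo: "holo_on (\<lambda>x. if b then f x else 0) W" if "holo_on f W" for b f
    using that holo_on_const[OF open_W, of 0] by (cases b) simp_all
  have H: "holo_on (H \<rho>) W" for \<rho>
    unfolding H_def by (intro holo_on_add if_holo h h')
  let ?X = "{\<sigma>, \<tau> \<sigma>}"
  have X: "finite ?X" "?X \<subseteq> shifts" using \<sigma> by auto
  have EH: "E = (\<lambda>\<rho>. mero_nf W (\<lambda>x. H \<rho> x / z x))"
  proof -
    have "(if \<rho> = \<sigma> then h x / z x else 0) + (if \<rho> = \<tau> \<sigma> then h' x / z x else 0) = H \<rho> x / z x" for \<rho> x
      by (simp add: H_def add_divide_distrib)
    then show ?thesis
      unfolding E add_coeff_shift[OF premero_divide_z[OF h] premero_divide_z[OF h']] by simp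
  qed
  have "E \<in> gens"
    unfolding EH
  proof (rule gensI[OF X _ H])
    show "H \<rho> = (\<lambda>_. 0)" if "\<rho> \<notin> ?X" for \<rho> using that by (auto simp: H_def)
    show "H (\<tau> \<rho>) (\<tau> x) = - H \<rho> x" for \<rho> x
    proof -
      have "\<tau> \<rho> = \<sigma> \<longleftrightarrow> \<rho> = \<tau> \<sigma>" by auto
      then show ?thesis by (simp add: H_def anti anti' tau_inject)
    qed
  qed
  then show ED: "E \<in> carrier \<D>" unfolding carrier_D by (rule generate_ring.incl)
  assume F: "F \<in> \<H>"
  have supp: "supp E \<subseteq> ?X"
  proof
    fix \<rho> assume "\<rho> \<in> supp E"
    moreover have "E \<rho> = 0" if "\<rho> \<notin> ?X"
      using that mero_nf_zero by (auto simp: EH H_def)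
    ultimately show "\<rho> \<in> ?X" by blast
  qed
  have "eventually (\<lambda>y. z y * E \<rho> y = H \<rho> y) (generic W)" for \<rho>
    using coeff_generic[of E \<rho>, OF fun_cong[OF EH] premero_divide_z[OF H]]
      z_nonzero_generic[OF open_W, of 0]
    by eventually_elim simp
  then have eq: "apply_fsum W E F v =
      (\<Sum>\<rho>\<in>?X. d (H \<rho>) v * F (shift (- \<rho>) v) + H \<rho> v * d F (shift (- \<rho>) v))"
    by (intro evaluate_action[OF ED F X(1) supp X(2) open_W order_refl v_W] H)
  note orb = inv_holo_orbit[OF F v_W z1_v \<sigma>]
  show "apply_fsum W E F v = (d h v + d h' v) * F (shift (- \<sigma>) v) + (h v - h' v) * d F (shift (- \<sigma>) v)"
  proof (cases "\<tau> \<sigma> = \<sigma>")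
    case True
    then have "H \<sigma> = (\<lambda>x. h x + h' x)" by (simp add: H_def fun_eq_iff)
    moreover from this have "d (H \<sigma>) v = d h v + d h' v" using d_add[OF h h' v_W] by simp
    moreover have "d F (shift (- \<sigma>) v) = 0" using orb(2) True by simp
    ultimately show ?thesis using eq True by simp
  next
    case False
    then have "H \<sigma> = h" "H (\<tau> \<sigma>) = h'" by (auto simp: H_def fun_eq_iff)
    then show ?thesis using eq False orb by (simp add: algebra_simps)
  qed
qed

definition sum_pair :: "'n shift \<Rightarrow> 'n fsum" where
  "sum_pair \<sigma> = coeff_shift W (\<lambda>_. 1) \<sigma> \<oplus>\<^bsub>R\<^esub> coeff_shift W (\<lambda>_. 1) (\<tau> \<sigma>)"

definition diff_pair :: "'n shift \<Rightarrow> 'n fsum" where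
  "diff_pair \<sigma> = coeff_shift W (\<lambda>x. 1 / (2 * z x)) \<sigma> \<oplus>\<^bsub>R\<^esub> coeff_shift W (\<lambda>x. - 1 / (2 * z x)) (\<tau> \<sigma>)"

text \<open>
  The coefficient \<open>1\<close> has the shape \<open>h / z\<close> with \<open>h = z\<close>.
\<close>

lemma sum_pair_eq: "sum_pair \<sigma> = coeff_shift W (\<lambda>x. z x / z x) \<sigma> \<oplus>\<^bsub>R\<^esub> coeff_shift W (\<lambda>x. z x / z x) (\<tau> \<sigma>)"
proof -
  have "mero_nf W (\<lambda>_. 1) = mero_nf W (\<lambda>x. z x / z x)"
    using z_nonzero_generic[OF open_W, of 0]
    by (intro mero_nf_cong[OF open_W]) (auto elim: eventually_mono)
  then show ?thesis unfolding sum_pair_def coeff_shift_def by (simp only:)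
qed

lemma sum_pair:
  assumes "\<sigma> \<in> shifts"
  shows "sum_pair \<sigma> \<in> carrier \<D>" "F \<in> \<H> \<Longrightarrow> apply_fsum W (sum_pair \<sigma>) F v = 2 * F (shift (- \<sigma>) v)"
  using pair_in_D[OF assms holo_z[OF open_W] holo_z[OF open_W] z_tau sum_pair_eq] by simp_all

lemma diff_pair:
  assumes "\<sigma> \<in> shifts"
  shows "diff_pair \<sigma> \<in> carrier \<D>" "F \<in> \<H> \<Longrightarrow> apply_fsum W (diff_pair \<sigma>) F v = d F (shift (- \<sigma>) v)"
proof -
  have "diff_pair \<sigma> = coeff_shift W (\<lambda>x. (1 / 2) / z x) \<sigma> \<oplus>\<^bsub>R\<^esub> coeff_shift W (\<lambda>x. (- 1 / 2) / z x) (\<tau> \<sigma>)"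
    by (simp add: diff_pair_def)
  from pair_in_D[OF assms holo_on_const[OF open_W] holo_on_const[OF open_W] _ this]
  show "diff_pair \<sigma> \<in> carrier \<D>" "F \<in> \<H> \<Longrightarrow> apply_fsum W (diff_pair \<sigma>) F v = d F (shift (- \<sigma>) v)"
    by simp_all
qed

abbreviation "D1 \<equiv> dist1 W v k i j"
abbreviation "D2 \<equiv> dist2 W v k i j"

lemma ev_comp: "comp_fsum W v (ev W v) A F = (if F \<in> \<H> then ev W v (apply_fsum W A F) else 0)"
  by (simp add: comp_fsum_def)

lemma ev_D:
  assumes "A \<in> carrier \<D>"
  shows "comp_fsum W v (ev W v) A F = (if F \<in> \<H> then apply_fsum W A F v else 0)"
  unfolding ev_comp using D_action[OF assms] by (simp add: ev_def)

lemma D1_sum_pair: "D1 \<sigma> = fscale (1/2) (comp_fsum W v (ev W v) (sum_pair \<sigma>))"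
  by (simp add: dist1_def sum_pair_def)

lemma D2_diff_pair: "\<tau> \<sigma> \<noteq> \<sigma> \<Longrightarrow> D2 \<sigma> = comp_fsum W v (ev W v) (diff_pair \<sigma>)"
  by (simp add: dist2_def diff_pair_def)

lemma D1_eval:
  assumes "\<sigma> \<in> shifts"
  shows "D1 \<sigma> F = (if F \<in> \<H> then F (shift (- \<sigma>) v) else 0)"
  using sum_pair[OF assms] by (simp add: D1_sum_pair fscale_def ev_D)

lemma D2_eval:
  assumes "\<sigma> \<in> shifts"
  shows "D2 \<sigma> F = (if F \<in> \<H> then d F (shift (- \<sigma>) v) else 0)"
proof (cases "\<tau> \<sigma> = \<sigma>")
  case True
  then show ?thesis
    using inv_holo_orbit(2)[OF _ v_W z1_v assms, of F] by (simp add: dist2_def)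
next
  case False
  then show ?thesis using diff_pair[OF assms] by (simp add: D2_diff_pair ev_D)
qed

section \<open>Composing the evaluation with the universal ring\<close>

abbreviation "g h \<equiv> mero_nf W (\<lambda>x. z x * h x)"

lemma D_numerators:
  assumes "A \<in> carrier \<D>"
  shows "holo_at (g (A \<sigma>)) v"
    and "F \<in> \<H> \<Longrightarrow> apply_fsum W A F v =
      (\<Sum>\<sigma> | A \<sigma> \<noteq> 0. d (g (A \<sigma>)) v * F (shift (- \<sigma>) v) + g (A \<sigma>) v * d F (shift (- \<sigma>) v))"
proof -
  note AR = D_carrier[OF assms]
  have X: "finite (supp A \<union> \<tau> ` supp A)" "supp A \<subseteq> supp A \<union> \<tau> ` supp A"
    "supp A \<union> \<tau> ` supp A \<subseteq> shifts" "\<tau> ` (supp A \<union> \<tau> ` supp A) \<subseteq> supp A \<union> \<tau> ` supp A"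
    using carrier_finite[OF AR] carrier_shifts[OF AR] by auto
  obtain U p where U: "open U" "U \<subseteq> W" "v \<in> U"
    and "\<forall>\<sigma>\<in>supp A \<union> \<tau> ` supp A. holo_on (p \<sigma>) U \<and>
      eventually (\<lambda>y. z y * A \<sigma> y = p \<sigma> y) (generic U)"
    using simple_poles[OF AR D_action[OF assms] D_poles[OF assms] X] by blast
  then have p: "\<And>\<sigma>. \<sigma> \<in> supp A \<Longrightarrow> holo_on (p \<sigma>) U"
    and pA: "\<And>\<sigma>. \<sigma> \<in> supp A \<Longrightarrow> eventually (\<lambda>y. z y * A \<sigma> y = p \<sigma> y) (generic U)"
    by blast+
  have gp: "g (A \<sigma>) y = p \<sigma> y" if "\<sigma> \<in> supp A" "y \<in> U" for \<sigma> y
    using that U by (intro mero_nf_eqI[OF _ that(2) p pA]) auto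
  show "holo_at (g (A \<sigma>)) v"
  proof (cases "\<sigma> \<in> supp A")
    case True
    then have "holo_on (g (A \<sigma>)) U"
      using holo_on_cong[OF p[of \<sigma>], of "g (A \<sigma>)"] gp by simp
    then show ?thesis using U(3) by (auto simp: holo_at_def)
  next
    case False
    then have "g (A \<sigma>) = (\<lambda>_. 0)" using mero_nf_zero by (simp add: zero_fun_def)
    then show ?thesis unfolding holo_at_def using holo_on_const[OF open_UNIV] by (metis UNIV_I)
  qed
  assume F: "F \<in> \<H>"
  have "apply_fsum W A F v = (\<Sum>\<sigma>\<in>supp A. d (p \<sigma>) v * F (shift (- \<sigma>) v) + p \<sigma> v * d F (shift (- \<sigma>) v))"
    by (rule evaluate_action[OF assms F carrier_finite[OF AR] order_refl carrier_shifts[OF AR] U p pA]) auto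
  also have "\<dots> = (\<Sum>\<sigma>\<in>supp A. d (g (A \<sigma>)) v * F (shift (- \<sigma>) v) + g (A \<sigma>) v * d F (shift (- \<sigma>) v))"
  proof (intro sum.cong refl)
    fix \<sigma> assume \<sigma>: "\<sigma> \<in> supp A"
    have "d (g (A \<sigma>)) v = d (p \<sigma>) v" by (rule d_cong[OF U(1,3)]) (rule gp[OF \<sigma>])
    then show "d (p \<sigma>) v * F (shift (- \<sigma>) v) + p \<sigma> v * d F (shift (- \<sigma>) v) =
        d (g (A \<sigma>)) v * F (shift (- \<sigma>) v) + g (A \<sigma>) v * d F (shift (- \<sigma>) v)"
      using gp[OF \<sigma> U(3)] by simp
  qed
  finally show "apply_fsum W A F v =
      (\<Sum>\<sigma> | A \<sigma> \<noteq> 0. d (g (A \<sigma>)) v * F (shift (- \<sigma>) v) + g (A \<sigma>) v * d F (shift (- \<sigma>) v))" .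
qed

text \<open>
  The evaluation of \<open>A F\<close> at \<open>v\<close> is a sum over first order jets of \<open>F\<close>, and the local distributions read off
  exactly these jets.
\<close>

lemma ev_comp_formula:
  assumes A: "A \<in> carrier \<D>"
  shows "comp_fsum W v (ev W v) A =
    (\<Sum>\<sigma> | A \<sigma> \<noteq> 0. fscale (g (A \<sigma>) v) (D2 \<sigma>)) + (\<Sum>\<sigma> | A \<sigma> \<noteq> 0. fscale (d (g (A \<sigma>)) v) (D1 \<sigma>))"
proof
  fix F
  have s: "\<sigma> \<in> shifts" if "\<sigma> \<in> supp A" for \<sigma> using carrier_shifts[OF D_carrier[OF A]] that by blast
  have 1: "(\<Sum>\<sigma> | A \<sigma> \<noteq> 0. fscale (g (A \<sigma>) v) (D2 \<sigma>)) F =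
      (\<Sum>\<sigma>\<in>supp A. g (A \<sigma>) v * (if F \<in> \<H> then d F (shift (- \<sigma>) v) else 0))"
    unfolding sum_fun_apply fscale_def by (intro sum.cong refl) (simp only: D2_eval[OF s])
  have 2: "(\<Sum>\<sigma> | A \<sigma> \<noteq> 0. fscale (d (g (A \<sigma>)) v) (D1 \<sigma>)) F =
      (\<Sum>\<sigma>\<in>supp A. d (g (A \<sigma>)) v * (if F \<in> \<H> then F (shift (- \<sigma>) v) else 0))"
    unfolding sum_fun_apply fscale_def by (intro sum.cong refl) (simp only: D1_eval[OF s])
  show "comp_fsum W v (ev W v) A F = ((\<Sum>\<sigma> | A \<sigma> \<noteq> 0. fscale (g (A \<sigma>) v) (D2 \<sigma>)) +
      (\<Sum>\<sigma> | A \<sigma> \<noteq> 0. fscale (d (g (A \<sigma>)) v) (D1 \<sigma>))) F"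
    unfolding plus_fun_apply 1 2 ev_D[OF A]
    using D_numerators(2)[OF A, of F] by (simp add: sum.distrib add.commute)
qed

lemma holomorphic_coefficient:
  assumes "holo_at h v"
  shows "g h v = 0" "d (g h) v = h v"
proof -
  obtain V where V: "v \<in> V" "holo_on h V" using assms by (auto simp: holo_at_def)
  let ?U = "V \<inter> W"
  have U: "open ?U" "v \<in> ?U" using V holo_on_imp_open open_W v_W by auto
  have h: "holo_on h ?U" using holo_on_subset[OF V(2) U(1)] by auto
  have zh: "holo_on (\<lambda>x. z x * h x) ?U" by (intro holo_on_mult h holo_z U)
  have gh: "g h y = z y * h y" if "y \<in> ?U" for y
    using that by (intro mero_nf_eqI[OF _ that zh]) auto
  show "g h v = 0" using gh[OF U(2)] z1_v by simp
  have "d (g h) v = d (\<lambda>x. z x * h x) v" by (rule d_cong[OF U gh])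
  also have "\<dots> = h v" using d_mult[OF holo_z[OF U(1)] h U(2)] z1_v by simp
  finally show "d (g h) v = h v" .
qed

section \<open>The span of the local distributions\<close>

abbreviation "\<B> \<equiv> dist_basis W v k i j"
abbreviation "\<S> \<equiv> functional.span \<B>"
abbreviation "\<Delta> \<equiv> ordered_shifts k i j"

lemma \<Delta>_cases: "\<sigma> \<in> shifts \<Longrightarrow> \<sigma> \<in> \<Delta> \<or> \<tau> \<sigma> \<in> \<Delta>"
  by (auto simp: ordered_shifts_def)

lemma \<Delta>_tau: "\<sigma> \<in> \<Delta> \<Longrightarrow> \<tau> \<sigma> \<in> \<Delta> \<Longrightarrow> \<tau> \<sigma> = \<sigma>"
  by (auto simp: ordered_shifts_def tau_eq_iff)

lemma \<Delta>_shifts: "\<sigma> \<in> \<Delta> \<Longrightarrow> \<sigma> \<in> shifts"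
  by (simp add: ordered_shifts_def)

lemma D1_tau: "\<sigma> \<in> shifts \<Longrightarrow> D1 (\<tau> \<sigma>) = D1 \<sigma>"
  using inv_holo_orbit(1)[OF _ v_W z1_v] by (auto simp: fun_eq_iff D1_eval)

text \<open>
  Up to sign the distributions only depend on \<open>\<sigma>\<close> modulo \<open>\<tau>\<close>; this is why the shifts in \<open>\<Delta>\<close> are enough.
\<close>

lemma D2_tau: "\<sigma> \<in> shifts \<Longrightarrow> D2 (\<tau> \<sigma>) = fscale (- 1) (D2 \<sigma>)"
  using inv_holo_orbit(2)[OF _ v_W z1_v] by (auto simp: fun_eq_iff D2_eval fscale_def)

lemma D1_span: 
  assumes "\<sigma> \<in> shifts" shows "D1 \<sigma> \<in> \<S>"
proof -
  have "D1 \<rho> \<in> \<S>" if "\<rho> \<in> \<Delta>" for \<rho>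
    using that by (intro functional.span_base) (simp add: dist_basis_def)
  then show ?thesis using \<Delta>_cases[OF assms] D1_tau[OF assms] by metis
qed

lemma D2_span: 
  assumes "\<sigma> \<in> shifts" shows "D2 \<sigma> \<in> \<S>"
proof -
  have *: "D2 \<rho> \<in> \<S>" if "\<rho> \<in> \<Delta>" for \<rho>
  proof (cases "\<tau> \<rho> = \<rho>")
    case True
    then show ?thesis using functional.span_zero by (simp add: dist2_def)
  next
    case False
    then show ?thesis using that by (intro functional.span_base) (auto simp: dist_basis_def)
  qed
  show ?thesis
  proof (cases "\<sigma> \<in> \<Delta>")
    case False
    then have "D2 (\<tau> \<sigma>) \<in> \<S>" using * \<Delta>_cases[OF assms] by blast
    then have "fscale (- 1) (D2 (\<tau> \<sigma>)) \<in> \<S>" by (rule functional.span_scale)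
    then show ?thesis using D2_tau[of "\<tau> \<sigma>"] assms by simp
  qed (rule *)
qed

lemma ev_comp_span:
  assumes "A \<in> carrier \<D>"
  shows "comp_fsum W v (ev W v) A \<in> \<S>"
proof -
  have s: "\<sigma> \<in> shifts" if "\<sigma> \<in> supp A" for \<sigma> using carrier_shifts[OF D_carrier[OF assms]] that by blast
  show ?thesis unfolding ev_comp_formula[OF assms]
    by (intro functional.span_add functional.span_sum functional.span_scale D1_span D2_span s)
qed

lemma D_mult: "A \<in> carrier \<D> \<Longrightarrow> B \<in> carrier \<D> \<Longrightarrow> A \<otimes>\<^bsub>R\<^esub> B \<in> carrier \<D>"
  unfolding carrier_D by (rule generate_ring.eng_mult)

lemma comp_comp:
  assumes A: "A \<in> carrier \<D>" and B: "B \<in> carrier \<D>"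
  shows "comp_fsum W v (comp_fsum W v D A) B = comp_fsum W v D (A \<otimes>\<^bsub>R\<^esub> B)"
proof
  fix F
  show "comp_fsum W v (comp_fsum W v D A) B F = comp_fsum W v D (A \<otimes>\<^bsub>R\<^esub> B) F"
    using D_action[OF B, of F] apply_mult[OF D_carrier[OF A] D_carrier[OF B] inv_holo_premero[of F]]
    by (simp add: comp_fsum_def)
qed

lemma comp_fsum_add: "comp_fsum W v (D + D') A = comp_fsum W v D A + comp_fsum W v D' A"
  by (auto simp: comp_fsum_def fun_eq_iff)

lemma comp_fsum_scale: "comp_fsum W v (fscale c D) A = fscale c (comp_fsum W v D A)"
  by (auto simp: comp_fsum_def fun_eq_iff fscale_def)

lemma comp_fsum_zero: "comp_fsum W v 0 A = 0"
  by (auto simp: comp_fsum_def fun_eq_iff)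

text \<open>
  A local distribution is the evaluation composed with a ring element \<open>E\<close>, so its composition with \<open>A\<close> is
  the evaluation composed with the product of \<open>E\<close> and \<open>A\<close>, which lies in the span by the formula.
\<close>

lemma span_comp:
  assumes A: "A \<in> carrier \<D>" and D: "D \<in> \<S>"
  shows "comp_fsum W v D A \<in> \<S>"
  using D
proof (rule functional.span_induct)
  show "functional.subspace {D. comp_fsum W v D A \<in> \<S>}"
    by (rule functional.subspaceI)
       (auto simp: comp_fsum_add comp_fsum_scale comp_fsum_zero
          intro: functional.span_add functional.span_scale functional.span_zero)
  fix D assume "D \<in> \<B>"
  then consider \<sigma> where "\<sigma> \<in> \<Delta>" "D = D1 \<sigma>" | \<sigma> where "\<sigma> \<in> \<Delta>" "\<tau> \<sigma> \<noteq> \<sigma>" "D = D2 \<sigma>"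
    by (auto simp: dist_basis_def)
  then show "comp_fsum W v D A \<in> \<S>"
  proof cases
    case 1
    then have "comp_fsum W v D A = fscale (1/2) (comp_fsum W v (ev W v) (sum_pair \<sigma> \<otimes>\<^bsub>R\<^esub> A))"
      using comp_comp[OF sum_pair(1)[OF \<Delta>_shifts[OF 1(1)]] A] by (simp add: D1_sum_pair comp_fsum_scale)
    then show ?thesis
      using 1 by (simp add: functional.span_scale ev_comp_span D_mult A sum_pair(1) \<Delta>_shifts)
  next
    case 2
    then have "comp_fsum W v D A = comp_fsum W v (ev W v) (diff_pair \<sigma> \<otimes>\<^bsub>R\<^esub> A)"
      using comp_comp[OF diff_pair(1)[OF \<Delta>_shifts[OF 2(1)]] A] by (simp add: D2_diff_pair)
    then show ?thesis
      using 2 by (simp add: ev_comp_span D_mult A diff_pair(1) \<Delta>_shifts)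
  qed
qed

lemma dist_dual:
  assumes "\<sigma> \<in> shifts"
  shows "D1 \<sigma> \<in> dual \<H>" "D2 \<sigma> \<in> dual \<H>"
proof -
  have yW: "shift (- \<sigma>) v \<in> W" using v_W assms shift_in_W by simp
  show "D1 \<sigma> \<in> dual \<H>"
    using assms by (simp add: dual_def D1_eval inv_holo_add inv_holo_scale) (simp add: fscale_def)
  have "d (F + G) (shift (- \<sigma>) v) = d F (shift (- \<sigma>) v) + d G (shift (- \<sigma>) v)" if "F \<in> \<H>" "G \<in> \<H>" for F G
    using d_add[OF inv_holoD(1)[OF that(1)] inv_holoD(1)[OF that(2)] yW] by (simp add: plus_fun_def)
  moreover have "d (fscale c F) (shift (- \<sigma>) v) = c * d F (shift (- \<sigma>) v)" if "F \<in> \<H>" for F c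
    using d_mult[OF holo_on_const[OF open_W] inv_holoD(1)[OF that] yW, of c] by (simp add: fscale_def)
  ultimately show "D2 \<sigma> \<in> dual \<H>"
    using assms by (simp add: dual_def D2_eval inv_holo_add inv_holo_scale)
qed

lemma dual_subspace: "functional.subspace (dual \<H>)"
  by (rule functional.subspaceI) (auto simp: dual_def fscale_def algebra_simps)

lemma span_dual: "\<S> \<subseteq> dual \<H>"
  by (rule functional.span_minimal[OF _ dual_subspace])
     (auto simp: dist_basis_def intro: dist_dual \<Delta>_shifts)

section \<open>Linear independence\<close>

text \<open>
  Two different shifts in \<open>\<Delta>\<close> are never exchanged by \<open>\<tau>\<close>.  So for each element of the basis some invariant
  function has a jet that this element detects and that a given finite set of other elements does not.
\<close>

lemma independent_basis: "functional.independent \<B>"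
  unfolding functional.dependent_def
proof
  assume "\<exists>b\<in>\<B>. b \<in> functional.span (\<B> - {b})"
  then obtain b where b: "b \<in> \<B>" "b \<in> functional.span (\<B> - {b})" by blast
  then obtain t r where t: "finite t" "t \<subseteq> \<B> - {b}" "b = (\<Sum>a\<in>t. fscale (r a) a)"
    unfolding functional.span_explicit by blast
  have bF: "b F = (\<Sum>a\<in>t. r a * a F)" for F
    unfolding t(3) sum_fun_apply fscale_def ..
  have "\<forall>a\<in>t. \<exists>\<rho>\<in>\<Delta>. a = D1 \<rho> \<or> a = D2 \<rho>"
    using t(2) by (auto simp: dist_basis_def)
  then obtain s where s: "\<And>a. a \<in> t \<Longrightarrow> s a \<in> \<Delta>" "\<And>a. a \<in> t \<Longrightarrow> a = D1 (s a) \<or> a = D2 (s a)"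
    unfolding Bex_def bchoice_iff by blast
  let ?X = "s ` t"
  have X: "finite ?X" "?X \<subseteq> shifts" using t(1) s(1) \<Delta>_shifts by auto
  have contra: False if "F \<in> \<H>" "b F \<noteq> 0" "\<And>a. a \<in> t \<Longrightarrow> a F = 0" for F
  proof -
    have "b F = 0" unfolding bF by (intro sum.neutral ballI) (simp add: that(3))
    with that(2) show False by contradiction
  qed
  have neq_tau: "\<rho> \<noteq> \<tau> \<sigma>" if "\<rho> \<in> \<Delta>" "\<sigma> \<in> \<Delta>" "\<rho> \<noteq> \<sigma>" for \<rho> \<sigma>
    using \<Delta>_tau[of \<sigma>] that by auto
  from b(1) consider \<sigma> where "\<sigma> \<in> \<Delta>" "b = D1 \<sigma>" | \<sigma> where "\<sigma> \<in> \<Delta>" "\<tau> \<sigma> \<noteq> \<sigma>" "b = D2 \<sigma>"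
    by (auto simp: dist_basis_def)
  then show False
  proof cases
    case 1
    note \<sigma> = \<Delta>_shifts[OF 1(1)]
    obtain F where F: "F \<in> \<H>" "F (shift (- \<sigma>) v) = 1" "d F (shift (- \<sigma>) v) = 0"
      "\<And>\<rho>. \<rho> \<in> ?X \<Longrightarrow> \<rho> \<noteq> \<sigma> \<Longrightarrow> \<rho> \<noteq> \<tau> \<sigma> \<Longrightarrow> F (shift (- \<rho>) v) = 0"
      "\<And>\<rho>. \<rho> \<in> ?X \<Longrightarrow> \<rho> \<noteq> \<sigma> \<Longrightarrow> \<rho> \<noteq> \<tau> \<sigma> \<Longrightarrow> d F (shift (- \<rho>) v) = 0"
      using jet_interpolation[OF v_W z1_v X \<sigma>, of 0 1] by metis
    show False
    proof (rule contra[OF F(1)])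
      show "b F \<noteq> 0" using F 1 \<sigma> by (simp add: D1_eval)
      fix a assume a: "a \<in> t"
      note \<rho> = \<Delta>_shifts[OF s(1)[OF a]]
      show "a F = 0"
      proof (cases "s a = \<sigma>")
        case True
        then have "a = D2 \<sigma>" using s(2)[OF a] a t(2) 1 by auto
        then show ?thesis using F \<sigma> by (simp add: D2_eval)
      next
        case False
        then have "F (shift (- s a) v) = 0" "d F (shift (- s a) v) = 0"
          using F(4,5)[of "s a"] neq_tau[OF s(1)[OF a] 1(1)] a by auto
        then have "D1 (s a) F = 0" "D2 (s a) F = 0" using \<rho> by (simp_all add: D1_eval D2_eval)
        then show ?thesis using s(2)[OF a] by metis
      qed
    qed
  next
    case 2
    note \<sigma> = \<Delta>_shifts[OF 2(1)]
    obtain F where F: "F \<in> \<H>" "F (shift (- \<sigma>) v) = 0" "d F (shift (- \<sigma>) v) = 1"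
      "\<And>\<rho>. \<rho> \<in> ?X \<Longrightarrow> \<rho> \<noteq> \<sigma> \<Longrightarrow> \<rho> \<noteq> \<tau> \<sigma> \<Longrightarrow> F (shift (- \<rho>) v) = 0"
      "\<And>\<rho>. \<rho> \<in> ?X \<Longrightarrow> \<rho> \<noteq> \<sigma> \<Longrightarrow> \<rho> \<noteq> \<tau> \<sigma> \<Longrightarrow> d F (shift (- \<rho>) v) = 0"
      using jet_interpolation[OF v_W z1_v X \<sigma>, of 1 0] 2(2) by metis
    show False
    proof (rule contra[OF F(1)])
      show "b F \<noteq> 0" using F 2 \<sigma> by (simp add: D2_eval)
      fix a assume a: "a \<in> t"
      note \<rho> = \<Delta>_shifts[OF s(1)[OF a]]
      show "a F = 0"
      proof (cases "s a = \<sigma>")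
        case True
        then have "a = D1 \<sigma>" using s(2)[OF a] a t(2) 2 by auto
        then show ?thesis using F \<sigma> by (simp add: D1_eval)
      next
        case False
        then have "F (shift (- s a) v) = 0" "d F (shift (- s a) v) = 0"
          using F(4,5)[of "s a"] neq_tau[OF s(1)[OF a] 2(1)] a by auto
        then have "D1 (s a) F = 0" "D2 (s a) F = 0" using \<rho> by (simp_all add: D1_eval D2_eval)
        then show ?thesis using s(2)[OF a] by metis
      qed
    qed
  qed
qed

section \<open>The module structure\<close>

lemma abelian_group_dist_module: "abelian_group (dist_module W v k i j)"
proof (rule abelian_groupI)
  fix D assume "D \<in> carrier (dist_module W v k i j)"
  then show "\<exists>D'\<in>carrier (dist_module W v k i j).
      D' \<oplus>\<^bsub>dist_module W v k i j\<^esub> D = \<zero>\<^bsub>dist_module W v k i j\<^esub>"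
    using functional.span_neg[of D \<B>] by (intro bexI[of _ "- D"]) (auto simp: dist_module_def)
qed (auto simp: dist_module_def functional.span_add functional.span_zero algebra_simps)

lemma left_module_dist: "left_module (opposite_ring \<D>) (dist_module W v k i j)"
proof (intro left_module.intro left_module_axioms.intro ring_opposite ring_D abelian_group_dist_module)
  fix A B D D'
  assume "A \<in> carrier (opposite_ring \<D>)" "B \<in> carrier (opposite_ring \<D>)"
  then have A: "A \<in> carrier \<D>" and B: "B \<in> carrier \<D>" by (simp_all add: opposite_ring_def)
  assume "D \<in> carrier (dist_module W v k i j)"
  then have D: "D \<in> \<S>" by (simp add: dist_module_def)
  show "(A \<oplus>\<^bsub>opposite_ring \<D>\<^esub> B) \<odot>\<^bsub>dist_module W v k i j\<^esub> D =
      A \<odot>\<^bsub>dist_module W v k i j\<^esub> D \<oplus>\<^bsub>dist_module W v k i j\<^esub> B \<odot>\<^bsub>dist_module W v k i j\<^esub> D"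
  proof -
    have "comp_fsum W v D (A \<oplus>\<^bsub>R\<^esub> B) F = comp_fsum W v D A F + comp_fsum W v D B F" for F
    proof (cases "F \<in> \<H>")
      case True
      note AF = D_action[OF A True] and BF = D_action[OF B True]
      have "D (apply_fsum W A F + apply_fsum W B F) = D (apply_fsum W A F) + D (apply_fsum W B F)"
        using span_dual D AF BF by (auto simp: dual_def)
      then show ?thesis
        using True apply_add_inv_holo[OF D_carrier[OF A] D_carrier[OF B] True AF BF]
        by (simp add: comp_fsum_def)
    qed (simp add: comp_fsum_def)
    then show ?thesis by (simp add: dist_module_def opposite_ring_def D_ops fun_eq_iff)
  qed
  show "(A \<otimes>\<^bsub>opposite_ring \<D>\<^esub> B) \<odot>\<^bsub>dist_module W v k i j\<^esub> D =
      A \<odot>\<^bsub>dist_module W v k i j\<^esub> (B \<odot>\<^bsub>dist_module W v k i j\<^esub> D)"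
    using comp_comp[OF B A, of D] by (simp add: dist_module_def opposite_ring_def D_ops)
next
  fix A D D' assume "A \<in> carrier (opposite_ring \<D>)" "D \<in> carrier (dist_module W v k i j)"
  then have A: "A \<in> carrier \<D>" and D: "D \<in> \<S>" by (simp_all add: opposite_ring_def dist_module_def)
  show "A \<odot>\<^bsub>dist_module W v k i j\<^esub> D \<in> carrier (dist_module W v k i j)"
    using span_comp[OF A D] by (simp add: dist_module_def)
  show "A \<odot>\<^bsub>dist_module W v k i j\<^esub> (D \<oplus>\<^bsub>dist_module W v k i j\<^esub> D') =
      A \<odot>\<^bsub>dist_module W v k i j\<^esub> D \<oplus>\<^bsub>dist_module W v k i j\<^esub> A \<odot>\<^bsub>dist_module W v k i j\<^esub> D'"
    by (simp add: dist_module_def comp_fsum_add)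
next
  fix D assume "D \<in> carrier (dist_module W v k i j)"
  then have "D \<in> dual \<H>" using span_dual by (auto simp: dist_module_def)
  then have "comp_fsum W v D \<one>\<^bsub>R\<^esub> F = D F" for F
    using apply_one[OF inv_holo_mero, of F] by (auto simp: comp_fsum_def dual_def)
  then show "\<one>\<^bsub>opposite_ring \<D>\<^esub> \<odot>\<^bsub>dist_module W v k i j\<^esub> D = D"
    by (simp add: dist_module_def opposite_ring_def D_ops fun_eq_iff)
qed

end

section \<open>The stabilizer of the singular point\<close>

text \<open>
  A permutation that fixes \<open>v\<close> can only exchange positions with equal entries.  Integral shifts preserve
  integrality of differences, so one-singularity of \<open>x0\<close> leaves only the positions \<open>i\<close>, \<open>j\<close> of row \<open>k\<close>.
\<close>

lemma stab_one_singular: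
  assumes sing: "one_singular x0 k i j" and v: "v \<in> orbit x0" and z: "z1 k i j v = 0"
  shows "stab v = {\<lambda>_. id, row_swap k i j}"
proof
  have ij: "i \<le> k" "j \<le> k" "i \<noteq> j" using sing by (auto simp: one_singular_def)
  have "(\<lambda>_. id) \<in> stab v"
    by (auto simp: stab_def row_perms_def permute_id permutes_id)
  moreover have "row_swap k i j \<in> row_perms"
    using ij by (auto simp: row_perms_def row_swap_def permutes_id intro: permutes_swap_id)
  moreover have "permute (row_swap k i j) v = v"
    using z by (auto simp: vec_eq_iff permute_row_swap_nth[OF ij(1,2)] z1_def Transposition.transpose_def)
  ultimately show "{\<lambda>_. id, row_swap k i j} \<subseteq> stab v" by (auto simp: stab_def)
  show "stab v \<subseteq> {\<lambda>_. id, row_swap k i j}"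
  proof
    fix s assume "s \<in> stab v"
    then have s: "\<And>r. s r permutes {..r}" and sv: "permute s v = v"
      by (auto simp: stab_def row_perms_def)
    obtain \<sigma> where \<sigma>: "v = shift \<sigma> x0" using v by (auto simp: orbit_def)
    have moved: "(r, {s r t, t}) = (k, {i, j})" if "s r t \<noteq> t" for r t
    proof (rule ccontr)
      assume ne: "(r, {s r t, t}) \<noteq> (k, {i, j})"
      have t: "t \<le> r" using that s[of r] by (auto simp: permutes_def)
      then have st: "s r t \<le> r" using permutes_in_image[OF s, of r t] by simp
      have "permute s v $ tp r t = v $ tp r t" using sv by simp
      then have "v $ tp r (s r t) = v $ tp r t" using t by (simp add: permute_def)
      then have "x0 $ tp r (s r t) - x0 $ tp r t = of_int (\<sigma> $ tp r t - \<sigma> $ tp r (s r t))"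
        by (simp add: \<sigma> shift_def algebra_simps)
      then have "x0 $ tp r (s r t) - x0 $ tp r t \<in> \<int>" by (metis Ints_of_int)
      then show False using sing st t that ne unfolding one_singular_def by blast
    qed
    have other: "s r = id" if "r \<noteq> k" for r
      using moved[of r] that by (auto simp: fun_eq_iff)
    have inj: "inj (s k)" using s permutes_inj by blast
    show "s \<in> {\<lambda>_. id, row_swap k i j}"
    proof (cases "s k i = i")
      case True
      have "s k t = t" for t
      proof (rule ccontr)
        assume a: "s k t \<noteq> t"
        then have "{s k t, t} = {i, j}" using moved by blast
        moreover have "t \<noteq> i" using a True by auto
        ultimately have "s k t = i" by (auto simp: doubleton_eq_iff)
        then show False using True inj \<open>t \<noteq> i\<close> by (metis injD)
      qed
      then have "s = (\<lambda>_. id)" using other by (auto simp: fun_eq_iff) (metis id_apply)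
      then show ?thesis by simp
    next
      case False
      then have "{s k i, i} = {i, j}" using moved by blast
      then have si: "s k i = j" using False by (auto simp: doubleton_eq_iff)
      have "s k j \<noteq> j" using si inj ij(3) by (metis injD)
      then have "{s k j, j} = {i, j}" using moved by blast
      then have sj: "s k j = i" using \<open>s k j \<noteq> j\<close> by (auto simp: doubleton_eq_iff)
      have "s k t = t" if "t \<noteq> i" "t \<noteq> j" for t
        using moved[of k t] that by (auto simp: doubleton_eq_iff)
      then have "s k = Transposition.transpose i j"
        using si sj by (auto simp: fun_eq_iff Transposition.transpose_def)
      then have "s = row_swap k i j" using other by (auto simp: fun_eq_iff row_swap_def)
      then show ?thesis by simp
    qed
  qed
qed

theorem proposition2:
  fixes x0 v :: "'n::{finite,linorder} tableau" and W :: "'n tableau set" and k i j :: 'n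
  assumes "CARD('n) \<ge> 2"
    and "one_singular x0 k i j"
    and "v \<in> orbit x0" and "z1 k i j v = 0"
    and "open W" and "orbit v \<subseteq> W"
    and "\<And>\<sigma>. \<sigma> \<in> shifts \<Longrightarrow> shift \<sigma> ` W = W"
    and "permute (row_swap k i j) ` W = W"
    and "\<And>x r s t. \<lbrakk>x \<in> W; s \<le> r; t \<le> r; s \<noteq> t; (r, {s, t}) \<noteq> (k, {i, j})\<rbrakk> \<Longrightarrow>
           x $ tp r s - x $ tp r t \<noteq> 0"
  defines "D1 \<equiv> dist1 W v k i j" and "D2 \<equiv> dist2 W v k i j"
    and "B \<equiv> dist_basis W v k i j" and "S \<equiv> dist_module W v k i j"
    and "\<D> \<equiv> univ_ring W v k i j"
    and "g \<equiv> \<lambda>h. mero_nf W (\<lambda>x. z1 k i j x * h x)"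
  shows "(\<forall>h \<in> carrier \<D>.
            (\<forall>F \<in> inv_holo W v. apply_fsum W h F \<in> inv_holo W v) \<and>
            (\<forall>\<sigma>. holo_at (g (h \<sigma>)) v) \<and>
            comp_fsum W v (ev W v) h =
              (\<Sum>\<sigma> | h \<sigma> \<noteq> 0. fscale (g (h \<sigma>) v) (D2 \<sigma>)) +
              (\<Sum>\<sigma> | h \<sigma> \<noteq> 0. fscale (dz1 k i j (g (h \<sigma>)) v) (D1 \<sigma>)) \<and>
            (\<forall>\<sigma>. holo_at (h \<sigma>) v \<longrightarrow> g (h \<sigma>) v = 0 \<and> dz1 k i j (g (h \<sigma>)) v = h \<sigma> v)) \<and>
         left_module (opposite_ring \<D>) S \<and>
         carrier S \<subseteq> dual (inv_holo W v) \<and>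
         functional.independent B \<and> functional.span B = carrier S"
proof -
  have "shift 0 v \<in> orbit v" unfolding orbit_def by (rule imageI) simp
  then have "v \<in> W" using assms(6) by auto
  then interpret swap_domain W v k i j
    using assms(2-5,7,8) stab_one_singular[OF assms(2-4)]
    by unfold_locales (auto simp: one_singular_def)
  show ?thesis
    unfolding assms(10-15)
    using D_action D_numerators(1) ev_comp_formula holomorphic_coefficient
      left_module_dist span_dual independent_basis
    by (simp add: dist_module_def)
qed

end
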